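(* Let $G$ be a locally compact groupoid over a paracompact space $X$, and suppose that the stability groupoid $G'=\{g\in G: r(g)=s(g)\}$ has open range map (i.e. the restriction $r|_{G'}:G'\to X$ is an open map). Let $\overline G=G/\!\sim$, where $g\sim h$ iff $r(g)=r(h)$ and $s(g)=s(h)$, be equipped with the quotient topology and the groupoid structure $[g][h]=[gh]$ for composable $g,h$ (with the same base $X$, range $r([g])=r(g)$ and source $s([g])=s(g)$). Then: (a) $\overline G$ is a locally compact groupoid, and the quotient map $G\to\overline G$ is open; (b) if the range map of $G$ is open, then so is the range map of $\overline G$; (c) if $\overline G$ admits a Haar system, then $G$ admits a Haar system.
   Context: A groupoid over a set $X$ is a small category with object set $X$ in which every arrow is invertible; $G$ denotes its set of arrows, with range and source maps $r,s:G\to X$, identity map $\varepsilon:X\to G$, composition $m$ defined on the set $G^{(2)}=\{(\alpha,\beta)\in G\times G: s(\alpha)=r(\beta)\}$ of composable pairs, and inversion $\iota$. A topological groupoid is a groupoid with topologies on $G$ and $X$ making $r,s,\varepsilon,m,\iota$ continuous ($G^{(2)}$ carries the subspace topology of $G\times G$). A locally compact groupoid is a topological groupoid in which $G$ and $X$ are locally compact Hausdorff spaces. The stability groupoid $G'$ is a closed subgroupoid of $G$ (a bundle of groups $G_x^x$ over $X$). For $x,y\in X$ write $G^x=\{g\in G: r(g)=x\}$ and $G_y^x=\{g\in G: s(g)=y,\ r(g)=x\}$. A Haar system on a locally compact groupoid $G$ is a family $(\mu^x)_{x\in X}$ of Radon measures on $G$ such that (a) $\operatorname{supp}(\mu^x)=G^x$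 for every $x\in X$; (b) $\int_G\phi(\alpha g)\,d\mu^{y}(g)=\int_G\phi(g)\,d\mu^{x}(g)$ for every $\phi\in C_c(G)$ and every $\alpha\in G_y^x$; (c) for every $\phi\in C_c(G)$ the map $x\mapsto\int_G\phi(g)\,d\mu^x(g)$ is continuous on $X$. *)

theory Defs
  imports "HOL-Analysis.Analysis" "HOL-Probability.Probability"
begin

definition groupoid ::
  "'g set \<Rightarrow> 'x set \<Rightarrow> ('g \<Rightarrow> 'x) \<Rightarrow> ('g \<Rightarrow> 'x) \<Rightarrow> ('x \<Rightarrow> 'g)
   \<Rightarrow> ('g \<Rightarrow> 'g \<Rightarrow> 'g) \<Rightarrow> ('g \<Rightarrow> 'g) \<Rightarrow> bool" where
  "groupoid Gs Xs r s e m i \<longleftrightarrow>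
     (\<forall>g\<in>Gs. r g \<in> Xs \<and> s g \<in> Xs) \<and>
     (\<forall>x\<in>Xs. e x \<in> Gs \<and> r (e x) = x \<and> s (e x) = x) \<and>
     (\<forall>a\<in>Gs. \<forall>b\<in>Gs. s a = r b \<longrightarrow> m a b \<in> Gs \<and> r (m a b) = r a \<and> s (m a b) = s b) \<and>
     (\<forall>a\<in>Gs. \<forall>b\<in>Gs. \<forall>c\<in>Gs. s a = r b \<longrightarrow> s b = r c \<longrightarrow> m (m a b) c = m a (m b c)) \<and>
     (\<forall>g\<in>Gs. m (e (r g)) g = g \<and> m g (e (s g)) = g) \<and>
     (\<forall>g\<in>Gs. i g \<in> Gs \<and> r (i g) = s g \<and> s (i g) = r g \<and>
              m g (i g) = e (r g) \<and> m (i g) g = e (s g))"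

definition composable :: "'g set \<Rightarrow> ('g \<Rightarrow> 'x) \<Rightarrow> ('g \<Rightarrow> 'x) \<Rightarrow> ('g \<times> 'g) set" where
  "composable Gs r s = {(a, b). a \<in> Gs \<and> b \<in> Gs \<and> s a = r b}"

definition topological_groupoid ::
  "'g topology \<Rightarrow> 'x topology \<Rightarrow> ('g \<Rightarrow> 'x) \<Rightarrow> ('g \<Rightarrow> 'x) \<Rightarrow> ('x \<Rightarrow> 'g)
   \<Rightarrow> ('g \<Rightarrow> 'g \<Rightarrow> 'g) \<Rightarrow> ('g \<Rightarrow> 'g) \<Rightarrow> bool" where
  "topological_groupoid TG TX r s e m i \<longleftrightarrow>
     groupoid (topspace TG) (topspace TX) r s e m i \<and>
     continuous_map TG TX r \<and> continuous_map TG TX s \<and> continuous_map TX TG e \<and>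
     continuous_map (subtopology (prod_topology TG TG) (composable (topspace TG) r s)) TG
        (\<lambda>(a, b). m a b) \<and>
     continuous_map TG TG i"

definition locally_compact_groupoid ::
  "'g topology \<Rightarrow> 'x topology \<Rightarrow> ('g \<Rightarrow> 'x) \<Rightarrow> ('g \<Rightarrow> 'x) \<Rightarrow> ('x \<Rightarrow> 'g)
   \<Rightarrow> ('g \<Rightarrow> 'g \<Rightarrow> 'g) \<Rightarrow> ('g \<Rightarrow> 'g) \<Rightarrow> bool" where
  "locally_compact_groupoid TG TX r s e m i \<longleftrightarrow>
     topological_groupoid TG TX r s e m i \<and>
     locally_compact_space TG \<and> Hausdorff_space TG \<and>
     locally_compact_space TX \<and> Hausdorff_space TX"

definition paracompact_space :: "'a topology \<Rightarrow> bool" where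
  "paracompact_space X \<longleftrightarrow> Hausdorff_space X \<and>
     (\<forall>\<U>. (\<forall>U\<in>\<U>. openin X U) \<and> topspace X \<subseteq> \<Union>\<U> \<longrightarrow>
        (\<exists>\<V>. (\<forall>V\<in>\<V>. openin X V) \<and> topspace X \<subseteq> \<Union>\<V> \<and>
              (\<forall>V\<in>\<V>. \<exists>U\<in>\<U>. V \<subseteq> U) \<and>
              (\<forall>x\<in>topspace X. \<exists>W. openin X W \<and> x \<in> W \<and> finite {V\<in>\<V>. V \<inter> W \<noteq> {}})))"

definition radon_measure :: "'a topology \<Rightarrow> 'a measure \<Rightarrow> bool" where
  "radon_measure X M \<longleftrightarrow>
     space M = topspace X \<and>
     sets M = sigma_sets (topspace X) {U. openin X U} \<and>
     (\<forall>K. compactin X K \<longrightarrow> emeasure M K < \<infinity>) \<and>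
     (\<forall>A\<in>sets M. emeasure M A = (INF U\<in>{U. openin X U \<and> A \<subseteq> U}. emeasure M U)) \<and>
     (\<forall>U. openin X U \<longrightarrow> emeasure M U = (SUP K\<in>{K. compactin X K \<and> K \<subseteq> U}. emeasure M K))"

definition measure_support :: "'a topology \<Rightarrow> 'a measure \<Rightarrow> 'a set" where
  "measure_support X M = {g \<in> topspace X. \<forall>U. openin X U \<and> g \<in> U \<longrightarrow> emeasure M U > 0}"

definition Cc :: "'a topology \<Rightarrow> ('a \<Rightarrow> complex) set" where
  "Cc X = {\<phi>. continuous_map X euclidean \<phi> \<and>
              (\<exists>K. compactin X K \<and> (\<forall>g\<in>topspace X - K. \<phi> g = 0))}"

definition haar_system ::
  "'g topology \<Rightarrow> 'x topology \<Rightarrow> ('g \<Rightarrow> 'x) \<Rightarrow> ('g \<Rightarrow> 'x) \<Rightarrow> ('g \<Rightarrow> 'g \<Rightarrow> 'g)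
   \<Rightarrow> ('x \<Rightarrow> 'g measure) \<Rightarrow> bool" where
  "haar_system TG TX r s m \<mu> \<longleftrightarrow>
     (\<forall>x\<in>topspace TX. radon_measure TG (\<mu> x)) \<and>
     (\<forall>x\<in>topspace TX. measure_support TG (\<mu> x) = {g \<in> topspace TG. r g = x}) \<and>
     (\<forall>\<phi>\<in>Cc TG. \<forall>\<alpha>\<in>topspace TG.
        integral\<^sup>L (\<mu> (s \<alpha>)) (\<lambda>g. if g \<in> topspace TG \<and> r g = s \<alpha> then \<phi> (m \<alpha> g) else 0)
        = integral\<^sup>L (\<mu> (r \<alpha>)) \<phi>) \<and>
     (\<forall>\<phi>\<in>Cc TG. continuous_map TX euclidean (\<lambda>x. integral\<^sup>L (\<mu> x) \<phi>))"

definition arrow_class :: "'g set \<Rightarrow> ('g \<Rightarrow> 'x) \<Rightarrow> ('g \<Rightarrow> 'x) \<Rightarrow> 'g \<Rightarrow> 'g set" where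
  "arrow_class Gs r s g = {h \<in> Gs. r h = r g \<and> s h = s g}"

definition qr :: "('g \<Rightarrow> 'x) \<Rightarrow> 'g set \<Rightarrow> 'x" where
  "qr r C = r (SOME g. g \<in> C)"

definition qe :: "'g set \<Rightarrow> ('g \<Rightarrow> 'x) \<Rightarrow> ('g \<Rightarrow> 'x) \<Rightarrow> ('x \<Rightarrow> 'g) \<Rightarrow> 'x \<Rightarrow> 'g set" where
  "qe Gs r s e x = arrow_class Gs r s (e x)"

definition qm :: "'g set \<Rightarrow> ('g \<Rightarrow> 'x) \<Rightarrow> ('g \<Rightarrow> 'x) \<Rightarrow> ('g \<Rightarrow> 'g \<Rightarrow> 'g)
   \<Rightarrow> 'g set \<Rightarrow> 'g set \<Rightarrow> 'g set" where
  "qm Gs r s m C D = arrow_class Gs r s (m (SOME g. g \<in> C) (SOME h. h \<in> D))"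

definition qi :: "'g set \<Rightarrow> ('g \<Rightarrow> 'x) \<Rightarrow> ('g \<Rightarrow> 'x) \<Rightarrow> ('g \<Rightarrow> 'g) \<Rightarrow> 'g set \<Rightarrow> 'g set" where
  "qi Gs r s i C = arrow_class Gs r s (i (SOME g. g \<in> C))"

end

(* A left Haar functional I_x on each stability group G(x) = {g. r g = s g = x} is obtained from
   Weil's covering numbers by compactness.  For f and F in C_c(G) with F(e x0) > 0 the ratio
   I_x f / I_x F is continuous at x0: on the group G(x0) both f and F are uniformly close to
   combinations of translates of one bump function phi near the unit, and since r restricted to the
   stability groupoid is open these approximations persist on the groups G(x) with x near x0.
   Paracompactness of the base glues the local normalisations, so that x |-> I_x f is continuous for
   every f in C_c(G).

   For g in G let Phi f g = I_{s g} (h |-> f (g h)).  By left invariance Phi f depends only on the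
   class of g, and it is a member of C_c of the quotient.  Given a Haar system mu on the quotient,
   f |-> integral of Phi f with respect to mu_x is a positive functional, and its Riesz measures nu_x
   form a Haar system of G.  No modular function enters, because only left translates of the Haar
   measures of the stability groups occur.

   The quotient map is open because the saturation of an open set U is the product of U with the
   stability groupoid; the quotient is Hausdorff because (r, s) maps it injectively to X x X. *)
theory Submission
  imports Defs
begin

section \<open>Nonnegative functions of compact support\<close>

text \<open>Haar functionals on different stability groups are chosen independently, each fixed only
  up to a positive factor, so the values \<open>J x f\<close> cannot be compared across base points.
  Every error is therefore measured against \<open>J x F\<close> for one reference function F, and
  continuity is first obtained for ratios only. The second obstacle is that an element of G(x0) does
  not act on G(x), and that h |-> f (g h) is defined only on one fibre of r. Such functions are
  extended from a closed fibre to all of G by Tietze's theorem, and an element of G(x0) is replaced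
  by a nearby element of G(x); this is where openness of r on the stability groupoid enters the
  continuity proof. Functionals live on the cone of nonnegative functions, which suits covering
  numbers; complex functions are recovered at the end from four nonnegative parts. No countability
  is assumed on G, so arguments about null sets rest on compact inner regularity of open
  sets.\<close>

definition Ccp :: "'a topology \<Rightarrow> ('a \<Rightarrow> real) set" where
  "Ccp X = {f. continuous_map X euclideanreal f \<and> (\<forall>x\<in>topspace X. 0 \<le> f x) \<and>
              (\<exists>K. compactin X K \<and> (\<forall>x\<in>topspace X - K. f x = 0))}"

lemma CcpI:
  assumes "continuous_map X euclideanreal f" "\<And>x. x \<in> topspace X \<Longrightarrow> 0 \<le> f x"
    "compactin X K" "\<And>x. x \<in> topspace X \<Longrightarrow> x \<notin> K \<Longrightarrow> f x = 0"
  shows "f \<in> Ccp X"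
  using assms unfolding Ccp_def by blast

lemma CcpD:
  assumes "f \<in> Ccp X"
  shows "continuous_map X euclideanreal f" "\<And>x. x \<in> topspace X \<Longrightarrow> 0 \<le> f x"
  using assms unfolding Ccp_def by auto

lemma Ccp_supp:
  assumes "f \<in> Ccp X"
  obtains K where "compactin X K" "\<And>x. x \<in> topspace X \<Longrightarrow> x \<notin> K \<Longrightarrow> f x = 0"
  using assms unfolding Ccp_def by blast

text \<open>Domination concerns zero sets, not values: a compact set off which f vanishes serves for
  g as well. Closure of the cone under products and truncated differences reduces to this.\<close>

lemma Ccp_dominated:
  assumes f: "f \<in> Ccp X" and g: "continuous_map X euclideanreal g"
    and g0: "\<And>x. x \<in> topspace X \<Longrightarrow> 0 \<le> g x"
    and fg: "\<And>x. x \<in> topspace X \<Longrightarrow> f x = 0 \<Longrightarrow> g x = 0"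
  shows "g \<in> Ccp X"
  using Ccp_supp[OF f] CcpI[OF g g0] fg by metis

lemma Ccp_zero: "(\<lambda>x. 0) \<in> Ccp X"
  by (rule CcpI[of _ _ "{}"]) auto

lemma Ccp_add:
  assumes f: "f \<in> Ccp X" and g: "g \<in> Ccp X"
  shows "(\<lambda>x. f x + g x) \<in> Ccp X"
proof -
  obtain K where K: "compactin X K" "\<And>x. x \<in> topspace X \<Longrightarrow> x \<notin> K \<Longrightarrow> f x = 0"
    using Ccp_supp[OF f] by metis
  obtain L where L: "compactin X L" "\<And>x. x \<in> topspace X \<Longrightarrow> x \<notin> L \<Longrightarrow> g x = 0"
    using Ccp_supp[OF g] by metis
  show ?thesis
    by (rule CcpI[of _ _ "K \<union> L"])
      (use K L CcpD[OF f] CcpD[OF g] in \<open>auto intro!: continuous_intros compactin_Un\<close>)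
qed

lemma Ccp_mult:
  assumes f: "f \<in> Ccp X" and g: "continuous_map X euclideanreal g"
    "\<And>x. x \<in> topspace X \<Longrightarrow> 0 \<le> g x"
  shows "(\<lambda>x. f x * g x) \<in> Ccp X"
  by (rule Ccp_dominated[OF f]) (use CcpD[OF f] g in \<open>auto intro!: continuous_intros\<close>)

lemma Ccp_scale:
  assumes f: "f \<in> Ccp X" and "0 \<le> c"
  shows "(\<lambda>x. c * f x) \<in> Ccp X"
  by (rule Ccp_dominated[OF f]) (use CcpD[OF f] assms in \<open>auto intro!: continuous_intros\<close>)

lemma Ccp_sum:
  assumes "finite A" "\<And>a. a \<in> A \<Longrightarrow> f a \<in> Ccp X"
  shows "(\<lambda>x. \<Sum>a\<in>A. f a x) \<in> Ccp X"
  using assms by (induction rule: finite_induct) (auto intro: Ccp_zero Ccp_add)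

lemma Ccp_pos_diff:
  assumes f: "f \<in> Ccp X" and g: "continuous_map X euclideanreal g"
    "\<And>x. x \<in> topspace X \<Longrightarrow> 0 \<le> g x"
  shows "(\<lambda>x. max 0 (f x - g x)) \<in> Ccp X"
  by (rule Ccp_dominated[OF f]) (use CcpD[OF f] g in \<open>auto intro!: continuous_intros\<close>)

lemma Ccp_abs_diff:
  assumes f: "f \<in> Ccp X" and g: "g \<in> Ccp X"
  shows "(\<lambda>x. \<bar>f x - g x\<bar>) \<in> Ccp X"
  by (rule Ccp_dominated[OF Ccp_add[OF f g]])
    (use CcpD[OF f] CcpD[OF g] in \<open>auto intro!: continuous_intros simp: add_nonneg_eq_0_iff\<close>)

lemma Ccp_cong:
  assumes f: "f \<in> Ccp X" and fg: "\<And>x. x \<in> topspace X \<Longrightarrow> f x = g x"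
  shows "g \<in> Ccp X"
proof (rule Ccp_dominated[OF f])
  show "continuous_map X euclideanreal g"
    using continuous_map_eq[OF CcpD(1)[OF f]] fg by blast
qed (use CcpD[OF f] fg in force)+

lemma Ccp_bounded:
  assumes f: "f \<in> Ccp X"
  obtains B where "B > 0" "\<And>x. x \<in> topspace X \<Longrightarrow> f x \<le> B"
proof -
  obtain K where K: "compactin X K" "\<And>x. x \<in> topspace X \<Longrightarrow> x \<notin> K \<Longrightarrow> f x = 0"
    using Ccp_supp[OF f] by metis
  have "compact (f ` K)"
    using image_compactin[OF K(1) CcpD(1)[OF f]] by simp
  then obtain a where a: "\<And>y. y \<in> f ` K \<Longrightarrow> \<bar>y\<bar> \<le> a"
    using compact_imp_bounded bounded_iff by (metis real_norm_def)
  show ?thesis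
  proof (rule that[of "\<bar>a\<bar> + 1"])
    fix x assume "x \<in> topspace X"
    then show "f x \<le> \<bar>a\<bar> + 1"
      by (cases "x \<in> K") (use a[of "f x"] K(2) in force)+
  qed simp
qed

text \<open>Closedness of S keeps the trace of a supporting compact set compact. Stability groups
  are closed, so one function on G can be integrated on all of them.\<close>

lemma Ccp_subtopology:
  assumes f: "f \<in> Ccp X" and S: "closedin X S"
  shows "f \<in> Ccp (subtopology X S)"
proof -
  obtain K where K: "compactin X K" "\<And>x. x \<in> topspace X \<Longrightarrow> x \<notin> K \<Longrightarrow> f x = 0"
    using Ccp_supp[OF f] by metis
  have "compactin X (S \<inter> K)"
    using closed_Int_compactin[OF S K(1)] .
  then have "compactin (subtopology X S) (S \<inter> K)"
    by (simp add: compactin_subtopology)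
  then show ?thesis
    by (rule CcpI[rotated 2])
      (use K CcpD[OF f] continuous_map_from_subtopology in auto)
qed

lemma open_pos_set:
  assumes "continuous_map X euclideanreal f"
  shows "openin X {x \<in> topspace X. (a::real) < f x}"
  using openin_continuous_map_preimage[OF assms, of "{a<..}"] by simp

text \<open>The cover is indexed by the points of K, so the finite subfamily comes with centres in
  K, from which the translating elements of the group arguments are formed.\<close>

lemma compactin_pointwise_subcover:
  assumes K: "compactin X K" and N: "\<And>k. k \<in> K \<Longrightarrow> openin X (N k)" "\<And>k. k \<in> K \<Longrightarrow> k \<in> N k"
  obtains A where "finite A" "A \<subseteq> K" "K \<subseteq> (\<Union>a\<in>A. N a)"
proof -
  have "\<exists>\<F>. finite \<F> \<and> \<F> \<subseteq> N ` K \<and> K \<subseteq> \<Union>\<F>"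
    by (rule compactinD[OF K]) (use N in auto)
  then obtain \<F> where F: "finite \<F>" "\<F> \<subseteq> N ` K" "K \<subseteq> \<Union>\<F>" by (elim exE conjE)
  obtain A where "finite A" "A \<subseteq> K" "\<F> = N ` A" using finite_subset_image[OF F(1,2)] by auto
  then show ?thesis using that F(3) by blast
qed

section \<open>Urysohn functions, extension and partitions in locally compact Hausdorff
  spaces\<close>

locale lc_Hausdorff =
  fixes X :: "'a topology"
  assumes loc_comp: "locally_compact_space X" and haus: "Hausdorff_space X"
begin

lemma compact_nhd:
  assumes "compactin X K" "openin X U" "K \<subseteq> U"
  obtains V C where "openin X V" "compactin X C" "K \<subseteq> V" "V \<subseteq> C" "C \<subseteq> U"
proof -
  obtain W L where WL: "openin X W" "compactin X L" "K \<subseteq> W" "W \<subseteq> L"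
    using locally_compact_space_compact_closed_compact loc_comp haus assms(1) by metis
  have reg: "regular_space X"
    using locally_compact_Hausdorff_imp_regular_space loc_comp haus by blast
  have UW: "openin X (U \<inter> W)" "K \<subseteq> U \<inter> W" using assms WL by auto
  have "disjnt K (topspace X - U \<inter> W)" using UW by (auto simp: disjnt_def)
  moreover have "closedin X (topspace X - U \<inter> W)" using UW by blast
  ultimately obtain V V' where V: "openin X V" "openin X V'" "K \<subseteq> V" "topspace X - U \<inter> W \<subseteq> V'" "disjnt V V'"
    using regular_space_compact_closed_separation[OF reg assms(1)] by metis
  have "compactin X (L \<inter> (topspace X - V'))"
    using V WL compact_Int_closedin by blast
  moreover have "V \<subseteq> L \<inter> (topspace X - V')" "L \<inter> (topspace X - V') \<subseteq> U"
    using openin_subset[OF V(1)] WL(4) V(4,5) unfolding disjnt_def by blast+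
  ultimately show ?thesis
    using that[OF V(1) _ V(3)] by blast
qed

text \<open>Complete regularity gives f vanishing off an open V with K inside V and V inside a
  compact C. The set C is part of the conclusion because later estimates need a compact support
  inside U, not merely vanishing off U.\<close>

lemma Urysohn_Ccp:
  assumes "compactin X K" "openin X U" "K \<subseteq> U"
  obtains f C where "f \<in> Ccp X" "compactin X C" "C \<subseteq> U" "K \<subseteq> C"
    "\<And>x. x \<in> topspace X \<Longrightarrow> 0 \<le> f x \<and> f x \<le> 1"
    "\<And>x. x \<in> K \<Longrightarrow> f x = 1" "\<And>x. x \<in> topspace X \<Longrightarrow> x \<notin> C \<Longrightarrow> f x = 0"
proof -
  obtain V C where V: "openin X V" "compactin X C" "K \<subseteq> V" "V \<subseteq> C" "C \<subseteq> U"
    using compact_nhd[OF assms] .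
  have "completely_regular_space X"
    using locally_compact_regular_imp_completely_regular_space loc_comp haus by blast
  moreover have "disjnt K (topspace X - V)" using V by (auto simp: disjnt_def)
  moreover have "closedin X (topspace X - V)" using V by blast
  ultimately obtain f where f: "continuous_map X (top_of_set {0..1::real}) f"
    "f ` (topspace X - V) \<subseteq> {0}" "f ` K \<subseteq> {1}"
    using Urysohn_completely_regular_compact_closed[of 0 1 X K "topspace X - V"] assms(1) by force
  have f': "continuous_map X euclideanreal f" "f ` topspace X \<subseteq> {0..1}"
    using f(1) by (auto simp: continuous_map_in_subtopology)
  have "f \<in> Ccp X"
    by (rule CcpI[OF f'(1) _ V(2)]) (use f' f V in force)+
  then show ?thesis
  proof (rule that[of f C])
    show "x \<in> topspace X \<Longrightarrow> 0 \<le> f x \<and> f x \<le> 1" for x using f'(2) by auto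
    show "x \<in> topspace X \<Longrightarrow> x \<notin> C \<Longrightarrow> f x = 0" for x using f(2) V(4) by blast
    show "x \<in> K \<Longrightarrow> f x = 1" for x using f(3) by blast
  qed (use V in auto)
qed

lemma Ccp_one_on:
  assumes "compactin X K"
  obtains f where "f \<in> Ccp X" "\<And>x. x \<in> topspace X \<Longrightarrow> 0 \<le> f x \<and> f x \<le> 1"
    "\<And>x. x \<in> K \<Longrightarrow> f x = 1"
proof -
  have "K \<subseteq> topspace X" using assms by (simp add: compactin_subset_topspace)
  then obtain f where "f \<in> Ccp X" "\<And>x. x \<in> topspace X \<Longrightarrow> 0 \<le> f x \<and> f x \<le> 1"
    "\<And>x. x \<in> K \<Longrightarrow> f x = 1"
    using Urysohn_Ccp[OF assms openin_topspace] by metis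
  then show ?thesis using that by blast
qed

lemma Ccp_extend:
  assumes S: "closedin X S" and f: "f \<in> Ccp (subtopology X S)"
  obtains g where "g \<in> Ccp X" "\<And>x. x \<in> S \<Longrightarrow> g x = f x"
proof -
  have SX: "S \<subseteq> topspace X" using S closedin_subset by blast
  then have tS: "topspace (subtopology X S) = S" by auto
  obtain K where K: "compactin X K" "K \<subseteq> S" "\<And>x. x \<in> S \<Longrightarrow> x \<notin> K \<Longrightarrow> f x = 0"
    using Ccp_supp[OF f] tS compactin_subtopology by metis
  obtain u C where u: "u \<in> Ccp X" "compactin X C" "K \<subseteq> C"
    "\<And>x. x \<in> topspace X \<Longrightarrow> 0 \<le> u x \<and> u x \<le> 1"
    "\<And>x. x \<in> K \<Longrightarrow> u x = 1" "\<And>x. x \<in> topspace X \<Longrightarrow> x \<notin> C \<Longrightarrow> u x = 0"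
    using Urysohn_Ccp[OF K(1) openin_topspace compactin_subset_topspace[OF K(1)]] by metis
  have cr: "completely_regular_space X"
    using locally_compact_regular_imp_completely_regular_space loc_comp haus by blast
  \<comment> \<open>Tietze is applied on the compact set \<open>S \<inter> C\<close> only.
    Multiplication by u repairs the rest of S: f vanishes off K, u is 1 on K, and u vanishes off
    C.\<close>
  have CS: "compactin X (S \<inter> C)" using closed_Int_compactin[OF S u(2)] .
  have "continuous_map (subtopology X (S \<inter> C)) euclideanreal f"
    by (metis CcpD(1)[OF f] continuous_map_from_subtopology subtopology_subtopology)
  moreover have "f ` (S \<inter> C) \<subseteq> {0..}" using CcpD(2)[OF f] tS by auto
  ultimately obtain g where g: "continuous_map X euclideanreal g" "g ` topspace X \<subseteq> {0..}" 
    "\<And>x. x \<in> S \<inter> C \<Longrightarrow> g x = f x"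
    using Tietze_extension_completely_regular[OF cr CS, of "{0..}" f] by auto
  have "(\<lambda>x. u x * g x) \<in> Ccp X"
    by (rule Ccp_mult[OF u(1) g(1)]) (use g(2) in auto)
  moreover have "u x * g x = f x" if "x \<in> S" for x
    using that u SX g K by (cases "x \<in> K"; cases "x \<in> C") (auto simp: subset_iff)
  ultimately show ?thesis using that by blast
qed

text \<open>The part of K outside V is compact in U, so u can be 1 on a neighbourhood W of it and
  supported in U. Then f (1 - u) vanishes on W and is carried by
  \<open>K \<inter> (topspace X - W)\<close>, a compact subset of V.\<close>

lemma Ccp_split:
  assumes f: "f \<in> Ccp X" and K: "compactin X K" "\<And>x. x \<in> topspace X \<Longrightarrow> x \<notin> K \<Longrightarrow> f x = 0"
    and UV: "openin X U" "openin X V" "K \<subseteq> U \<union> V"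
  obtains g h C D where "g \<in> Ccp X" "h \<in> Ccp X" "\<And>x. x \<in> topspace X \<Longrightarrow> f x = g x + h x"
    "compactin X C" "C \<subseteq> U" "\<And>x. x \<in> topspace X \<Longrightarrow> x \<notin> C \<Longrightarrow> g x = 0"
    "compactin X D" "D \<subseteq> V" "\<And>x. x \<in> topspace X \<Longrightarrow> x \<notin> D \<Longrightarrow> h x = 0"
proof -
  have "compactin X (K \<inter> (topspace X - V))" using K(1) UV(2) compact_Int_closedin by blast
  moreover have "K \<inter> (topspace X - V) \<subseteq> U" using UV by auto
  ultimately obtain W L where W: "openin X W" "compactin X L" "K \<inter> (topspace X - V) \<subseteq> W" "W \<subseteq> L" "L \<subseteq> U"
    using compact_nhd[OF _ UV(1)] by metis
  obtain u C where u: "u \<in> Ccp X" "compactin X C" "C \<subseteq> U"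
    "\<And>x. x \<in> topspace X \<Longrightarrow> 0 \<le> u x \<and> u x \<le> 1"
    "\<And>x. x \<in> L \<Longrightarrow> u x = 1" "\<And>x. x \<in> topspace X \<Longrightarrow> x \<notin> C \<Longrightarrow> u x = 0"
    using Urysohn_Ccp[OF W(2) UV(1) W(5)] by metis
  have D: "compactin X (K \<inter> (topspace X - W))" using K(1) W(1) compact_Int_closedin by blast
  have DV: "K \<inter> (topspace X - W) \<subseteq> V" using W by blast
  show ?thesis
  proof (rule that[of "\<lambda>x. f x * u x" "\<lambda>x. f x * (1 - u x)" C "K \<inter> (topspace X - W)"])
    show "(\<lambda>x. f x * u x) \<in> Ccp X"
      by (rule Ccp_mult[OF f]) (use u CcpD[OF u(1)] in auto)
    show "(\<lambda>x. f x * (1 - u x)) \<in> Ccp X"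
      by (rule Ccp_mult[OF f]) (use u CcpD[OF u(1)] in \<open>auto intro!: continuous_intros\<close>)
  qed (use D DV u K W in \<open>auto simp: algebra_simps subset_iff\<close>)
qed

text \<open>Induction on the index set, splitting off one piece at a time. Decomposing f itself, in
  place of the constant 1, makes the pieces add up to f at every point.\<close>

lemma Ccp_partition:
  assumes "finite A" "f \<in> Ccp X" "compactin X K" "\<And>x. x \<in> topspace X \<Longrightarrow> x \<notin> K \<Longrightarrow> f x = 0"
    "\<And>a. a \<in> A \<Longrightarrow> openin X (U a)" "K \<subseteq> (\<Union>a\<in>A. U a)"
  obtains h where "\<And>a. a \<in> A \<Longrightarrow> h a \<in> Ccp X"
    "\<And>a. a \<in> A \<Longrightarrow> \<exists>C. compactin X C \<and> C \<subseteq> U a \<and> (\<forall>x\<in>topspace X - C. h a x = 0)"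
    "\<And>x. x \<in> topspace X \<Longrightarrow> f x = (\<Sum>a\<in>A. h a x)"
proof -
  have "\<exists>h. (\<forall>a\<in>A. h a \<in> Ccp X \<and> (\<exists>C. compactin X C \<and> C \<subseteq> U a \<and> (\<forall>x\<in>topspace X - C. h a x = 0)))
     \<and> (\<forall>x\<in>topspace X. f x = (\<Sum>a\<in>A. h a x))"
    using assms
  proof (induction A arbitrary: f K rule: finite_induct)
    case empty
    then show ?case by auto
  next
    case (insert a A)
    have U: "openin X (U a)" "openin X (\<Union>a\<in>A. U a)" "K \<subseteq> U a \<union> (\<Union>a\<in>A. U a)"
      using insert.prems by auto
    obtain g k C D where gk: "g \<in> Ccp X" "k \<in> Ccp X" "\<And>x. x \<in> topspace X \<Longrightarrow> f x = g x + k x"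
      "compactin X C" "C \<subseteq> U a" "\<And>x. x \<in> topspace X \<Longrightarrow> x \<notin> C \<Longrightarrow> g x = 0"
      "compactin X D" "D \<subseteq> (\<Union>a\<in>A. U a)" "\<And>x. x \<in> topspace X \<Longrightarrow> x \<notin> D \<Longrightarrow> k x = 0"
      by (rule Ccp_split[OF insert.prems(1,2,3) U]) blast+
    obtain h where h: "\<And>a. a \<in> A \<Longrightarrow> h a \<in> Ccp X \<and> (\<exists>C. compactin X C \<and> C \<subseteq> U a \<and> (\<forall>x\<in>topspace X - C. h a x = 0))"
      "\<And>x. x \<in> topspace X \<Longrightarrow> k x = (\<Sum>a\<in>A. h a x)"
      using insert.IH[OF gk(2,7,9) insert.prems(4)[OF insertI2] gk(8)] by blast
    have *: "(\<Sum>b\<in>A. (h(a := g)) b x) = (\<Sum>b\<in>A. h b x)" for x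
      by (rule sum.cong) (use insert.hyps in auto)
    show ?case
    proof (intro exI[of _ "h(a := g)"] conjI ballI)
      fix b assume "b \<in> insert a A"
      show "(h(a := g)) b \<in> Ccp X"
        using h(1)[of b] gk(1) \<open>b \<in> insert a A\<close> by (cases "b = a") auto
      show "\<exists>C. compactin X C \<and> C \<subseteq> U b \<and> (\<forall>x\<in>topspace X - C. (h(a := g)) b x = 0)"
      proof (cases "b = a")
        case True
        then show ?thesis using gk by (intro exI[of _ C]) auto
      next
        case False
        then show ?thesis using h(1)[of b] \<open>b \<in> insert a A\<close> by auto
      qed
    next
      fix x assume "x \<in> topspace X"
      then show "f x = (\<Sum>b\<in>insert a A. (h(a := g)) b x)"
        using gk(3) h(2) * insert.hyps by simp
    qed
  qed
  then show ?thesis using that by metis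
qed

end

text \<open>\<open>mono\<close> compares functions at points of the space only, so L does not see
  values outside \<open>topspace X\<close>; lemma \<open>cong\<close> makes this explicit.\<close>

locale pos_functional = lc_Hausdorff X for X :: "'a topology" +
  fixes L :: "('a \<Rightarrow> real) \<Rightarrow> real"
  assumes add: "f \<in> Ccp X \<Longrightarrow> g \<in> Ccp X \<Longrightarrow> L (\<lambda>x. f x + g x) = L f + L g"
    and scale: "f \<in> Ccp X \<Longrightarrow> 0 \<le> c \<Longrightarrow> L (\<lambda>x. c * f x) = c * L f"
    and mono: "f \<in> Ccp X \<Longrightarrow> g \<in> Ccp X \<Longrightarrow> (\<And>x. x \<in> topspace X \<Longrightarrow> f x \<le> g x) \<Longrightarrow> L f \<le> L g"
begin

lemma zero: "L (\<lambda>x. 0) = 0"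
  using scale[OF Ccp_zero, of 0] by simp

lemma nonneg: "f \<in> Ccp X \<Longrightarrow> 0 \<le> L f"
  using mono[OF Ccp_zero] CcpD(2) zero by force

lemma cong: "f \<in> Ccp X \<Longrightarrow> (\<And>x. x \<in> topspace X \<Longrightarrow> f x = g x) \<Longrightarrow> L f = L g"
  using Ccp_cong[of f X g] by (intro antisym mono) auto

lemma sum: "finite A \<Longrightarrow> (\<And>a. a \<in> A \<Longrightarrow> f a \<in> Ccp X) \<Longrightarrow> L (\<lambda>x. \<Sum>a\<in>A. f a x) = (\<Sum>a\<in>A. L (f a))"
  by (induction rule: finite_induct) (auto simp: zero intro!: add[THEN trans] Ccp_sum)

lemma abs_diff_le:
  assumes f: "f \<in> Ccp X" and g: "g \<in> Ccp X"
  shows "\<bar>L f - L g\<bar> \<le> L (\<lambda>x. \<bar>f x - g x\<bar>)"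
proof -
  let ?d = "\<lambda>x. \<bar>f x - g x\<bar>"
  have d: "?d \<in> Ccp X" using Ccp_abs_diff[OF f g] .
  have "L f \<le> L (\<lambda>x. g x + ?d x)" "L g \<le> L (\<lambda>x. f x + ?d x)"
    by (intro mono f g Ccp_add d; force)+
  then show ?thesis using add f g d by fastforce
qed

text \<open>Positivity turns a pointwise error into an error of L. The error carries a weight h of
  compact support because a constant lies outside the cone when the space is not compact.\<close>

lemma approx:
  assumes f: "f \<in> Ccp X" and g: "g \<in> Ccp X" and h: "h \<in> Ccp X" and "0 \<le> c"
    and "\<And>x. x \<in> topspace X \<Longrightarrow> \<bar>f x - g x\<bar> \<le> c * h x"
  shows "\<bar>L f - L g\<bar> \<le> c * L h"
proof -
  have "L (\<lambda>x. \<bar>f x - g x\<bar>) \<le> L (\<lambda>x. c * h x)"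
    by (intro mono Ccp_abs_diff Ccp_scale assms)
  then show ?thesis using abs_diff_le[OF f g] scale[OF h] assms by simp
qed

end

section \<open>The Riesz representation theorem\<close>

lemma radon_openin_sets:
  assumes "radon_measure X M" "openin X U"
  shows "U \<in> sets M"
  using assms unfolding radon_measure_def by (auto intro: sigma_sets.Basic)

lemma radon_closedin_sets:
  assumes M: "radon_measure X M" and C: "closedin X C"
  shows "C \<in> sets M"
proof -
  have "space M - (topspace X - C) \<in> sets M"
    using radon_openin_sets[OF M] C by (intro sets.compl_sets) auto
  moreover have "space M - (topspace X - C) = C"
    using M closedin_subset[OF C] unfolding radon_measure_def by auto
  ultimately show ?thesis by simp
qed

lemma radon_measurable_continuous:
  assumes M: "radon_measure X M" and f: "continuous_map X euclideanreal f"
  shows "f \<in> borel_measurable M"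
proof -
  have "space M = topspace X" using M unfolding radon_measure_def by blast
  then show ?thesis
    unfolding borel_measurable_iff_greater using radon_openin_sets[OF M open_pos_set[OF f]] by simp
qed

lemma radon_compact_finite:
  assumes "Hausdorff_space X" "radon_measure X M" "compactin X K"
  shows "K \<in> fmeasurable M"
proof (rule fmeasurableI)
  show "K \<in> sets M" using radon_closedin_sets[OF assms(2) compactin_imp_closedin[OF assms(1,3)]] .
  show "emeasure M K < \<infinity>" using assms unfolding radon_measure_def by blast
qed

lemma radon_integrable_Ccp:
  assumes X: "Hausdorff_space X" and M: "radon_measure X M" and f: "f \<in> Ccp X"
  shows "integrable M f"
proof -
  obtain K where K: "compactin X K" "\<And>x. x \<in> topspace X \<Longrightarrow> x \<notin> K \<Longrightarrow> f x = 0"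
    using Ccp_supp[OF f] by metis
  obtain B where B: "B > 0" "\<And>x. x \<in> topspace X \<Longrightarrow> f x \<le> B"
    using Ccp_bounded[OF f] by metis
  have sp: "space M = topspace X" using M unfolding radon_measure_def by blast
  have "integrable M (\<lambda>x. B * indicator K x)"
    using radon_compact_finite[OF X M K(1)]
    by (intro integrable_mult_right integrable_real_indicator) (auto simp: fmeasurable_def)
  then show ?thesis
  proof (rule Bochner_Integration.integrable_bound)
    show "f \<in> borel_measurable M"
      using radon_measurable_continuous[OF M CcpD(1)[OF f]] .
    show "AE x in M. norm (f x) \<le> norm (B * indicator K x)"
    proof (rule AE_I2)
      fix x assume "x \<in> space M"
      then show "norm (f x) \<le> norm (B * indicator K x)"
        using K(2)[of x] B(1) B(2)[of x] CcpD(2)[OF f, of x] sp by (cases "x \<in> K") auto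
    qed
  qed
qed

section \<open>The outer measure of a positive functional\<close>

context pos_functional
begin

(* The relation written f \<prec> U in the classical proof. *)
definition below :: "'a set \<Rightarrow> ('a \<Rightarrow> real) \<Rightarrow> bool" where
  "below U f \<longleftrightarrow> f \<in> Ccp X \<and> (\<forall>x\<in>topspace X. f x \<le> 1) \<and>
     (\<exists>C. compactin X C \<and> C \<subseteq> U \<and> (\<forall>x\<in>topspace X - C. f x = 0))"

definition open_val :: "'a set \<Rightarrow> ennreal" where
  "open_val U = (SUP f\<in>{f. below U f}. ennreal (L f))"

definition outer_val :: "'a set \<Rightarrow> ennreal" where
  "outer_val A = (INF U\<in>{U. openin X U \<and> A \<subseteq> U}. open_val U)"

lemma below_mono: "below U f \<Longrightarrow> U \<subseteq> V \<Longrightarrow> below V f"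
  unfolding below_def by blast

lemma below_zero: "below U (\<lambda>x. 0)"
  unfolding below_def using Ccp_zero by (auto intro!: exI[of _ "{}"])

lemma open_val_upper: "below U f \<Longrightarrow> ennreal (L f) \<le> open_val U"
  unfolding open_val_def by (rule SUP_upper) simp

lemma open_val_mono: "U \<subseteq> V \<Longrightarrow> open_val U \<le> open_val V"
  unfolding open_val_def by (rule SUP_subset_mono) (auto intro: below_mono)

lemma outer_val_open: "openin X U \<Longrightarrow> outer_val U = open_val U"
  unfolding outer_val_def by (intro antisym INF_lower INF_greatest) (auto intro: open_val_mono)

lemma outer_val_le_open_val: "openin X U \<Longrightarrow> A \<subseteq> U \<Longrightarrow> outer_val A \<le> open_val U"
  unfolding outer_val_def by (intro INF_lower) auto

lemma outer_val_mono: "A \<subseteq> B \<Longrightarrow> outer_val A \<le> outer_val B"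
  unfolding outer_val_def by (intro INF_superset_mono) auto

lemma open_val_empty: "open_val {} = 0"
proof -
  have "ennreal (L f) = 0" if "below {} f" for f
  proof -
    from that have "f \<in> Ccp X" "\<And>x. x \<in> topspace X \<Longrightarrow> f x = 0" unfolding below_def by auto
    then have "L f = L (\<lambda>x. 0)" by (rule cong)
    then show ?thesis by (simp add: zero)
  qed
  then have "open_val {} \<le> 0" unfolding open_val_def by (intro SUP_least) auto
  then show ?thesis by simp
qed

text \<open>A compact set carrying f is covered by finitely many \<open>U n\<close>; cutting f into
  pieces subordinate to these turns L f into a finite sum.\<close>

lemma open_val_countable_subadd:
  assumes U: "\<And>n::nat. openin X (U n)"
  shows "open_val (\<Union>n. U n) \<le> (\<Sum>n. open_val (U n))"
  unfolding open_val_def[of "\<Union>n. U n"]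
proof (rule SUP_least)
  fix f assume "f \<in> {f. below (\<Union>n. U n) f}"
  then obtain C where f: "f \<in> Ccp X" "\<And>x. x \<in> topspace X \<Longrightarrow> f x \<le> 1"
    and C: "compactin X C" "C \<subseteq> (\<Union>n. U n)" "\<And>x. x \<in> topspace X \<Longrightarrow> x \<notin> C \<Longrightarrow> f x = 0"
    unfolding below_def by blast
  obtain \<F> where F: "finite \<F>" "\<F> \<subseteq> range U" "C \<subseteq> \<Union>\<F>"
    using C(1,2) U unfolding compactin_def by (metis (no_types, lifting) imageE)
  obtain A where A: "finite A" "\<F> = U ` A" using finite_subset_image[OF F(1,2)] by auto
  have CA: "C \<subseteq> (\<Union>a\<in>A. U a)" using F A by auto
  obtain h where h: "\<And>a. a \<in> A \<Longrightarrow> h a \<in> Ccp X"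
    "\<And>a. a \<in> A \<Longrightarrow> \<exists>C. compactin X C \<and> C \<subseteq> U a \<and> (\<forall>x\<in>topspace X - C. h a x = 0)"
    "\<And>x. x \<in> topspace X \<Longrightarrow> f x = (\<Sum>a\<in>A. h a x)"
    by (rule Ccp_partition[OF A(1) f(1) C(1,3) U CA]) blast+
  have b: "below (U a) (h a)" if "a \<in> A" for a
  proof -
    have "h a x \<le> 1" if "x \<in> topspace X" for x
    proof -
      have "h a x \<le> (\<Sum>a\<in>A. h a x)"
        using A(1) \<open>a \<in> A\<close> CcpD(2)[OF h(1)] that by (intro member_le_sum) auto
      then show ?thesis using f(2) h(3) that by fastforce
    qed
    then show ?thesis unfolding below_def using h(1,2) that by blast
  qed
  have "L f = (\<Sum>a\<in>A. L (h a))"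
    using cong[OF f(1) h(3)] sum[OF A(1) h(1)] by simp
  then have "ennreal (L f) = (\<Sum>a\<in>A. ennreal (L (h a)))"
    using nonneg h(1) by (simp add: sum_ennreal)
  also have "\<dots> \<le> (\<Sum>a\<in>A. open_val (U a))"
    by (intro sum_mono open_val_upper b)
  also have "\<dots> \<le> (\<Sum>n. open_val (U n))"
    by (intro sum_le_suminf A) auto
  finally show "ennreal (L f) \<le> (\<Sum>n. open_val (U n))" .
qed

lemma outer_val_countably_subadditive: "countably_subadditive (Pow (topspace X)) outer_val"
  unfolding countably_subadditive_def
proof (intro allI impI)
  fix A :: "nat \<Rightarrow> 'a set" assume "range A \<subseteq> Pow (topspace X)"
  show "outer_val (\<Union>i. A i) \<le> (\<Sum>i. outer_val (A i))"
  proof (rule ennreal_le_epsilon)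
    fix e :: real assume fin: "(\<Sum>i. outer_val (A i)) < top" and e: "0 < e"
    \<comment> \<open>The excess granted to the n-th set is e/2^(n+1), and these sum to e.
      Finiteness of the series makes every \<open>outer_val (A n)\<close> finite, so the enlarged
      value is strictly larger than the infimum.\<close>
    have "\<exists>U. openin X U \<and> A n \<subseteq> U \<and> open_val U \<le> outer_val (A n) + ennreal (e * (1/2)^Suc n)" for n
    proof -
      have "outer_val (A n) < top" using ennreal_suminf_lessD[OF fin] .
      moreover have "0 < ennreal (e * (1/2)^Suc n)" using e by simp
      ultimately have "outer_val (A n) < outer_val (A n) + ennreal (e * (1/2)^Suc n)"
        by (metis add.right_neutral ennreal_add_left_cancel_less infinity_ennreal_def less_irrefl)
      then show ?thesis
        unfolding outer_val_def[of "A n"] INF_less_iff by (auto intro: less_imp_le)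
    qed
    then obtain U where U: "\<And>n. openin X (U n)" "\<And>n. A n \<subseteq> U n" 
      "\<And>n. open_val (U n) \<le> outer_val (A n) + ennreal (e * (1/2)^Suc n)" by metis
    have "outer_val (\<Union>i. A i) \<le> open_val (\<Union>n. U n)"
      using U(1,2) by (intro outer_val_le_open_val) auto
    also have "\<dots> \<le> (\<Sum>n. open_val (U n))"
      using open_val_countable_subadd U(1) by blast
    also have "\<dots> \<le> (\<Sum>n. outer_val (A n) + ennreal (e * (1/2)^Suc n))"
      by (intro suminf_le U(3)) auto
    also have "\<dots> = (\<Sum>n. outer_val (A n)) + (\<Sum>n. ennreal (e * (1/2)^Suc n))"
      by (intro suminf_add[symmetric]) auto
    also have "(\<Sum>n. ennreal (e * (1/2)^Suc n)) = ennreal e"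
    proof -
      have "(\<lambda>n. e * (1/2)^Suc n) sums (e * 1)"
        using power_half_series by (intro sums_mult)
      then show ?thesis using e by (intro suminf_ennreal_eq) auto
    qed
    finally show "outer_val (\<Union>i. A i) \<le> (\<Sum>i. outer_val (A i)) + ennreal e" .
  qed
qed

lemma outer_val_outer_measure: "outer_measure_space (Pow (topspace X)) outer_val"
  unfolding outer_measure_space_def positive_def increasing_def
  using outer_val_countably_subadditive outer_val_mono outer_val_open[of "{}"] open_val_empty by auto

lemma outer_val_Un_le:
  assumes "A \<subseteq> topspace X" "B \<subseteq> topspace X" "A \<inter> B = {}"
  shows "outer_val (A \<union> B) \<le> outer_val A + outer_val B"
proof -
  have "positive (Pow (topspace X)) outer_val"
    using outer_val_outer_measure unfolding outer_measure_space_def by blast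
  then have "subadditive (Pow (topspace X)) outer_val"
    using ring_of_sets.countably_subadditive_subadditive[OF ring_of_sets_Pow] outer_val_countably_subadditive
    by blast
  then show ?thesis using subadditiveD assms by blast
qed

text \<open>Functions with disjoint supports can be added without exceeding 1, so f and any
  competitor for \<open>V - C\<close> together compete for V.\<close>

lemma open_val_split:
  assumes f: "f \<in> Ccp X" "\<And>x. x \<in> topspace X \<Longrightarrow> f x \<le> 1"
    and C: "compactin X C" "C \<subseteq> V" "\<And>x. x \<in> topspace X \<Longrightarrow> x \<notin> C \<Longrightarrow> f x = 0"
  shows "ennreal (L f) + open_val (V - C) \<le> open_val V"
proof -
  have "ennreal (L f) + open_val (V - C) = (SUP g\<in>{g. below (V - C) g}. ennreal (L f) + ennreal (L g))"
    unfolding open_val_def using below_zero by (intro ennreal_SUP_add_right) auto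
  also have "\<dots> \<le> open_val V"
  proof (rule SUP_least)
    fix g assume "g \<in> {g. below (V - C) g}"
    then obtain D where g: "g \<in> Ccp X" "\<And>x. x \<in> topspace X \<Longrightarrow> g x \<le> 1"
      and D: "compactin X D" "D \<subseteq> V - C" "\<And>x. x \<in> topspace X \<Longrightarrow> x \<notin> D \<Longrightarrow> g x = 0"
      unfolding below_def by blast
    have "f x + g x \<le> 1" if "x \<in> topspace X" for x
      using that f(2) g(2) C(3) D by (cases "x \<in> C") force+
    then have "below V (\<lambda>x. f x + g x)"
      unfolding below_def using Ccp_add[OF f(1) g(1)] C D
      by (intro conjI exI[of _ "C \<union> D"]) (auto intro: compactin_Un)
    then have "ennreal (L (\<lambda>x. f x + g x)) \<le> open_val V" by (rule open_val_upper)
    then show "ennreal (L f) + ennreal (L g) \<le> open_val V"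
      using add[OF f(1) g(1)] nonneg f g by simp
  qed
  finally show ?thesis .
qed

text \<open>Caratheodory's criterion. For open V containing A, the value of
  \<open>U \<inter> V\<close> is approached by functions with compact support C inside U; then
  \<open>V - C\<close> is open and still contains the part of A outside U, so
  \<open>open_val_split\<close> bounds both parts together.\<close>

lemma open_in_lambda_system:
  assumes U: "openin X U"
  shows "U \<in> lambda_system (topspace X) (Pow (topspace X)) outer_val"
proof -
  have "outer_val (U \<inter> A) + outer_val ((topspace X - U) \<inter> A) = outer_val A" if A: "A \<subseteq> topspace X" for A
  proof (rule antisym)
    show "outer_val (U \<inter> A) + outer_val ((topspace X - U) \<inter> A) \<le> outer_val A"
      unfolding outer_val_def[of A]
    proof (rule INF_greatest)
      fix V assume "V \<in> {V. openin X V \<and> A \<subseteq> V}"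
      then have V: "openin X V" "A \<subseteq> V" by auto
      have "outer_val (U \<inter> A) + outer_val ((topspace X - U) \<inter> A) \<le> open_val (U \<inter> V) + outer_val ((topspace X - U) \<inter> A)"
        using U V by (intro add_right_mono outer_val_le_open_val) auto
      also have "\<dots> = (SUP f\<in>{f. below (U \<inter> V) f}. ennreal (L f) + outer_val ((topspace X - U) \<inter> A))"
        unfolding open_val_def using below_zero by (intro ennreal_SUP_add_left[symmetric]) auto
      also have "\<dots> \<le> open_val V"
      proof (rule SUP_least)
        fix f assume "f \<in> {f. below (U \<inter> V) f}"
        then obtain C where f: "f \<in> Ccp X" "\<And>x. x \<in> topspace X \<Longrightarrow> f x \<le> 1"
          and C: "compactin X C" "C \<subseteq> U \<inter> V" "\<And>x. x \<in> topspace X \<Longrightarrow> x \<notin> C \<Longrightarrow> f x = 0"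
          unfolding below_def by blast
        have "openin X (V - C)" using V(1) compactin_imp_closedin[OF haus C(1)] by blast
        then have "outer_val ((topspace X - U) \<inter> A) \<le> open_val (V - C)"
          using V(2) C(2) by (intro outer_val_le_open_val) auto
        then have "ennreal (L f) + outer_val ((topspace X - U) \<inter> A) \<le> ennreal (L f) + open_val (V - C)"
          by (rule add_left_mono)
        also have "\<dots> \<le> open_val V"
          using open_val_split[OF f C(1) _ C(3)] C(2) by blast
        finally show "ennreal (L f) + outer_val ((topspace X - U) \<inter> A) \<le> open_val V" .
      qed
      finally show "outer_val (U \<inter> A) + outer_val ((topspace X - U) \<inter> A) \<le> open_val V" .
    qed
    have "A = (U \<inter> A) \<union> ((topspace X - U) \<inter> A)" using A by auto
    then show "outer_val A \<le> outer_val (U \<inter> A) + outer_val ((topspace X - U) \<inter> A)"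
      using outer_val_Un_le[of "U \<inter> A" "(topspace X - U) \<inter> A"] A by fastforce
  qed
  then show ?thesis unfolding lambda_system_def using openin_subset[OF U] by auto
qed

section \<open>The representing measure and its integral\<close>

definition riesz :: "'a measure" where
  "riesz = measure_of (topspace X) (sigma_sets (topspace X) {U. openin X U}) outer_val"

lemma space_riesz [simp]: "space riesz = topspace X"
  unfolding riesz_def by (simp add: space_measure_of_conv)

lemma riesz_sigma: "sigma_algebra (topspace X) (sigma_sets (topspace X) {U. openin X U})"
  using openin_subset by (intro sigma_algebra_sigma_sets) auto

lemma sets_riesz: "sets riesz = sigma_sets (topspace X) {U. openin X U}"
  unfolding riesz_def using sigma_algebra.sets_measure_of_eq[OF riesz_sigma] .

text \<open>\<open>measure_of\<close> takes the prescribed values only once countable additivity is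
  known. Caratheodory's theorem gives it on the sets measurable for the outer measure, and these
  contain the sigma-algebra generated by the open sets.\<close>

lemma emeasure_riesz:
  assumes "A \<in> sets riesz"
  shows "emeasure riesz A = outer_val A"
proof -
  let ?S = "sigma_sets (topspace X) {U. openin X U}"
  have lam: "measure_space (topspace X) (lambda_system (topspace X) (Pow (topspace X)) outer_val) outer_val"
    using sigma_algebra.caratheodory_lemma[OF sigma_algebra_Pow outer_val_outer_measure] .
  then have "?S \<subseteq> lambda_system (topspace X) (Pow (topspace X)) outer_val"
    using open_in_lambda_system unfolding measure_space_def
    by (intro sigma_algebra.sigma_sets_subset) auto
  then have "measure_space (topspace X) ?S outer_val"
    using measure_down[OF lam riesz_sigma] by blast
  then show ?thesis
    unfolding riesz_def using assms sets_riesz unfolding measure_space_def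
    by (intro emeasure_measure_of_sigma) auto
qed

text \<open>For a < 1 the open set where f exceeds a contains K, and a competitor there is at most
  f/a; then a tends to 1. The set where f \<ge> 1 itself need not be open.\<close>

lemma outer_val_compact_le:
  assumes f: "f \<in> Ccp X" and K: "K \<subseteq> topspace X" "\<And>x. x \<in> K \<Longrightarrow> 1 \<le> f x"
  shows "outer_val K \<le> ennreal (L f)"
proof -
  have *: "outer_val K \<le> ennreal (L f / a)" if a: "0 < a" "a < 1" for a :: real
  proof -
    let ?U = "{x \<in> topspace X. a < f x}"
    have "outer_val K \<le> open_val ?U"
      using open_pos_set[OF CcpD(1)[OF f]] K a by (intro outer_val_le_open_val) force+
    also have "\<dots> \<le> ennreal (L f / a)"
      unfolding open_val_def
    proof (rule SUP_least)
      fix g assume "g \<in> {g. below ?U g}"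
      then obtain C where g: "g \<in> Ccp X" "\<And>x. x \<in> topspace X \<Longrightarrow> g x \<le> 1"
        and C: "compactin X C" "C \<subseteq> ?U" "\<And>x. x \<in> topspace X \<Longrightarrow> x \<notin> C \<Longrightarrow> g x = 0"
        unfolding below_def by blast
      have "g x \<le> (1/a) * f x" if "x \<in> topspace X" for x
      proof (cases "x \<in> C")
        case True
        then have "a < f x" using C by auto
        then have "1 \<le> (1/a) * f x" using a by (simp add: field_simps)
        then show ?thesis using g(2)[OF that] by simp
      next
        case False
        then show ?thesis using C(3)[OF that] CcpD(2)[OF f that] a by simp
      qed
      then have "L g \<le> L (\<lambda>x. (1/a) * f x)" using a by (intro mono g Ccp_scale f) auto
      then show "ennreal (L g) \<le> ennreal (L f / a)" using scale[OF f, of "1/a"] a by (intro ennreal_leI) simp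
    qed
    finally show ?thesis .
  qed
  have "outer_val K < top" using *[of "1/2"] by (simp add: le_less_trans)
  then obtain r where r: "outer_val K = ennreal r" "0 \<le> r" by (cases "outer_val K") auto
  have "r * a \<le> L f" if a: "0 < a" "a < 1" for a
    using *[OF a] r a nonneg[OF f] by (simp add: ennreal_le_iff field_simps)
  then have "r \<le> L f"
    using field_le_mult_one_interval[of r "L f"] by (metis mult.commute)
  then show ?thesis using r by (simp add: ennreal_leI)
qed

text \<open>\<open>below\<close> makes sense for sets that are not open. For a compact C this bounds
  its measure from below, which yields inner regularity and one half of the integral
  formula.\<close>

lemma L_le_outer_val:
  assumes "below C f"
  shows "ennreal (L f) \<le> outer_val C"
  unfolding outer_val_def by (rule INF_greatest) (auto intro!: open_val_upper below_mono[OF assms])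

lemma compact_sets_riesz: "compactin X K \<Longrightarrow> K \<in> sets riesz"
  unfolding sets_riesz using compactin_imp_closedin[OF haus]
  by (metis closedin_def double_diff equalityD1 sigma_sets.Basic sigma_sets.Compl mem_Collect_eq closedin_subset)

lemma radon_riesz: "radon_measure X riesz"
  unfolding radon_measure_def
proof (intro conjI allI impI ballI)
  show "space riesz = topspace X" "sets riesz = sigma_sets (topspace X) {U. openin X U}"
    by (simp_all add: sets_riesz)
next
  fix K assume K: "compactin X K"
  obtain f where "f \<in> Ccp X" "\<And>x. x \<in> K \<Longrightarrow> f x = 1" using Ccp_one_on[OF K] by metis
  then have "outer_val K \<le> ennreal (L f)" using compactin_subset_topspace[OF K] by (intro outer_val_compact_le) auto
  then show "emeasure riesz K < \<infinity>"
    using emeasure_riesz[OF compact_sets_riesz[OF K]] by (simp add: le_less_trans)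
next
  have o: "emeasure riesz U = open_val U" if "openin X U" for U
    using emeasure_riesz[of U] outer_val_open[OF that] that by (simp add: sets_riesz sigma_sets.Basic)
  fix A assume "A \<in> sets riesz"
  then show "emeasure riesz A = (INF U\<in>{U. openin X U \<and> A \<subseteq> U}. emeasure riesz U)"
    using emeasure_riesz o unfolding outer_val_def by (auto intro!: INF_cong)
next
  fix U assume U: "openin X U"
  have US: "U \<in> sets riesz" using U by (simp add: sets_riesz sigma_sets.Basic)
  show "emeasure riesz U = (SUP K\<in>{K. compactin X K \<and> K \<subseteq> U}. emeasure riesz K)"
  proof (rule antisym)
    show "emeasure riesz U \<le> (SUP K\<in>{K. compactin X K \<and> K \<subseteq> U}. emeasure riesz K)"
      unfolding emeasure_riesz[OF US] outer_val_open[OF U] open_val_def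
    proof (rule SUP_least)
      fix f assume "f \<in> {f. below U f}"
      then obtain C where "below C f" and C: "compactin X C" "C \<subseteq> U" unfolding below_def by blast
      then have "ennreal (L f) \<le> emeasure riesz C"
        using L_le_outer_val emeasure_riesz[OF compact_sets_riesz[OF C(1)]] by simp
      then show "ennreal (L f) \<le> (SUP K\<in>{K. compactin X K \<and> K \<subseteq> U}. emeasure riesz K)"
        using C by (intro SUP_upper2[of C]) auto
    qed
    show "(SUP K\<in>{K. compactin X K \<and> K \<subseteq> U}. emeasure riesz K) \<le> emeasure riesz U"
      by (rule SUP_least) (auto intro!: emeasure_mono US)
  qed
qed

text \<open>f is cut into horizontal layers \<open>g j\<close> of height \<delta>. Both
  \<open>L (g j)\<close> and the integral of \<open>g j\<close> lie between \<delta> times the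
  measures of \<open>E (Suc j)\<close> and of \<open>E j\<close>, and these gaps telescope to at
  most \<delta> times the measure of a supporting compact set.\<close>

lemma integral_riesz:
  assumes f: "f \<in> Ccp X"
  shows "integral\<^sup>L riesz f = L f"
proof -
  obtain C where C: "compactin X C" "\<And>x. x \<in> topspace X \<Longrightarrow> x \<notin> C \<Longrightarrow> f x = 0"
    using Ccp_supp[OF f] by metis
  obtain B where B: "B > 0" "\<And>x. x \<in> topspace X \<Longrightarrow> f x \<le> B"
    using Ccp_bounded[OF f] by metis
  let ?m = "\<lambda>A. measure riesz A"
  have key: "\<bar>L f - integral\<^sup>L riesz f\<bar> \<le> \<delta> * ?m C" if d: "0 < \<delta>" for \<delta>
  proof -
    obtain N :: nat where N: "B < real N * \<delta>" using reals_Archimedean3[OF d] by blast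
    define g where "g j x = min \<delta> (max 0 (f x - real j * \<delta>))" for j :: nat and x
    \<comment> \<open>\<open>E 0\<close> is a compact support in place of the set where f \<ge> 0,
      which is the whole space.\<close>
    define E where "E j = (if j = 0 then C else {x \<in> topspace X. real j * \<delta> \<le> f x})" for j :: nat
    have gC: "g j \<in> Ccp X" for j
      unfolding g_def
    proof (rule Ccp_dominated[OF f])
      show "continuous_map X euclideanreal (\<lambda>x. min \<delta> (max 0 (f x - real j * \<delta>)))"
        using CcpD(1)[OF f] by (intro continuous_intros) auto
      show "min \<delta> (max 0 (f x - real j * \<delta>)) = 0" if "f x = 0" for x
      proof -
        have "0 \<le> real j * \<delta>" using d by simp
        then show ?thesis using d that by linarith
      qed
    qed (use d in simp)
    have Ecl: "compactin X (E j)" for j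
    proof (cases "j = 0")
      case False
      have "closedin X {x \<in> topspace X. f x \<in> {real j * \<delta>..}}"
        by (rule closedin_continuous_map_preimage[OF CcpD(1)[OF f]]) simp
      moreover have "E j \<subseteq> C"
        using C(2) False d unfolding E_def by (auto, metis mult_pos_pos not_less of_nat_0_less_iff)
      ultimately show ?thesis using closed_compactin[OF C(1)] False unfolding E_def by simp
    qed (simp add: E_def C)
    have Ef: "E j \<in> fmeasurable riesz" for j
      using radon_compact_finite[OF haus radon_riesz Ecl] .
    have em: "outer_val (E j) = ennreal (?m (E j))" for j
      using emeasure_eq_measure2[OF Ef[of j]] emeasure_riesz Ef by (metis fmeasurableD)
    \<comment> \<open>The first n layers add up to f truncated at height n \<delta>; since f stays
      below N \<delta>, the first N layers recover f.\<close>
    have s: "(\<Sum>j<n. g j x) = min (real n * \<delta>) (f x)" if "x \<in> topspace X" for n x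
      by (induction n) (use CcpD(2)[OF f that] d in \<open>auto simp: g_def min_def max_def algebra_simps\<close>)
    have fs: "f x = (\<Sum>j<N. g j x)" if "x \<in> topspace X" for x
      using s[OF that] B(2)[OF that] N by simp
    have in_E: "g j x = \<delta>" if "x \<in> E (Suc j)" for x j
      using that unfolding g_def E_def by (auto simp: min_def max_def algebra_simps)
    have out_E: "g j x = 0" if "x \<in> topspace X" "x \<notin> E j" for x j
      using that C(2)[of x] d unfolding g_def E_def by (auto simp: min_def max_def split: if_splits)
    have g_bd: "0 \<le> g j x" "g j x \<le> \<delta>" for j x using d unfolding g_def by auto
    have L1: "\<delta> * ?m (E (Suc j)) \<le> L (g j)" for j
    proof -
      have "outer_val (E (Suc j)) \<le> ennreal (L (\<lambda>x. (1/\<delta>) * g j x))"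
        using d compactin_subset_topspace[OF Ecl] in_E by (intro outer_val_compact_le Ccp_scale gC) auto
      then have "?m (E (Suc j)) \<le> (1/\<delta>) * L (g j)"
        using em scale[OF gC, of "1/\<delta>"] d nonneg[OF gC, of j] by (simp add: ennreal_le_iff)
      then show ?thesis using d by (simp add: field_simps)
    qed
    have L2: "L (g j) \<le> \<delta> * ?m (E j)" for j
    proof -
      have "below (E j) (\<lambda>x. (1/\<delta>) * g j x)"
        unfolding below_def using d g_bd Ecl out_E
        by (intro conjI Ccp_scale gC exI[of _ "E j"]) (auto simp: field_simps)
      then have "ennreal (L (\<lambda>x. (1/\<delta>) * g j x)) \<le> ennreal (?m (E j))"
        using L_le_outer_val em by metis
      then have "(1/\<delta>) * L (g j) \<le> ?m (E j)"
        using scale[OF gC, of "1/\<delta>"] d by (simp add: ennreal_le_iff)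
      then show ?thesis using d by (simp add: field_simps)
    qed
    have gi: "integrable riesz (g j)" for j
      using radon_integrable_Ccp[OF haus radon_riesz gC] .
    have ind: "integrable riesz (\<lambda>x. \<delta> * indicator (E j) x)" for j
      using Ef[of j] by (intro integrable_mult_right integrable_real_indicator) (auto simp: fmeasurable_def)
    have indv: "integral\<^sup>L riesz (\<lambda>x. \<delta> * indicator (E j) x) = \<delta> * ?m (E j)" for j
      using Ef[of j] compactin_subset_topspace[OF Ecl[of j]] by (simp add: Int_absorb2)
    have I1: "\<delta> * ?m (E (Suc j)) \<le> integral\<^sup>L riesz (g j)" for j
      unfolding indv[symmetric] using in_E g_bd
      by (intro integral_mono ind gi) (auto simp: indicator_def)
    have I2: "integral\<^sup>L riesz (g j) \<le> \<delta> * ?m (E j)" for j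
      unfolding indv[symmetric] using out_E g_bd
      by (intro integral_mono ind gi) (auto simp: indicator_def)
    have "L f = (\<Sum>j<N. L (g j))"
      using cong[OF f fs] sum[of "{..<N}" g] gC by simp
    moreover have "integral\<^sup>L riesz f = (\<Sum>j<N. integral\<^sup>L riesz (g j))"
    proof -
      have "integral\<^sup>L riesz f = integral\<^sup>L riesz (\<lambda>x. \<Sum>j<N. g j x)"
        using fs by (intro Bochner_Integration.integral_cong) auto
      also have "\<dots> = (\<Sum>j<N. integral\<^sup>L riesz (g j))"
        by (rule Bochner_Integration.integral_sum) (rule gi)
      finally show ?thesis .
    qed
    ultimately have "\<bar>L f - integral\<^sup>L riesz f\<bar> = \<bar>\<Sum>j<N. L (g j) - integral\<^sup>L riesz (g j)\<bar>"
      by (simp add: sum_subtractf)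
    also have "\<dots> \<le> (\<Sum>j<N. \<bar>L (g j) - integral\<^sup>L riesz (g j)\<bar>)" by (rule sum_abs)
    also have "\<dots> \<le> (\<Sum>j<N. \<delta> * ?m (E j) - \<delta> * ?m (E (Suc j)))"
      by (intro sum_mono) (use L1 L2 I1 I2 in \<open>smt (verit)\<close>)
    also have "\<dots> = \<delta> * ?m (E 0) - \<delta> * ?m (E N)" by (rule sum_lessThan_telescope')
    also have "\<dots> \<le> \<delta> * ?m C" using d by (simp add: E_def)
    finally show ?thesis .
  qed
  have "\<bar>L f - integral\<^sup>L riesz f\<bar> \<le> 0"
  proof (rule field_le_epsilon)
    fix e :: real assume e: "0 < e"
    \<comment> \<open>The added 1 keeps the quotient meaningful when C is a null set.\<close>
    have "\<bar>L f - integral\<^sup>L riesz f\<bar> \<le> (e / (?m C + 1)) * ?m C"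
      using e by (intro key) (simp add: add_nonneg_pos)
    also have "\<dots> \<le> e"
    proof -
      have "e * ?m C \<le> e * (?m C + 1)" using e by (intro mult_left_mono) auto
      moreover have "0 < ?m C + 1" by (simp add: add_nonneg_pos)
      ultimately show ?thesis by (simp add: pos_divide_le_eq)
    qed
    finally show "\<bar>L f - integral\<^sup>L riesz f\<bar> \<le> 0 + e" by simp
  qed
  then show ?thesis by simp
qed

lemma emeasure_riesz_open:
  assumes "openin X U"
  shows "emeasure riesz U = open_val U"
  using emeasure_riesz[of U] outer_val_open[OF assms] assms by (simp add: sets_riesz sigma_sets.Basic)

end

section \<open>Haar functionals on locally compact groups\<close>

text \<open>The laws are required on \<open>topspace X\<close> only: the instances are the stability
  groups, with the partial operations of the groupoid.\<close>

locale lc_group = lc_Hausdorff X for X :: "'a topology" +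
  fixes m :: "'a \<Rightarrow> 'a \<Rightarrow> 'a" and u :: 'a and i :: "'a \<Rightarrow> 'a"
  assumes m_closed [simp]: "a \<in> topspace X \<Longrightarrow> b \<in> topspace X \<Longrightarrow> m a b \<in> topspace X"
    and i_closed [simp]: "a \<in> topspace X \<Longrightarrow> i a \<in> topspace X"
    and u_closed [simp]: "u \<in> topspace X"
    and assoc: "a \<in> topspace X \<Longrightarrow> b \<in> topspace X \<Longrightarrow> c \<in> topspace X \<Longrightarrow> m (m a b) c = m a (m b c)"
    and u_left [simp]: "a \<in> topspace X \<Longrightarrow> m u a = a"
    and u_right [simp]: "a \<in> topspace X \<Longrightarrow> m a u = a"
    and i_left [simp]: "a \<in> topspace X \<Longrightarrow> m (i a) a = u"
    and i_right [simp]: "a \<in> topspace X \<Longrightarrow> m a (i a) = u"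
    and cont_m: "continuous_map (prod_topology X X) X (\<lambda>(a, b). m a b)"
    and cont_i: "continuous_map X X i"
begin

abbreviation "H \<equiv> topspace X"

lemma i_m_cancel [simp]: "a \<in> H \<Longrightarrow> b \<in> H \<Longrightarrow> m (i a) (m a b) = b"
  by (metis assoc i_closed i_left u_left)

lemma m_i_cancel [simp]: "a \<in> H \<Longrightarrow> b \<in> H \<Longrightarrow> m a (m (i a) b) = b"
  by (metis assoc i_closed i_right u_left)

lemma i_unique: "a \<in> H \<Longrightarrow> b \<in> H \<Longrightarrow> m a b = u \<Longrightarrow> b = i a"
  by (metis i_closed i_m_cancel u_right)

lemma i_i [simp]: "a \<in> H \<Longrightarrow> i (i a) = a"
  using i_unique[of "i a" a] by simp

lemma i_m: "a \<in> H \<Longrightarrow> b \<in> H \<Longrightarrow> i (m a b) = m (i b) (i a)"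
  by (rule i_unique[symmetric]) (auto simp: assoc)

lemma i_u [simp]: "i u = u"
  using i_unique[of u u] by simp

lemma cont_m2:
  assumes "continuous_map Y X f" "continuous_map Y X g"
  shows "continuous_map Y X (\<lambda>y. m (f y) (g y))"
  using continuous_map_compose[OF continuous_map_pairedI[OF assms] cont_m] by (simp add: o_def)

lemma cont_lmult: "a \<in> H \<Longrightarrow> continuous_map X X (\<lambda>x. m a x)"
  by (intro cont_m2) auto

section \<open>Translation and uniform continuity\<close>

definition shift :: "'a \<Rightarrow> ('a \<Rightarrow> real) \<Rightarrow> 'a \<Rightarrow> real" where
  "shift s f x = f (m (i s) x)"

lemma shift_in_Ccp:
  assumes s: "s \<in> H" and f: "f \<in> Ccp X"
  shows "shift s f \<in> Ccp X"
proof -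
  obtain K where K: "compactin X K" "\<And>x. x \<in> H \<Longrightarrow> x \<notin> K \<Longrightarrow> f x = 0"
    using Ccp_supp[OF f] by metis
  show ?thesis
  proof (rule CcpI)
    show "continuous_map X euclideanreal (shift s f)"
      unfolding shift_def using continuous_map_compose[OF cont_lmult[of "i s"] CcpD(1)[OF f]] s
      by (simp add: o_def)
    show "compactin X ((\<lambda>x. m s x) ` K)" using image_compactin[OF K(1) cont_lmult[OF s]] .
    show "shift s f x = 0" if "x \<in> H" "x \<notin> (\<lambda>x. m s x) ` K" for x
    proof -
      have "m (i s) x \<notin> K" using that s by (metis image_eqI m_i_cancel)
      then show ?thesis unfolding shift_def using K(2) s that by simp
    qed
  qed (use CcpD[OF f] s in \<open>auto simp: shift_def\<close>)
qed

lemma inv_Ccp: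
  assumes f: "f \<in> Ccp X"
  shows "(\<lambda>x. f (i x)) \<in> Ccp X"
proof -
  obtain K where K: "compactin X K" "\<And>x. x \<in> H \<Longrightarrow> x \<notin> K \<Longrightarrow> f x = 0"
    using Ccp_supp[OF f] by metis
  show ?thesis
  proof (rule CcpI)
    show "continuous_map X euclideanreal (\<lambda>x. f (i x))"
      using continuous_map_compose[OF cont_i CcpD(1)[OF f]] by (simp add: o_def)
    show "compactin X (i ` K)" using image_compactin[OF K(1) cont_i] .
    show "f (i x) = 0" if "x \<in> H" "x \<notin> i ` K" for x
      using that K(2)[of "i x"] by (metis i_closed i_i image_eqI)
  qed (use CcpD[OF f] in auto)
qed

text \<open>Wallace's theorem for \<open>K \<times> {u}\<close> gives one neighbourhood that serves
  all y in K. Making it closed under inversion handles the case where only x lies in K; if neither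
  does, both values are 0.\<close>

lemma left_unif_cont:
  assumes f: "f \<in> Ccp X" and e: "(0::real) < e"
  obtains V where "openin X V" "u \<in> V"
    "\<And>x y. x \<in> H \<Longrightarrow> y \<in> H \<Longrightarrow> m (i y) x \<in> V \<Longrightarrow> \<bar>f x - f y\<bar> \<le> e"
proof -
  obtain K where K: "compactin X K" "\<And>x. x \<in> H \<Longrightarrow> x \<notin> K \<Longrightarrow> f x = 0"
    using Ccp_supp[OF f] by metis
  have KH: "K \<subseteq> H" using K(1) compactin_subset_topspace by blast
  let ?P = "prod_topology X X"
  define F where "F p = \<bar>f (m (fst p) (snd p)) - f (fst p)\<bar>" for p
  have c: "continuous_map ?P euclideanreal F"
  proof -
    have "continuous_map ?P X (\<lambda>p. m (fst p) (snd p))"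
      by (rule cont_m2[OF continuous_map_fst continuous_map_snd])
    from continuous_map_compose[OF this CcpD(1)[OF f]] continuous_map_compose[OF continuous_map_fst CcpD(1)[OF f]]
    have "continuous_map ?P euclideanreal (\<lambda>p. f (m (fst p) (snd p)))" "continuous_map ?P euclideanreal (\<lambda>p. f (fst p))"
      by (simp_all add: o_def)
    then show ?thesis unfolding F_def by (intro continuous_intros)
  qed
  have W: "openin ?P {p \<in> topspace ?P. F p \<in> {..<e}}"
    by (rule openin_continuous_map_preimage[OF c]) simp
  have "K \<times> {u} \<subseteq> {p \<in> topspace ?P. F p \<in> {..<e}}" using KH e by (auto simp: F_def)
  then obtain U V where UV: "openin X U" "openin X V" "K \<subseteq> U" "{u} \<subseteq> V"
    "U \<times> V \<subseteq> {p \<in> topspace ?P. F p \<in> {..<e}}"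
    by (rule Wallace_theorem_prod_topology[OF K(1) _ W, of "{u}", rotated]) auto
  have *: "\<bar>f (m y v) - f y\<bar> < e" if "y \<in> K" "v \<in> V" for y v
    using UV that unfolding F_def by force
  let ?V = "{x \<in> V. i x \<in> V}"
  have "?V = V \<inter> {x \<in> H. i x \<in> V}" using openin_subset[OF UV(2)] by auto
  then have "openin X ?V" using openin_continuous_map_preimage[OF cont_i UV(2)] UV(2) by auto
  moreover have "u \<in> ?V" using UV(4) by simp
  moreover have "\<bar>f x - f y\<bar> \<le> e" if xy: "x \<in> H" "y \<in> H" "m (i y) x \<in> ?V" for x y
  proof -
    consider "y \<in> K" | "x \<in> K" | "x \<notin> K" "y \<notin> K" by blast
    then show ?thesis
    proof cases
      case 1
      then show ?thesis using *[of y "m (i y) x"] xy by simp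
    next
      case 2
      have "m (i x) y \<in> V" using xy by (simp add: i_m)
      then show ?thesis using *[OF 2, of "m (i x) y"] xy by simp
    qed (use K xy e in auto)
  qed
  ultimately show ?thesis using that by blast
qed

text \<open>Inversion exchanges left and right uniformity, so this is left uniform continuity of f
  composed with i.\<close>

lemma right_unif_cont:
  assumes f: "f \<in> Ccp X" and e: "(0::real) < e"
  obtains V where "openin X V" "u \<in> V"
    "\<And>w z. w \<in> V \<Longrightarrow> z \<in> H \<Longrightarrow> \<bar>f (m (i w) z) - f z\<bar> \<le> e"
proof -
  obtain V where V: "openin X V" "u \<in> V"
    "\<And>x y. x \<in> H \<Longrightarrow> y \<in> H \<Longrightarrow> m (i y) x \<in> V \<Longrightarrow> \<bar>f (i x) - f (i y)\<bar> \<le> e"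
    using left_unif_cont[OF inv_Ccp[OF f] e] by metis
  have "\<bar>f (m (i w) z) - f z\<bar> \<le> e" if "w \<in> V" "z \<in> H" for w z
  proof -
    have "w \<in> H" using that V openin_subset by blast
    then show ?thesis using V(3)[of "m (i z) w" "i z"] that by (simp add: i_m)
  qed
  then show ?thesis using that V by blast
qed

text \<open>Lists admit repeated translates without merging coefficients: sums of combinations are
  concatenations, and proofs go by induction.\<close>

definition comb :: "(real \<times> 'a) list \<Rightarrow> ('a \<Rightarrow> real) \<Rightarrow> 'a \<Rightarrow> real" where
  "comb l f x = (\<Sum>p\<leftarrow>l. fst p * shift (snd p) f x)"

definition good :: "(real \<times> 'a) list \<Rightarrow> bool" where
  "good l \<longleftrightarrow> (\<forall>p\<in>set l. 0 \<le> fst p \<and> snd p \<in> H)"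

definition weight :: "(real \<times> 'a) list \<Rightarrow> real" where
  "weight l = (\<Sum>p\<leftarrow>l. fst p)"

definition covers :: "('a \<Rightarrow> real) \<Rightarrow> ('a \<Rightarrow> real) \<Rightarrow> (real \<times> 'a) list \<Rightarrow> bool" where
  "covers f \<phi> l \<longleftrightarrow> good l \<and> (\<forall>x\<in>H. f x \<le> comb l \<phi> x)"

(* Weil's covering number (f : \<phi>); a list entry (c, s) stands for the term c * \<phi> (s^-1 x). *)
definition cover_num :: "('a \<Rightarrow> real) \<Rightarrow> ('a \<Rightarrow> real) \<Rightarrow> real" where
  "cover_num f \<phi> = Inf {weight l | l. covers f \<phi> l}"

definition bump :: "('a \<Rightarrow> real) \<Rightarrow> bool" where
  "bump f \<longleftrightarrow> f \<in> Ccp X \<and> (\<exists>x\<in>H. 0 < f x)"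

lemma bump_Ccp: "bump f \<Longrightarrow> f \<in> Ccp X"
  unfolding bump_def by simp

lemma good_simps [simp]: "good []" "good (p # l) \<longleftrightarrow> 0 \<le> fst p \<and> snd p \<in> H \<and> good l"
  "good (k @ l) \<longleftrightarrow> good k \<and> good l"
  unfolding good_def by auto

lemma weight_simps [simp]: "weight [] = 0" "weight (p # l) = fst p + weight l" "weight (k @ l) = weight k + weight l"
  unfolding weight_def by auto

lemma comb_simps [simp]: "comb [] f x = 0" "comb (p # l) f x = fst p * shift (snd p) f x + comb l f x"
  "comb (k @ l) f x = comb k f x + comb l f x"
  unfolding comb_def by auto

lemma weight_nonneg: "good l \<Longrightarrow> 0 \<le> weight l"
  by (induction l) auto

lemma comb_Ccp: "good l \<Longrightarrow> f \<in> Ccp X \<Longrightarrow> comb l f \<in> Ccp X"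
proof (induction l)
  case Nil
  have "comb [] f = (\<lambda>x. 0)" by auto
  then show ?case using Ccp_zero by metis
next
  case (Cons p l)
  have "comb (p # l) f = (\<lambda>x. fst p * shift (snd p) f x + comb l f x)" by auto
  then show ?case using Cons by (simp add: Ccp_add Ccp_scale shift_in_Ccp)
qed

text \<open>Near z the bump exceeds half its value at z. Finitely many translates of that region, by
  k z^-1 with k in K, cover the support of f, and the coefficient \<open>B / ?d\<close> lifts each
  of them above the bound B of f.\<close>

lemma covers_exists:
  assumes f: "f \<in> Ccp X" and p: "bump \<phi>"
  obtains l where "covers f \<phi> l"
proof -
  obtain K where K: "compactin X K" "\<And>x. x \<in> H \<Longrightarrow> x \<notin> K \<Longrightarrow> f x = 0"
    using Ccp_supp[OF f] by metis
  obtain B where B: "B > 0" "\<And>x. x \<in> H \<Longrightarrow> f x \<le> B"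
    using Ccp_bounded[OF f] by metis
  obtain z where z: "z \<in> H" "0 < \<phi> z" and pC: "\<phi> \<in> Ccp X" using p unfolding bump_def by blast
  let ?d = "\<phi> z / 2"
  have KH: "K \<subseteq> H" using K(1) compactin_subset_topspace by blast
  define O' where "O' k = {x \<in> H. ?d < shift (m k (i z)) \<phi> x}" for k
  have O1: "openin X (O' k)" if "k \<in> K" for k
    unfolding O'_def by (rule open_pos_set[OF CcpD(1)[OF shift_in_Ccp[OF _ pC]]]) (use that KH z in auto)
  have O2: "k \<in> O' k" if "k \<in> K" for k
  proof -
    have "k \<in> H" using that KH by auto
    then show ?thesis unfolding O'_def shift_def using z by (simp add: i_m assoc)
  qed
  obtain A where A: "finite A" "A \<subseteq> K" "K \<subseteq> (\<Union>a\<in>A. O' a)"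
    by (rule compactin_pointwise_subcover[OF K(1) O1 O2])
  obtain xs where xs: "set xs = A" using finite_list[OF A(1)] by auto
  define l where "l = map (\<lambda>k. (B / ?d, m k (i z))) xs"
  have gl: "good l" using xs A(2) KH B(1) z unfolding l_def good_def by auto
  have "f x \<le> comb l \<phi> x" if x: "x \<in> H" for x
  proof (cases "x \<in> K")
    case True
    then obtain k where k: "k \<in> set xs" "x \<in> O' k" using A xs by auto
    have ge: "0 \<le> fst p * shift (snd p) \<phi> x" if "p \<in> set l" for p
      using that gl CcpD(2)[OF shift_in_Ccp[OF _ pC] x] unfolding good_def by auto
    have "f x \<le> B / ?d * ?d" using B(2)[OF x] z(2) by simp
    also have "\<dots> \<le> B / ?d * shift (m k (i z)) \<phi> x"
      using k(2) B(1) z(2) unfolding O'_def by (intro mult_left_mono) auto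
    also have "\<dots> \<le> comb l \<phi> x"
    proof -
      have "(B / ?d, m k (i z)) \<in> set l" using k(1) unfolding l_def by auto
      then have "B / ?d * shift (m k (i z)) \<phi> x \<in> set (map (\<lambda>p. fst p * shift (snd p) \<phi> x) l)"
        by (metis (no_types, lifting) fst_conv image_eqI list.set_map snd_conv)
      then show ?thesis
        unfolding comb_def using ge by (intro member_le_sum_list) auto
    qed
    finally show ?thesis .
  next
    case False
    then show ?thesis using K(2)[OF x] CcpD(2)[OF comb_Ccp[OF gl pC] x] by simp
  qed
  then show ?thesis using that gl unfolding covers_def by blast
qed

section \<open>Estimates for covering numbers\<close>

lemma cover_num_bdd: "bdd_below {weight l | l. covers f \<phi> l}"
  by (rule bdd_belowI[of _ 0]) (auto simp: covers_def weight_nonneg)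

lemma cover_num_lower: "covers f \<phi> l \<Longrightarrow> cover_num f \<phi> \<le> weight l"
  unfolding cover_num_def by (rule cInf_lower[OF _ cover_num_bdd]) auto

lemma cover_num_greatest:
  assumes "f \<in> Ccp X" "bump \<phi>" "\<And>l. covers f \<phi> l \<Longrightarrow> a \<le> weight l"
  shows "a \<le> cover_num f \<phi>"
  unfolding cover_num_def using covers_exists[OF assms(1,2)] assms(3) by (intro cInf_greatest) auto

lemma cover_num_nonneg: "f \<in> Ccp X \<Longrightarrow> bump \<phi> \<Longrightarrow> 0 \<le> cover_num f \<phi>"
  by (rule cover_num_greatest) (auto simp: covers_def weight_nonneg)

lemma cover_num_approx:
  assumes "f \<in> Ccp X" "bump \<phi>" "0 < e"
  obtains l where "covers f \<phi> l" "weight l < cover_num f \<phi> + e"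
proof -
  have "Inf {weight l | l. covers f \<phi> l} < cover_num f \<phi> + e" using assms unfolding cover_num_def by simp
  then obtain y where "y \<in> {weight l | l. covers f \<phi> l}" "y < cover_num f \<phi> + e"
    using cInf_lessD covers_exists[OF assms(1,2)] by (metis (mono_tags, lifting) empty_iff mem_Collect_eq)
  then show ?thesis using that by auto
qed

lemma cover_num_mono:
  assumes "g \<in> Ccp X" "bump \<phi>" "\<And>x. x \<in> H \<Longrightarrow> f x \<le> g x"
  shows "cover_num f \<phi> \<le> cover_num g \<phi>"
  by (rule cover_num_greatest[OF assms(1,2)], rule cover_num_lower) (use assms(3) in \<open>force simp: covers_def\<close>)

lemma cover_num_add:
  assumes f: "f \<in> Ccp X" and g: "g \<in> Ccp X" and p: "bump \<phi>"
  shows "cover_num (\<lambda>x. f x + g x) \<phi> \<le> cover_num f \<phi> + cover_num g \<phi>"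
proof (rule field_le_epsilon)
  fix e :: real assume e: "0 < e"
  obtain k where k: "covers f \<phi> k" "weight k < cover_num f \<phi> + e/2" using cover_num_approx[OF f p, of "e/2"] e by auto
  obtain l where l: "covers g \<phi> l" "weight l < cover_num g \<phi> + e/2" using cover_num_approx[OF g p, of "e/2"] e by auto
  have "covers (\<lambda>x. f x + g x) \<phi> (k @ l)" using k(1) l(1) unfolding covers_def by (auto intro: add_mono)
  then have "cover_num (\<lambda>x. f x + g x) \<phi> \<le> weight k + weight l" using cover_num_lower by fastforce
  then show "cover_num (\<lambda>x. f x + g x) \<phi> \<le> cover_num f \<phi> + cover_num g \<phi> + e" using k l by simp
qed

lemma cover_num_scale_le:
  assumes f: "f \<in> Ccp X" and p: "bump \<phi>" and c: "0 < c"
  shows "cover_num (\<lambda>x. c * f x) \<phi> \<le> c * cover_num f \<phi>"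
proof -
  have "cover_num (\<lambda>x. c * f x) \<phi> / c \<le> cover_num f \<phi>"
  proof (rule cover_num_greatest[OF f p])
    fix l assume l: "covers f \<phi> l"
    define k where "k = map (\<lambda>p. (c * fst p, snd p)) l"
    have "weight k = c * weight l" unfolding k_def weight_def by (simp add: o_def sum_list_const_mult)
    moreover have "covers (\<lambda>x. c * f x) \<phi> k"
    proof -
      have "comb k \<phi> x = c * comb l \<phi> x" for x
        unfolding k_def comb_def by (simp add: o_def sum_list_const_mult mult.assoc)
      moreover have "good k" using l c unfolding covers_def good_def k_def by auto
      ultimately show ?thesis using l c unfolding covers_def by simp
    qed
    ultimately show "cover_num (\<lambda>x. c * f x) \<phi> / c \<le> weight l" using cover_num_lower c by (force simp: field_simps)
  qed
  then show ?thesis using c by (simp add: field_simps)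
qed

lemma cover_num_zero: "bump \<phi> \<Longrightarrow> cover_num (\<lambda>x. 0) \<phi> = 0"
  using cover_num_lower[of "\<lambda>x. 0" \<phi> "[]"] cover_num_nonneg[OF Ccp_zero] unfolding covers_def by force

lemma cover_num_scale:
  assumes f: "f \<in> Ccp X" and p: "bump \<phi>" and c: "0 \<le> c"
  shows "cover_num (\<lambda>x. c * f x) \<phi> = c * cover_num f \<phi>"
proof (cases "c = 0")
  case True
  then show ?thesis using cover_num_zero[OF p] by simp
next
  case False
  then have "0 < c" using c by simp
  then show ?thesis
    using cover_num_scale_le[OF f p, of c] cover_num_scale_le[OF Ccp_scale[OF f c] p, of "1/c"]
    by (auto simp: field_simps)
qed

lemma cover_num_shift_le:
  assumes f: "f \<in> Ccp X" and p: "bump \<phi>" and s: "s \<in> H"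
  shows "cover_num (shift s f) \<phi> \<le> cover_num f \<phi>"
proof (rule cover_num_greatest[OF f p])
  fix l assume l: "covers f \<phi> l"
  define k where "k = map (\<lambda>p. (fst p, m s (snd p))) l"
  have "comb k \<phi> x = comb l \<phi> (m (i s) x)" if "x \<in> H" for x
    using l that s unfolding k_def comb_def covers_def good_def
    by (auto simp: o_def shift_def i_m assoc intro!: arg_cong[of _ _ sum_list])
  moreover have "good k" using l s unfolding k_def covers_def good_def by auto
  ultimately have "covers (shift s f) \<phi> k" using l s unfolding covers_def shift_def by simp
  moreover have "weight k = weight l" unfolding k_def weight_def by (simp add: o_def)
  ultimately show "cover_num (shift s f) \<phi> \<le> weight l" using cover_num_lower by fastforce
qed

lemma cover_num_shift:
  assumes f: "f \<in> Ccp X" and p: "bump \<phi>" and s: "s \<in> H"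
  shows "cover_num (shift s f) \<phi> = cover_num f \<phi>"
proof (rule antisym[OF cover_num_shift_le[OF assms]])
  have "cover_num f \<phi> \<le> cover_num (shift (i s) (shift s f)) \<phi>"
    by (intro cover_num_mono shift_in_Ccp f p) (use s in \<open>auto simp: shift_def\<close>)
  also have "\<dots> \<le> cover_num (shift s f) \<phi>"
    by (intro cover_num_shift_le shift_in_Ccp f p) (use s in auto)
  finally show "cover_num f \<phi> \<le> cover_num (shift s f) \<phi>" .
qed

lemma cover_num_comb:
  assumes g: "g \<in> Ccp X" and p: "bump \<phi>" and l: "good l"
  shows "cover_num (comb l g) \<phi> \<le> weight l * cover_num g \<phi>"
  using l
proof (induction l)
  case Nil
  have "comb [] g = (\<lambda>x. 0)" by auto
  then show ?case using cover_num_zero[OF p] by simp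
next
  case (Cons q l)
  have q: "0 \<le> fst q" "snd q \<in> H" "good l" using Cons.prems by auto
  have "comb (q # l) g = (\<lambda>x. fst q * shift (snd q) g x + comb l g x)" by auto
  then have "cover_num (comb (q # l) g) \<phi> \<le> cover_num (\<lambda>x. fst q * shift (snd q) g x) \<phi> + cover_num (comb l g) \<phi>"
    using cover_num_add[OF Ccp_scale[OF shift_in_Ccp[OF q(2) g] q(1)] comb_Ccp[OF q(3) g] p] by simp
  also have "\<dots> \<le> fst q * cover_num g \<phi> + weight l * cover_num g \<phi>"
    using cover_num_scale[OF shift_in_Ccp[OF q(2) g] p q(1)] cover_num_shift[OF g p q(2)] Cons.IH[OF q(3)] by simp
  finally show ?case by (simp only: weight_simps distrib_right)
qed

text \<open>All translates of g have the same covering number, so a cover of f by translates of g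
  costs at most its weight times (g : \<phi>). This bounds (f : \<phi>) / (f0 : \<phi>) by (f : f0)
  independently of \<phi>, the bound behind the compactness argument.\<close>

lemma cover_num_shiftans:
  assumes f: "f \<in> Ccp X" and g: "bump g" and p: "bump \<phi>"
  shows "cover_num f \<phi> \<le> cover_num f g * cover_num g \<phi>"
proof -
  have le: "cover_num f \<phi> \<le> weight l * cover_num g \<phi>" if "covers f g l" for l
    using cover_num_mono[OF comb_Ccp p] cover_num_comb[OF bump_Ccp[OF g] p] that bump_Ccp[OF g]
    unfolding covers_def by (meson order_trans)
  show ?thesis
  proof (cases "cover_num g \<phi> = 0")
    case True
    obtain l where "covers f g l" using covers_exists[OF f g] .
    then show ?thesis using le[of l] True by simp
  next
    case False
    then have pos: "0 < cover_num g \<phi>" using cover_num_nonneg[OF bump_Ccp[OF g] p] by simp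
    have "cover_num f \<phi> / cover_num g \<phi> \<le> cover_num f g"
      by (rule cover_num_greatest[OF f g]) (use le pos in \<open>simp add: field_simps\<close>)
    then show ?thesis using pos by (simp add: field_simps)
  qed
qed

text \<open>Each term of a cover is at most its coefficient times the bound B of \<phi>, so covering
  f at the single point z already costs \<open>f z / B\<close>.\<close>

lemma cover_num_pos:
  assumes f: "bump f" and p: "bump \<phi>"
  shows "0 < cover_num f \<phi>"
proof -
  obtain B where B: "B > 0" "\<And>x. x \<in> H \<Longrightarrow> \<phi> x \<le> B" using Ccp_bounded[OF bump_Ccp[OF p]] by metis
  obtain z where z: "z \<in> H" "0 < f z" using f unfolding bump_def by blast
  have "f z / B \<le> cover_num f \<phi>"
  proof (rule cover_num_greatest[OF bump_Ccp[OF f] p])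
    fix l assume l: "covers f \<phi> l"
    have "comb l \<phi> z \<le> weight l * B" if "good l" for l
      using that
    proof (induction l)
      case (Cons q l)
      have "fst q * shift (snd q) \<phi> z \<le> fst q * B"
        using Cons.prems z unfolding shift_def by (intro mult_left_mono B(2)) auto
      then show ?case using Cons by (simp add: algebra_simps)
    qed simp
    then have "f z \<le> weight l * B" using l z unfolding covers_def by force
    then show "f z / B \<le> weight l" using B(1) by (simp add: field_simps)
  qed
  moreover have "0 < f z / B" using z B by simp
  ultimately show ?thesis by simp
qed

lemma bump_small:
  assumes "openin X V" "u \<in> V"
  obtains \<phi> where "bump \<phi>" "\<And>x. x \<in> H \<Longrightarrow> x \<notin> V \<Longrightarrow> \<phi> x = 0" "0 < \<phi> u"
proof -
  have "compactin X {u}" "{u} \<subseteq> V" using assms by auto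
  then obtain f C where f: "f \<in> Ccp X" "compactin X C" "C \<subseteq> V" "f u = 1"
    "\<And>x. x \<in> topspace X \<Longrightarrow> x \<notin> C \<Longrightarrow> f x = 0"
    using Urysohn_Ccp[OF _ assms(1)] by (metis singletonI)
  show ?thesis
    by (rule that[of f]) (use f u_closed in \<open>auto simp: bump_def intro!: bexI[of _ u]\<close>)
qed

(* With k = 1 on the supports, multiply a cover of h = f + g + d k by f/h and g/h, which are nearly
   constant on translates of the support of \<phi>, to obtain covers of f and of g. *)
lemma cover_num_approx_additive:
  assumes f: "f \<in> Ccp X" and g: "g \<in> Ccp X" and f0: "bump f0" and e: "0 < e"
  obtains V where "openin X V" "u \<in> V"
    "\<And>\<phi>. bump \<phi> \<Longrightarrow> (\<And>x. x \<in> H \<Longrightarrow> x \<notin> V \<Longrightarrow> \<phi> x = 0) \<Longrightarrow>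
      cover_num f \<phi> / cover_num f0 \<phi> + cover_num g \<phi> / cover_num f0 \<phi> \<le> cover_num (\<lambda>x. f x + g x) \<phi> / cover_num f0 \<phi> + e"
proof -
  have fg: "(\<lambda>x. f x + g x) \<in> Ccp X" using Ccp_add[OF f g] .
  obtain K where K: "compactin X K" "\<And>x. x \<in> H \<Longrightarrow> x \<notin> K \<Longrightarrow> f x + g x = 0"
    using Ccp_supp[OF fg] by metis
  have fK: "f x = 0" "g x = 0" if "x \<in> H" "x \<notin> K" for x
    using K(2)[OF that] CcpD(2)[OF f that(1)] CcpD(2)[OF g that(1)] by auto
  obtain k where k: "k \<in> Ccp X" "\<And>x. x \<in> K \<Longrightarrow> k x = 1" using Ccp_one_on[OF K(1)] by metis
  let ?A = "cover_num (\<lambda>x. f x + g x) f0" and ?B = "cover_num k f0"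
  have A0: "0 \<le> ?A" and B0: "0 \<le> ?B" using cover_num_nonneg fg k f0 by auto
  \<comment> \<open>\<open>?A\<close> and \<open>?B\<close> bound the normalised covering numbers of
    f + g and of k for every \<phi>, so d can be fixed before \<phi>. The cap d \<le> 1 gives (1 + 2
    d) d \<le> 3 d, and the final 1 keeps the denominator positive.\<close>
  define d where "d = min 1 (e / (2 * ?A + 3 * ?B + 1))"
  have den: "0 < 2 * ?A + 3 * ?B + 1" using A0 B0 by simp
  have d: "0 < d" "d \<le> 1" unfolding d_def using e den by auto
  have "d \<le> e / (2 * ?A + 3 * ?B + 1)" unfolding d_def by simp
  then have "d * (2 * ?A + 3 * ?B + 1) \<le> e" using den by (simp add: field_simps)
  then have de: "2 * d * ?A + 3 * d * ?B \<le> e" using d by (simp add: algebra_simps)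
  define h where "h x = f x + g x + d * k x" for x
  have hC: "h \<in> Ccp X" unfolding h_def by (intro Ccp_add f g Ccp_scale k) (use d in simp)
  have hK: "d \<le> h x" if "x \<in> K" for x
    using that k(2)[OF that] CcpD(2)[OF fg, of x] compactin_subset_topspace[OF K(1)]
    unfolding h_def by auto
  \<comment> \<open>Division by \<open>max d (h x)\<close> is continuous everywhere; on K, where f
    and g live, h is at least d and the quotient is q / h.\<close>
  have quot: "(\<lambda>x. q x / max d (h x)) \<in> Ccp X" if "q \<in> Ccp X" for q
    by (rule Ccp_dominated[OF that]) (use CcpD[OF that] CcpD[OF hC] d in \<open>auto intro!: continuous_intros\<close>)
  obtain V1 where V1: "openin X V1" "u \<in> V1"
    "\<And>x y. x \<in> H \<Longrightarrow> y \<in> H \<Longrightarrow> m (i y) x \<in> V1 \<Longrightarrow> \<bar>f x / max d (h x) - f y / max d (h y)\<bar> \<le> d"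
    using left_unif_cont[OF quot[OF f] d(1)] by metis
  obtain V2 where V2: "openin X V2" "u \<in> V2"
    "\<And>x y. x \<in> H \<Longrightarrow> y \<in> H \<Longrightarrow> m (i y) x \<in> V2 \<Longrightarrow> \<bar>g x / max d (h x) - g y / max d (h y)\<bar> \<le> d"
    using left_unif_cont[OF quot[OF g] d(1)] by metis
  show ?thesis
  proof (rule that[of "V1 \<inter> V2"])
    fix \<phi> assume p: "bump \<phi>" and pV: "\<And>x. x \<in> H \<Longrightarrow> x \<notin> V1 \<inter> V2 \<Longrightarrow> \<phi> x = 0"
    \<comment> \<open>The d added to each coefficient pays for replacing q / h at x by its value at
      the centre of the translate.\<close>
    have one: "cover_num q \<phi> \<le> (\<Sum>p\<leftarrow>l. fst p * (q (snd p) / max d (h (snd p)) + d))"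
      if q: "q \<in> Ccp X" "\<And>x. x \<in> H \<Longrightarrow> x \<notin> K \<Longrightarrow> q x = 0"
        and V: "\<And>x y. x \<in> H \<Longrightarrow> y \<in> H \<Longrightarrow> m (i y) x \<in> V1 \<inter> V2 \<Longrightarrow> \<bar>q x / max d (h x) - q y / max d (h y)\<bar> \<le> d"
        and l: "covers h \<phi> l" for q l
    proof -
      let ?r = "\<lambda>x. q x / max d (h x)"
      define l' where "l' = map (\<lambda>p. (fst p * (?r (snd p) + d), snd p)) l"
      have gl: "good l" using l unfolding covers_def by simp
      have r0: "0 \<le> ?r x" if "x \<in> H" for x using CcpD(2)[OF quot[OF q(1)] that] .
      have gl': "good l'" using gl r0 d unfolding good_def l'_def by (auto intro!: mult_nonneg_nonneg add_nonneg_nonneg)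
      have "q x \<le> comb l' \<phi> x" if x: "x \<in> H" for x
      proof (cases "x \<in> K")
        case True
        have "q x = ?r x * h x" using hK[OF True] d by (simp add: max_def)
        also have "\<dots> \<le> ?r x * comb l \<phi> x"
          using l x r0[OF x] unfolding covers_def by (intro mult_left_mono) auto
        also have "\<dots> = (\<Sum>p\<leftarrow>l. ?r x * (fst p * shift (snd p) \<phi> x))"
          unfolding comb_def by (simp only: sum_list_const_mult)
        also have "\<dots> \<le> (\<Sum>p\<leftarrow>l. (fst p * (?r (snd p) + d)) * shift (snd p) \<phi> x)"
        proof (rule sum_list_mono)
          fix p assume "p \<in> set l"
          then have pp: "0 \<le> fst p" "snd p \<in> H" using gl unfolding good_def by auto
          have t0: "0 \<le> shift (snd p) \<phi> x" using CcpD(2)[OF shift_in_Ccp[OF pp(2) bump_Ccp[OF p]] x] .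
          show "?r x * (fst p * shift (snd p) \<phi> x) \<le> (fst p * (?r (snd p) + d)) * shift (snd p) \<phi> x"
          proof (cases "m (i (snd p)) x \<in> V1 \<inter> V2")
            case True
            then have "?r x \<le> ?r (snd p) + d" using V[OF x pp(2)] by linarith
            then have "?r x * (fst p * shift (snd p) \<phi> x) \<le> (?r (snd p) + d) * (fst p * shift (snd p) \<phi> x)"
              using pp t0 by (intro mult_right_mono) auto
            then show ?thesis by (simp add: ac_simps)
          next
            case False
            then have "shift (snd p) \<phi> x = 0" unfolding shift_def using pV pp x by simp
            then show ?thesis by simp
          qed
        qed
        also have "\<dots> = comb l' \<phi> x" unfolding comb_def l'_def by (simp add: o_def)
        finally show ?thesis .
      next
        case False
        then show ?thesis using q(2)[OF x] CcpD(2)[OF comb_Ccp[OF gl' bump_Ccp[OF p]] x] by simp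
      qed
      then have "covers q \<phi> l'" using gl' unfolding covers_def by simp
      then show ?thesis using cover_num_lower[of q \<phi> l'] unfolding weight_def l'_def by (simp add: o_def)
    qed
    have "(cover_num f \<phi> + cover_num g \<phi>) / (1 + 2 * d) \<le> cover_num h \<phi>"
    proof (rule cover_num_greatest[OF hC p])
      fix l assume l: "covers h \<phi> l"
      let ?r = "\<lambda>q p. q (snd p) / max d (h (snd p))"
      have "cover_num f \<phi> + cover_num g \<phi> \<le> (\<Sum>p\<leftarrow>l. fst p * (?r f p + d)) + (\<Sum>p\<leftarrow>l. fst p * (?r g p + d))"
        using one[OF f fK(1) V1(3) l] one[OF g fK(2) V2(3) l] by fastforce
      also have "\<dots> = (\<Sum>p\<leftarrow>l. fst p * (?r f p + d) + fst p * (?r g p + d))"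
        by (simp add: sum_list_addf)
      also have "\<dots> \<le> (\<Sum>p\<leftarrow>l. (1 + 2 * d) * fst p)"
      proof (rule sum_list_mono)
        fix p assume "p \<in> set l"
        then have pp: "0 \<le> fst p" "snd p \<in> H" using l unfolding covers_def good_def by auto
        \<comment> \<open>Since d k is nonnegative, the two quotients at one centre sum to at most
          1; the two corrections d account for the factor 1 + 2 d.\<close>
        have "f (snd p) + g (snd p) \<le> max d (h (snd p))"
          using CcpD(2)[OF k(1) pp(2)] d unfolding h_def by (simp add: max.coboundedI2)
        then have "?r f p + ?r g p \<le> 1" using d by (simp add: add_divide_distrib[symmetric] divide_le_eq)
        then have "fst p * ((?r f p + d) + (?r g p + d)) \<le> fst p * (1 + 2 * d)"
          using pp by (intro mult_left_mono) auto
        then show "fst p * (?r f p + d) + fst p * (?r g p + d) \<le> (1 + 2 * d) * fst p"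
          by (simp add: algebra_simps)
      qed
      also have "\<dots> = (1 + 2 * d) * weight l" unfolding weight_def by (simp add: sum_list_const_mult)
      finally show "(cover_num f \<phi> + cover_num g \<phi>) / (1 + 2 * d) \<le> weight l" using d by (simp add: field_simps)
    qed
    then have "cover_num f \<phi> + cover_num g \<phi> \<le> (1 + 2 * d) * cover_num h \<phi>" using d by (simp add: field_simps)
    also have "cover_num h \<phi> \<le> cover_num (\<lambda>x. f x + g x) \<phi> + d * cover_num k \<phi>"
      unfolding h_def using cover_num_add[OF fg Ccp_scale[OF k(1)] p] cover_num_scale[OF k(1) p] d by (simp add: less_imp_le)
    finally have main: "cover_num f \<phi> + cover_num g \<phi> \<le> (1 + 2 * d) * (cover_num (\<lambda>x. f x + g x) \<phi> + d * cover_num k \<phi>)"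
      using d by (simp add: mult_left_mono)
    have pos: "0 < cover_num f0 \<phi>" using cover_num_pos[OF f0 p] .
    let ?a = "cover_num (\<lambda>x. f x + g x) \<phi> / cover_num f0 \<phi>" and ?b = "cover_num k \<phi> / cover_num f0 \<phi>"
    have ab: "?a \<le> ?A" "?b \<le> ?B" "0 \<le> ?b"
      using cover_num_shiftans[OF fg f0 p] cover_num_shiftans[OF k(1) f0 p] pos cover_num_nonneg[OF k(1) p] by (auto simp: field_simps)
    have "cover_num f \<phi> / cover_num f0 \<phi> + cover_num g \<phi> / cover_num f0 \<phi> = (cover_num f \<phi> + cover_num g \<phi>) / cover_num f0 \<phi>"
      by (simp add: add_divide_distrib)
    also have "\<dots> \<le> (1 + 2 * d) * (cover_num (\<lambda>x. f x + g x) \<phi> + d * cover_num k \<phi>) / cover_num f0 \<phi>"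
      using main pos by (intro divide_right_mono) auto
    also have "\<dots> = (1 + 2 * d) * (?a + d * ?b)"
    proof -
      have "(1 + 2 * d) * (a + d * b) / c = (1 + 2 * d) * (a / c + d * (b / c))" for a b c :: real
        by (cases "c = 0") (simp_all add: field_simps)
      then show ?thesis .
    qed
    also have "\<dots> = ?a + 2 * d * ?a + (1 + 2 * d) * d * ?b"
    proof -
      have "(1 + 2 * d) * (a + d * b) = a + 2 * d * a + (1 + 2 * d) * d * b" for a b :: real
        by (simp add: algebra_simps)
      then show ?thesis .
    qed
    also have "\<dots> \<le> ?a + 2 * d * ?A + 3 * d * ?B"
    proof -
      have "(1 + 2 * d) * d * ?b \<le> 3 * d * ?B"
        using d ab B0 by (intro mult_mono) auto
      moreover have "2 * d * ?a \<le> 2 * d * ?A" using d ab by (intro mult_left_mono) auto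
      ultimately show ?thesis by linarith
    qed
    also have "\<dots> \<le> ?a + e" using de by simp
    finally show "cover_num f \<phi> / cover_num f0 \<phi> + cover_num g \<phi> / cover_num f0 \<phi> \<le> ?a + e" .
  qed (use V1 V2 in auto)
qed

(* A cluster point of the normalised covering numbers in the compact product of the intervals
   [0, (f : f0)], as the support of \<phi> shrinks to the unit. *)
theorem haar_functional_exists:
  obtains I where "pos_functional X I"
    "\<And>f s. f \<in> Ccp X \<Longrightarrow> s \<in> H \<Longrightarrow> I (shift s f) = I f"
    "\<And>f. bump f \<Longrightarrow> 0 < I f"
proof -
  obtain f0 where f0: "bump f0" using bump_small[OF openin_topspace u_closed] by metis
  \<comment> \<open>The default 0 off \<open>Ccp X\<close>, matched by \<open>S f = {0}\<close>,
    makes each \<open>J \<phi>\<close> a point of a product of compact sets over all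
    functions.\<close>
  define J where "J \<phi> f = (if f \<in> Ccp X then cover_num f \<phi> / cover_num f0 \<phi> else 0)" for \<phi> f
  define S where "S f = (if f \<in> Ccp X then {0..cover_num f f0} else {0})" for f
  define small where "small V = {\<phi>. bump \<phi> \<and> (\<forall>x\<in>H. x \<notin> V \<longrightarrow> \<phi> x = 0)}" for V
  define \<V> where "\<V> = {V. openin X V \<and> u \<in> V}"
  have J_bd: "0 \<le> J \<phi> f" "J \<phi> f \<le> cover_num f f0" if "bump \<phi>" "f \<in> Ccp X" for \<phi> f
    using cover_num_pos[OF f0 that(1)] cover_num_nonneg[OF that(2,1)] cover_num_shiftans[OF that(2) f0 that(1)] that
    unfolding J_def by (auto simp: field_simps)
  have JS: "J \<phi> \<in> PiE UNIV S" if "bump \<phi>" for \<phi>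
    using J_bd[OF that] unfolding S_def by (auto simp: J_def)
  have "compact (PiE UNIV S)"
  proof -
    have "compactin (product_topology (\<lambda>_. euclidean) UNIV) (PiE UNIV S)"
      unfolding compactin_PiE by (auto simp: S_def)
    then show ?thesis by (simp add: euclidean_product_topology)
  qed
  then have "PiE UNIV S \<inter> (\<Inter>V\<in>\<V>. closure (J ` small V)) \<noteq> {}"
  proof (rule compact_imp_fip_image)
    fix \<V>' assume V': "finite \<V>'" "\<V>' \<subseteq> \<V>"
    have W: "openin X (H \<inter> \<Inter>\<V>')" "u \<in> H \<inter> \<Inter>\<V>'"
      using V' openin_Int_Inter[of \<V>' X H] unfolding \<V>_def by (auto intro!: openin_Int_Inter)
    obtain \<phi> where p: "bump \<phi>" "\<And>x. x \<in> H \<Longrightarrow> x \<notin> H \<inter> \<Inter>\<V>' \<Longrightarrow> \<phi> x = 0"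
      using bump_small[OF W] by metis
    have "J \<phi> \<in> closure (J ` small V)" if "V \<in> \<V>'" for V
      using p that closure_subset[of "J ` small V"] unfolding small_def by blast
    then show "PiE UNIV S \<inter> (\<Inter>V\<in>\<V>'. closure (J ` small V)) \<noteq> {}" using JS[OF p(1)] by blast
  qed simp
  then obtain I where I: "I \<in> PiE UNIV S" "\<And>V. V \<in> \<V> \<Longrightarrow> I \<in> closure (J ` small V)" by blast
  \<comment> \<open>A closed condition met by \<open>J \<phi>\<close> for all \<phi> of small
    support passes to the cluster point. Most laws hold for every bump \<phi>; superadditivity holds
    only up to e and for \<phi> supported in a set V depending on e.\<close>
  have limit: "P I" if "closed {F. P F}" "openin X V" "u \<in> V"
    "\<And>\<phi>. bump \<phi> \<Longrightarrow> (\<And>x. x \<in> H \<Longrightarrow> x \<notin> V \<Longrightarrow> \<phi> x = 0) \<Longrightarrow> P (J \<phi>)"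
    for P V
  proof -
    have "closure (J ` small V) \<subseteq> {F. P F}"
      using that by (intro closure_minimal) (auto simp: small_def)
    then show ?thesis using I(2)[of V] that unfolding \<V>_def by blast
  qed
  have all: "P I" if "closed {F. P F}" "\<And>\<phi>. bump \<phi> \<Longrightarrow> P (J \<phi>)" for P
    using limit[OF that(1) openin_topspace u_closed] that(2) by blast
  have coord: "continuous_on UNIV (\<lambda>F::('a \<Rightarrow> real) \<Rightarrow> real. F f)" for f by simp
  have mono: "I f \<le> I g" if "f \<in> Ccp X" "g \<in> Ccp X" "\<And>x. x \<in> H \<Longrightarrow> f x \<le> g x" for f g
    by (rule all[of "\<lambda>F. F f \<le> F g"])
      (use that in \<open>auto intro!: closed_Collect_le coord divide_right_mono cover_num_mono simp: J_def less_imp_le cover_num_pos[OF f0]\<close>)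
  have sc: "I (\<lambda>x. c * f x) = c * I f" if "f \<in> Ccp X" "0 \<le> c" for f c
    by (rule all[of "\<lambda>F. F (\<lambda>x. c * f x) = c * F f"])
      (use that in \<open>auto intro!: closed_Collect_eq continuous_intros coord simp: J_def Ccp_scale cover_num_scale\<close>)
  have inv: "I (shift s f) = I f" if "f \<in> Ccp X" "s \<in> H" for f s
    by (rule all[of "\<lambda>F. F (shift s f) = F f"])
      (use that in \<open>auto intro!: closed_Collect_eq coord simp: J_def shift_in_Ccp cover_num_shift\<close>)
  have subadd: "I (\<lambda>x. f x + g x) \<le> I f + I g" if "f \<in> Ccp X" "g \<in> Ccp X" for f g
  proof (rule all[of "\<lambda>F. F (\<lambda>x. f x + g x) \<le> F f + F g"])
    show "closed {F :: ('a \<Rightarrow> real) \<Rightarrow> real. F (\<lambda>x. f x + g x) \<le> F f + F g}"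
      by (intro closed_Collect_le continuous_intros coord)
    show "J \<phi> (\<lambda>x. f x + g x) \<le> J \<phi> f + J \<phi> g" if "bump \<phi>" for \<phi>
      using cover_num_add[OF \<open>f \<in> Ccp X\<close> \<open>g \<in> Ccp X\<close> that] cover_num_pos[OF f0 that] \<open>f \<in> Ccp X\<close> \<open>g \<in> Ccp X\<close>
      by (simp add: J_def Ccp_add add_divide_distrib[symmetric] divide_right_mono)
  qed
  have superadd: "I f + I g \<le> I (\<lambda>x. f x + g x)" if fg: "f \<in> Ccp X" "g \<in> Ccp X" for f g
  proof (rule field_le_epsilon)
    fix e :: real assume e: "0 < e"
    obtain V where V: "openin X V" "u \<in> V"
      "\<And>\<phi>. bump \<phi> \<Longrightarrow> (\<And>x. x \<in> H \<Longrightarrow> x \<notin> V \<Longrightarrow> \<phi> x = 0) \<Longrightarrow>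
        cover_num f \<phi> / cover_num f0 \<phi> + cover_num g \<phi> / cover_num f0 \<phi> \<le> cover_num (\<lambda>x. f x + g x) \<phi> / cover_num f0 \<phi> + e"
      by (rule cover_num_approx_additive[OF fg f0 e]) blast
    show "I f + I g \<le> I (\<lambda>x. f x + g x) + e"
    proof (rule limit[of "\<lambda>F. F f + F g \<le> F (\<lambda>x. f x + g x) + e", OF _ V(1,2)])
      show "closed {F :: ('a \<Rightarrow> real) \<Rightarrow> real. F f + F g \<le> F (\<lambda>x. f x + g x) + e}"
        by (intro closed_Collect_le continuous_intros coord)
      show "J \<phi> f + J \<phi> g \<le> J \<phi> (\<lambda>x. f x + g x) + e"
        if "bump \<phi>" "\<And>x. x \<in> H \<Longrightarrow> x \<notin> V \<Longrightarrow> \<phi> x = 0" for \<phi>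
        using V(3)[OF that] fg by (simp add: J_def Ccp_add)
    qed
  qed
  have pos: "0 < I f" if f: "bump f" for f
  proof -
    \<comment> \<open>From (f0 : \<phi>) \<le> (f0 : f) (f : \<phi>): a lower bound free of \<phi>,
      which prevents the limit from degenerating to 0.\<close>
    have "1 / cover_num f0 f \<le> I f"
    proof (rule all[of "\<lambda>F. 1 / cover_num f0 f \<le> F f"])
      show "1 / cover_num f0 f \<le> J \<phi> f" if "bump \<phi>" for \<phi>
        using cover_num_shiftans[OF bump_Ccp[OF f0] f that] cover_num_pos[OF f0 f] cover_num_pos[OF f0 that] bump_Ccp[OF f]
        by (simp add: J_def field_simps)
    qed (intro closed_Collect_le continuous_intros coord)
    then show ?thesis using cover_num_pos[OF f0 f] by (smt (verit) divide_pos_pos)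
  qed
  have "pos_functional X I"
    by unfold_locales (simp_all add: sc mono antisym[OF subadd superadd])
  then show ?thesis using that inv pos by blast
qed

end

section \<open>Uniform approximation by translates\<close>

locale haar_group = lc_group X m u i for X :: "'a topology" and m u i +
  fixes I :: "('a \<Rightarrow> real) \<Rightarrow> real"
  assumes pf: "pos_functional X I"
    and I_inv: "f \<in> Ccp X \<Longrightarrow> k \<in> topspace X \<Longrightarrow> I (\<lambda>x. f (m (i k) x)) = I f"
    and I_pos: "f \<in> Ccp X \<Longrightarrow> k \<in> topspace X \<Longrightarrow> 0 < f k \<Longrightarrow> 0 < I f"
begin

interpretation I: pos_functional X I by (rule pf)

lemma I_shift: "f \<in> Ccp X \<Longrightarrow> k \<in> H \<Longrightarrow> I (shift k f) = I f"
  unfolding shift_def by (rule I_inv)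

(* The combination is a Riemann sum of the integral of f y * \<phi> (y^-1 x) over y, which is close to
   f x times the integral of \<phi> o i. *)
lemma approx_comb_pointwise:
  assumes f: "f \<in> Ccp X" and K: "compactin X K" "\<And>x. x \<in> H \<Longrightarrow> x \<notin> K \<Longrightarrow> f x = 0"
    and V: "openin X V" "u \<in> V" "\<And>x y. x \<in> H \<Longrightarrow> y \<in> H \<Longrightarrow> m (i y) x \<in> V \<Longrightarrow> \<bar>f x - f y\<bar> \<le> e/2"
    and e: "0 < e" and p: "\<phi> \<in> Ccp X" "\<And>x. x \<in> H \<Longrightarrow> x \<notin> V \<Longrightarrow> \<phi> x = 0" "0 < \<phi> u"
  obtains l where "good l" "snd ` set l \<subseteq> K" "\<And>x. x \<in> H \<Longrightarrow> \<bar>f x - comb l \<phi> x\<bar> \<le> e"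
proof -
  have KH: "K \<subseteq> H" using K(1) compactin_subset_topspace by blast
  \<comment> \<open>y |-> \<phi> (y^-1 x) is the left translate by x of \<phi> composed with
    inversion, so left invariance gives it the same integral c for every x.\<close>
  define c where "c = I (\<lambda>y. \<phi> (i y))"
  have c: "0 < c" unfolding c_def using I_pos[OF inv_Ccp[OF p(1)], of u] p(3) by simp
  define Q where "Q x y = \<phi> (m (i y) x)" for x y
  have Qshift: "shift x (\<lambda>y. \<phi> (i y)) y = Q x y" if "x \<in> H" "y \<in> H" for x y
    using that by (simp add: shift_def Q_def i_m)
  have QC: "Q x \<in> Ccp X" if "x \<in> H" for x
    by (rule Ccp_cong[OF shift_in_Ccp[OF that inv_Ccp[OF p(1)]] Qshift[OF that]])
  have QI: "I (Q x) = c" if "x \<in> H" for x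
    using I.cong[OF shift_in_Ccp[OF that inv_Ccp[OF p(1)]] Qshift[OF that]] I_shift[OF inv_Ccp[OF p(1)] that]
    unfolding c_def by simp
  \<comment> \<open>Freezing y at the centre of its piece then costs at most (e/2) c in total; the
    added 1 keeps the denominator positive.\<close>
  define \<eta> where "\<eta> = (e/2) * c / (I f + 1)"
  have If: "0 \<le> I f" using I.nonneg[OF f] .
  have eta: "0 < \<eta>" "\<eta> * I f \<le> (e/2) * c"
    unfolding \<eta>_def using e c If by (auto simp: field_simps)
  obtain W where W: "openin X W" "u \<in> W" "\<And>w z. w \<in> W \<Longrightarrow> z \<in> H \<Longrightarrow> \<bar>\<phi> (m (i w) z) - \<phi> z\<bar> \<le> \<eta>"
    by (rule right_unif_cont[OF p(1) eta(1)]) blast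
  define U where "U k = {y \<in> H. m (i k) y \<in> W}" for k
  have U: "openin X (U k)" "k \<in> U k" if "k \<in> K" for k
    using openin_continuous_map_preimage[OF cont_lmult W(1), of "i k"] that KH W(2)
    unfolding U_def by auto
  obtain A where A: "finite A" "A \<subseteq> K" and KA: "K \<subseteq> (\<Union>a\<in>A. U a)"
    by (rule compactin_pointwise_subcover[OF K(1) U])
  have UA: "openin X (U a)" if "a \<in> A" for a using U that A by blast
  obtain h where h: "\<And>a. a \<in> A \<Longrightarrow> h a \<in> Ccp X"
    "\<And>a. a \<in> A \<Longrightarrow> \<exists>C. compactin X C \<and> C \<subseteq> U a \<and> (\<forall>x\<in>topspace X - C. h a x = 0)"
    "\<And>x. x \<in> topspace X \<Longrightarrow> f x = (\<Sum>a\<in>A. h a x)"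
    by (rule Ccp_partition[OF A(1) f K UA KA]) blast+
  obtain xs where xs: "set xs = A" "distinct xs" using finite_distinct_list[OF A(1)] by auto
  define l where "l = map (\<lambda>a. (I (h a) / c, a)) xs"
  have comb_l: "comb l \<phi> x = (\<Sum>a\<in>A. \<phi> (m (i a) x) * I (h a)) / c" for x
    unfolding comb_def l_def shift_def using xs
    by (simp add: o_def sum_list_distinct_conv_sum_set sum_divide_distrib mult.commute)
  show ?thesis
  proof (rule that[of l])
    show "good l" using xs A KH c I.nonneg[OF h(1)] unfolding good_def l_def by auto
    show "snd ` set l \<subseteq> K" using xs A unfolding l_def by auto
    fix x assume x: "x \<in> H"
    have fQ: "(\<lambda>y. q y * Q x y) \<in> Ccp X" if "q \<in> Ccp X" for q
      by (rule Ccp_mult[OF that]) (use CcpD[OF QC[OF x]] in auto)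
    \<comment> \<open>Where \<open>Q x y\<close> is nonzero, y^-1 x lies in V, so f y differs from f
      x by at most e/2.\<close>
    have "\<bar>I (\<lambda>y. f x * Q x y) - I (\<lambda>y. f y * Q x y)\<bar> \<le> (e/2) * I (Q x)"
    proof (rule I.approx)
      fix y assume y: "y \<in> H"
      have q0: "0 \<le> Q x y" using CcpD(2)[OF QC[OF x] y] .
      have "\<bar>f x - f y\<bar> * Q x y \<le> e/2 * Q x y"
      proof (cases "m (i y) x \<in> V")
        case True
        then show ?thesis using V(3)[OF x y] q0 by (intro mult_right_mono) auto
      next
        case False
        then show ?thesis using p(2)[of "m (i y) x"] x y unfolding Q_def by simp
      qed
      moreover have "\<bar>f x * Q x y - f y * Q x y\<bar> = \<bar>f x - f y\<bar> * Q x y"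
      proof -
        have "f x * Q x y - f y * Q x y = (f x - f y) * Q x y" by (simp add: algebra_simps)
        then show ?thesis using q0 by (simp only: abs_mult abs_of_nonneg)
      qed
      ultimately show "\<bar>f x * Q x y - f y * Q x y\<bar> \<le> e/2 * Q x y" by simp
    qed (use e x CcpD(2)[OF f x] in \<open>auto intro!: QC fQ[OF f] Ccp_scale\<close>)
    then have 1: "\<bar>f x * c - I (\<lambda>y. f y * Q x y)\<bar> \<le> (e/2) * c"
      using I.scale[OF QC[OF x] CcpD(2)[OF f x]] QI[OF x] by simp
    have "I (\<lambda>y. f y * Q x y) = I (\<lambda>y. \<Sum>a\<in>A. h a y * Q x y)"
      by (rule I.cong[OF fQ[OF f]]) (simp add: h(3) sum_distrib_right)
    also have "\<dots> = (\<Sum>a\<in>A. I (\<lambda>y. h a y * Q x y))"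
      by (rule I.sum[OF A(1)]) (rule fQ[OF h(1)])
    finally have 2: "I (\<lambda>y. f y * Q x y) = (\<Sum>a\<in>A. I (\<lambda>y. h a y * Q x y))" .
    have 3: "\<bar>I (\<lambda>y. h a y * Q x y) - \<phi> (m (i a) x) * I (h a)\<bar> \<le> \<eta> * I (h a)" if a: "a \<in> A" for a
    proof -
      have aH: "a \<in> H" using a A KH by auto
      have p0: "0 \<le> \<phi> (m (i a) x)" using CcpD(2)[OF p(1)] aH x by simp
      have "\<bar>I (\<lambda>y. h a y * Q x y) - I (\<lambda>y. \<phi> (m (i a) x) * h a y)\<bar> \<le> \<eta> * I (h a)"
      proof (rule I.approx)
        fix y assume y: "y \<in> H"
        have h0: "0 \<le> h a y" using CcpD(2)[OF h(1)[OF a] y] .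
        have "\<bar>Q x y - \<phi> (m (i a) x)\<bar> * h a y \<le> \<eta> * h a y"
        proof (cases "y \<in> U a")
          case True
          \<comment> \<open>With w = a^-1 y in W one has y^-1 x = w^-1 (a^-1 x), so right uniform
            continuity compares \<phi> at y^-1 x with \<phi> at a^-1 x.\<close>
          let ?w = "m (i a) y"
          have "?w \<in> W" using True unfolding U_def by simp
          moreover have "m (i ?w) (m (i a) x) = m (i y) x"
            using aH x y by (simp add: i_m assoc)
          ultimately have "\<bar>Q x y - \<phi> (m (i a) x)\<bar> \<le> \<eta>"
            unfolding Q_def using W(3)[of ?w "m (i a) x"] aH x by simp
          then show ?thesis using h0 by (intro mult_right_mono) auto
        next
          case False
          then have "h a y = 0" using h(2)[OF a] y by blast
          then show ?thesis by simp
        qed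
        moreover have "\<bar>h a y * Q x y - \<phi> (m (i a) x) * h a y\<bar> = \<bar>Q x y - \<phi> (m (i a) x)\<bar> * h a y"
        proof -
          have "h a y * Q x y - \<phi> (m (i a) x) * h a y = (Q x y - \<phi> (m (i a) x)) * h a y"
            by (simp add: algebra_simps)
          then show ?thesis using h0 by (simp add: abs_mult)
        qed
        ultimately show "\<bar>h a y * Q x y - \<phi> (m (i a) x) * h a y\<bar> \<le> \<eta> * h a y" by simp
      qed (use eta p0 in \<open>auto intro!: fQ h(1)[OF a] Ccp_scale\<close>)
      then show ?thesis using I.scale[OF h(1)[OF a] p0] by simp
    qed
    have IfA: "I f = (\<Sum>a\<in>A. I (h a))"
      using I.cong[OF f h(3)] I.sum[OF A(1) h(1)] by simp
    have "\<bar>I (\<lambda>y. f y * Q x y) - c * comb l \<phi> x\<bar>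
      = \<bar>\<Sum>a\<in>A. I (\<lambda>y. h a y * Q x y) - \<phi> (m (i a) x) * I (h a)\<bar>"
      unfolding 2 comb_l using c by (simp add: sum_subtractf)
    also have "\<dots> \<le> (\<Sum>a\<in>A. \<eta> * I (h a))"
      by (rule order_trans[OF sum_abs sum_mono]) (rule 3)
    also have "\<dots> \<le> (e/2) * c" using eta(2) unfolding IfA sum_distrib_left .
    finally have "\<bar>I (\<lambda>y. f y * Q x y) - c * comb l \<phi> x\<bar> \<le> e * c / 2" by simp
    moreover have "\<bar>f x * c - I (\<lambda>y. f y * Q x y)\<bar> \<le> e * c / 2" using 1 by simp
    ultimately have "\<bar>f x * c - c * comb l \<phi> x\<bar> \<le> e * c" by linarith
    moreover have "\<bar>f x * c - c * comb l \<phi> x\<bar> = \<bar>f x - comb l \<phi> x\<bar> * c"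
    proof -
      have "f x * c - c * comb l \<phi> x = (f x - comb l \<phi> x) * c" by (simp add: algebra_simps)
      then show ?thesis using c by (simp add: abs_mult)
    qed
    ultimately show "\<bar>f x - comb l \<phi> x\<bar> \<le> e" using c by simp
  qed
qed

text \<open>A constant error cannot be integrated, so it is sharpened to \<open>e * L x\<close> with
  L of compact support chosen before e. L is 1 on the support K of f and on the products of K with a
  compact neighbourhood of the unit; translates by K of a bump inside that neighbourhood vanish
  outside these products.\<close>

lemma approx_comb:
  assumes f: "f \<in> Ccp X"
  obtains L where "L \<in> Ccp X"
    "\<And>e. 0 < e \<Longrightarrow> \<exists>V. openin X V \<and> u \<in> V \<and> (\<forall>\<phi>\<in>Ccp X. (\<forall>x\<in>H - V. \<phi> x = 0) \<longrightarrow> 0 < \<phi> u \<longrightarrow>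
       (\<exists>l. good l \<and> (\<forall>x\<in>H. \<bar>f x - comb l \<phi> x\<bar> \<le> e * L x)))"
proof -
  obtain K where K: "compactin X K" "\<And>x. x \<in> H \<Longrightarrow> x \<notin> K \<Longrightarrow> f x = 0"
    using Ccp_supp[OF f] by metis
  have KH: "K \<subseteq> H" using K(1) compactin_subset_topspace by blast
  obtain V0 C where V0: "openin X V0" "compactin X C" "{u} \<subseteq> V0" "V0 \<subseteq> C"
    by (rule compact_nhd[OF _ openin_topspace, of "{u}"]) auto
  let ?KC = "(\<lambda>(a, b). m a b) ` (K \<times> C)"
  have "compactin (prod_topology X X) (K \<times> C)" using K(1) V0(2) by (simp add: compactin_Times)
  then have "compactin X ?KC" using image_compactin cont_m by blast
  then have "compactin X (K \<union> ?KC)" using K(1) by (rule compactin_Un[rotated])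
  then obtain L where L: "L \<in> Ccp X" "\<And>x. x \<in> topspace X \<Longrightarrow> 0 \<le> L x \<and> L x \<le> 1"
    "\<And>x. x \<in> K \<union> ?KC \<Longrightarrow> L x = 1" by (rule Ccp_one_on) blast
  show ?thesis
  proof (rule that[OF L(1)])
    fix e :: real assume e: "0 < e"
    obtain V where V: "openin X V" "u \<in> V" "\<And>x y. x \<in> H \<Longrightarrow> y \<in> H \<Longrightarrow> m (i y) x \<in> V \<Longrightarrow> \<bar>f x - f y\<bar> \<le> e/2"
      by (rule left_unif_cont[OF f, of "e/2"]) (use e in auto)
    have "\<exists>l. good l \<and> (\<forall>x\<in>H. \<bar>f x - comb l \<phi> x\<bar> \<le> e * L x)"
      if p: "\<phi> \<in> Ccp X" "\<And>x. x \<in> H \<Longrightarrow> x \<notin> V \<inter> V0 \<Longrightarrow> \<phi> x = 0" "0 < \<phi> u" for \<phi>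
    proof -
      have p2: "\<phi> x = 0" if "x \<in> H" "x \<notin> V" for x using p(2) that by blast
      obtain l where l: "good l" "snd ` set l \<subseteq> K" "\<And>x. x \<in> H \<Longrightarrow> \<bar>f x - comb l \<phi> x\<bar> \<le> e"
        by (rule approx_comb_pointwise[OF f K V e p(1) p2 p(3)]) auto
      have "\<bar>f x - comb l \<phi> x\<bar> \<le> e * L x" if x: "x \<in> H" for x
      proof (cases "x \<in> K \<union> ?KC")
        case True
        then show ?thesis using l(3)[OF x] L(3) by simp
      next
        case False
        have "fst q * shift (snd q) \<phi> x = 0" if q: "q \<in> set l" for q
        proof -
          have k: "snd q \<in> K" using l(2) q by auto
          then have kH: "snd q \<in> H" using KH by auto
          have "m (i (snd q)) x \<notin> C"
          proof
            assume "m (i (snd q)) x \<in> C"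
            then have "(snd q, m (i (snd q)) x) \<in> K \<times> C" using k by simp
            then have "(\<lambda>(a, b). m a b) (snd q, m (i (snd q)) x) \<in> ?KC" by (rule imageI)
            then show False using False kH x by simp
          qed
          then show ?thesis unfolding shift_def using p(2)[of "m (i (snd q)) x"] V0(4) kH x by auto
        qed
        then have "comb l \<phi> x = (\<Sum>q\<leftarrow>l. 0)" unfolding comb_def by (intro arg_cong[of _ _ sum_list] map_cong refl)
        then have "comb l \<phi> x = 0" by simp
        then show ?thesis using K(2)[OF x] False L(2)[OF x] e by simp
      qed
      then show ?thesis using l(1) by blast
    qed
    then show "\<exists>V. openin X V \<and> u \<in> V \<and> (\<forall>\<phi>\<in>Ccp X. (\<forall>x\<in>H - V. \<phi> x = 0) \<longrightarrow> 0 < \<phi> u \<longrightarrow>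
       (\<exists>l. good l \<and> (\<forall>x\<in>H. \<bar>f x - comb l \<phi> x\<bar> \<le> e * L x)))"
      using V V0 by (intro exI[of _ "V \<inter> V0"]) auto
  qed
qed

end

section \<open>Groupoid operations and the stability groups\<close>

locale lc_groupoid =
  fixes TG :: "'g topology" and TX :: "'x topology"
    and r s :: "'g \<Rightarrow> 'x" and e :: "'x \<Rightarrow> 'g" and m :: "'g \<Rightarrow> 'g \<Rightarrow> 'g" and i :: "'g \<Rightarrow> 'g"
  assumes lcg: "locally_compact_groupoid TG TX r s e m i"
begin

abbreviation "Gs \<equiv> topspace TG"
abbreviation "Xs \<equiv> topspace TX"

lemma is_topological_groupoid: "topological_groupoid TG TX r s e m i"
  using lcg unfolding locally_compact_groupoid_def by blast

lemma is_groupoid: "groupoid Gs Xs r s e m i"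
  using is_topological_groupoid unfolding topological_groupoid_def by blast

lemma r_in [simp]: "g \<in> Gs \<Longrightarrow> r g \<in> Xs" and s_in [simp]: "g \<in> Gs \<Longrightarrow> s g \<in> Xs"
  and e_in [simp]: "x \<in> Xs \<Longrightarrow> e x \<in> Gs" and r_e [simp]: "x \<in> Xs \<Longrightarrow> r (e x) = x"
  and s_e [simp]: "x \<in> Xs \<Longrightarrow> s (e x) = x"
  and m_in [simp]: "a \<in> Gs \<Longrightarrow> b \<in> Gs \<Longrightarrow> s a = r b \<Longrightarrow> m a b \<in> Gs"
  and r_m [simp]: "a \<in> Gs \<Longrightarrow> b \<in> Gs \<Longrightarrow> s a = r b \<Longrightarrow> r (m a b) = r a"
  and s_m [simp]: "a \<in> Gs \<Longrightarrow> b \<in> Gs \<Longrightarrow> s a = r b \<Longrightarrow> s (m a b) = s b"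
  and m_assoc: "a \<in> Gs \<Longrightarrow> b \<in> Gs \<Longrightarrow> c \<in> Gs \<Longrightarrow> s a = r b \<Longrightarrow> s b = r c \<Longrightarrow> m (m a b) c = m a (m b c)"
  and e_m [simp]: "g \<in> Gs \<Longrightarrow> m (e (r g)) g = g" and m_e [simp]: "g \<in> Gs \<Longrightarrow> m g (e (s g)) = g"
  and i_in [simp]: "g \<in> Gs \<Longrightarrow> i g \<in> Gs" and r_i [simp]: "g \<in> Gs \<Longrightarrow> r (i g) = s g"
  and s_i [simp]: "g \<in> Gs \<Longrightarrow> s (i g) = r g"
  and m_i [simp]: "g \<in> Gs \<Longrightarrow> m g (i g) = e (r g)" and i_m_e [simp]: "g \<in> Gs \<Longrightarrow> m (i g) g = e (s g)"
  using is_groupoid unfolding groupoid_def by blast+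

lemma i_m_cancel [simp]: "a \<in> Gs \<Longrightarrow> b \<in> Gs \<Longrightarrow> s a = r b \<Longrightarrow> m (i a) (m a b) = b"
  by (metis e_m i_in i_m_e m_assoc s_i)

lemma m_i_cancel [simp]: "a \<in> Gs \<Longrightarrow> b \<in> Gs \<Longrightarrow> r a = r b \<Longrightarrow> m a (m (i a) b) = b"
  by (metis e_m i_in m_assoc m_i r_i s_i)

lemma m_cancel_i [simp]: "a \<in> Gs \<Longrightarrow> b \<in> Gs \<Longrightarrow> s a = r b \<Longrightarrow> m (m a b) (i b) = a"
  by (metis i_in m_assoc m_e m_i r_i)

lemma i_i [simp]: "a \<in> Gs \<Longrightarrow> i (i a) = a"
  by (metis i_in i_m_cancel i_m_e m_e r_i s_i)

lemma cont_r: "continuous_map TG TX r" and cont_s: "continuous_map TG TX s"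
  and cont_e: "continuous_map TX TG e" and cont_i: "continuous_map TG TG i"
  and cont_m: "continuous_map (subtopology (prod_topology TG TG) (composable Gs r s)) TG (\<lambda>(a, b). m a b)"
  using is_topological_groupoid unfolding topological_groupoid_def by blast+

sublocale G: lc_Hausdorff TG
  by unfold_locales (use lcg in \<open>auto simp: locally_compact_groupoid_def\<close>)

sublocale X: lc_Hausdorff TX
  by unfold_locales (use lcg in \<open>auto simp: locally_compact_groupoid_def\<close>)

lemma cont_gm:
  assumes f: "continuous_map Y TG f" and g: "continuous_map Y TG g"
    and c: "\<And>y. y \<in> topspace Y \<Longrightarrow> s (f y) = r (g y)"
  shows "continuous_map Y TG (\<lambda>y. m (f y) (g y))"
proof -
  have "(f y, g y) \<in> composable Gs r s" if "y \<in> topspace Y" for y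
    using that c continuous_map_image_subset_topspace[OF f] continuous_map_image_subset_topspace[OF g]
    unfolding composable_def by auto
  then have "continuous_map Y (subtopology (prod_topology TG TG) (composable Gs r s)) (\<lambda>y. (f y, g y))"
    using continuous_map_pairedI[OF f g] by (auto simp: continuous_map_in_subtopology)
  from continuous_map_compose[OF this cont_m] show ?thesis by (simp add: o_def)
qed

text \<open>Continuity of m is given on the subspace of composable pairs. It is recast as a pair of
  neighbourhoods in which composability is tested pair by pair; f and g are later the identity or
  inversion.\<close>

lemma mult_nhds:
  assumes f: "continuous_map TG TG f" and g: "continuous_map TG TG g" and U: "openin TG U"
    and ab: "a \<in> Gs" "b \<in> Gs" "s (f a) = r (g b)" "m (f a) (g b) \<in> U"
  obtains A B where "openin TG A" "openin TG B" "a \<in> A" "b \<in> B"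
    "\<And>a b. a \<in> A \<Longrightarrow> b \<in> B \<Longrightarrow> s (f a) = r (g b) \<Longrightarrow> m (f a) (g b) \<in> U"
proof -
  let ?P = "prod_topology TG TG"
  let ?Q = "{p. s (f (fst p)) = r (g (snd p))}"
  have "continuous_map (subtopology ?P ?Q) TG (\<lambda>p. m (f (fst p)) (g (snd p)))"
    using continuous_map_from_subtopology[OF continuous_map_compose[OF continuous_map_fst f, of TG]]
      continuous_map_from_subtopology[OF continuous_map_compose[OF continuous_map_snd g, of TG]]
    by (intro cont_gm) (auto simp: o_def)
  from openin_continuous_map_preimage[OF this U]
  obtain W where W: "openin ?P W" "{p \<in> topspace (subtopology ?P ?Q). m (f (fst p)) (g (snd p)) \<in> U} = W \<inter> ?Q"
    unfolding openin_subtopology by blast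
  have "(a, b) \<in> {p \<in> topspace (subtopology ?P ?Q). m (f (fst p)) (g (snd p)) \<in> U}" using ab by simp
  then have "(a, b) \<in> W" unfolding W(2) by blast
  then obtain A B where AB: "openin TG A" "openin TG B" "a \<in> A" "b \<in> B" "A \<times> B \<subseteq> W"
    using W(1)[unfolded openin_prod_topology_alt, rule_format, of a b] by blast
  show ?thesis
  proof (rule that[OF AB(1-4)])
    fix a b assume "a \<in> A" "b \<in> B" "s (f a) = r (g b)"
    then have "(a, b) \<in> W \<inter> ?Q" using AB by auto
    then show "m (f a) (g b) \<in> U" unfolding W(2)[symmetric] by simp
  qed
qed

definition Stab :: "'g set" where "Stab = {g \<in> Gs. r g = s g}"

definition St :: "'x \<Rightarrow> 'g set" where "St x = {g \<in> Gs. r g = x \<and> s g = x}"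

definition T :: "'x \<Rightarrow> 'g topology" where "T x = subtopology TG (St x)"

lemma St_sub: "St x \<subseteq> Gs" unfolding St_def by auto

lemma topspace_T [simp]: "topspace (T x) = St x"
  unfolding T_def using St_sub[of x] by auto

lemma StD: "g \<in> St x \<Longrightarrow> g \<in> Gs" "g \<in> St x \<Longrightarrow> r g = x" "g \<in> St x \<Longrightarrow> s g = x"
  unfolding St_def by auto

lemma closedin_Stab: "closedin TG Stab"
proof -
  have "closedin TG {g \<in> Gs. r g = s g}"
    using closedin_continuous_maps_eq[OF X.haus cont_r cont_s] .
  then show ?thesis unfolding Stab_def .
qed

lemma closedin_r_fibre: "x \<in> Xs \<Longrightarrow> closedin TG {g \<in> Gs. r g = x}"
  using closedin_continuous_map_preimage[OF cont_r, of "{x}"] X.haus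
  by (simp add: closedin_Hausdorff_sing_eq)

lemma closedin_St: "x \<in> Xs \<Longrightarrow> closedin TG (St x)"
proof -
  assume "x \<in> Xs"
  then have "closedin TG ({g \<in> Gs. r g = x} \<inter> Stab)"
    using closedin_r_fibre closedin_Stab by blast
  moreover have "{g \<in> Gs. r g = x} \<inter> Stab = St x" unfolding Stab_def St_def by auto
  ultimately show ?thesis by simp
qed

lemma Ccp_T: "x \<in> Xs \<Longrightarrow> f \<in> Ccp TG \<Longrightarrow> f \<in> Ccp (T x)"
  unfolding T_def using Ccp_subtopology closedin_St by blast

lemma lc_group_T:
  assumes x: "x \<in> Xs"
  shows "lc_group (T x) m (e x) i"
proof
  show "locally_compact_space (T x)"
    unfolding T_def by (rule locally_compact_space_closed_subset[OF G.loc_comp closedin_St[OF x]])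
  show "Hausdorff_space (T x)" unfolding T_def using G.haus Hausdorff_space_subtopology by blast
  have fs: "continuous_map (prod_topology (T x) (T x)) TG fst" "continuous_map (prod_topology (T x) (T x)) TG snd"
    using continuous_map_fst[of "T x" "T x"] continuous_map_snd[of "T x" "T x"]
    unfolding T_def continuous_map_in_subtopology by blast+
  have "continuous_map (prod_topology (T x) (T x)) TG (\<lambda>p. m (fst p) (snd p))"
    by (rule cont_gm[OF fs]) (auto simp: St_def)
  then show "continuous_map (prod_topology (T x) (T x)) (T x) (\<lambda>(a, b). m a b)"
    unfolding T_def[of x] continuous_map_in_subtopology
    by (auto simp: case_prod_unfold St_def T_def[symmetric])
  show "continuous_map (T x) (T x) i"
    using continuous_map_from_subtopology[OF cont_i, of "St x"]
    unfolding T_def continuous_map_in_subtopology by (auto simp: St_def)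
  show "m a (e x) = a" if "a \<in> topspace (T x)" for a
    using that m_e[of a] by (auto simp: St_def)
qed (use x in \<open>auto simp: St_def m_assoc\<close>)

text \<open>Upper semicontinuity of the stability groups: the base points over which C meets them
  form a compact, hence closed, set. This rests on continuity of r; the counterpart
  \<open>near_stab\<close> rests on openness.\<close>

lemma compact_avoid:
  assumes C: "compactin TG C" and x: "x \<in> Xs" and d: "C \<inter> St x = {}"
  shows "\<forall>\<^sub>F y in nhdsin TX x. C \<inter> St y = {}"
proof -
  have "compactin TG (C \<inter> Stab)" using compact_Int_closedin[OF C closedin_Stab] .
  then have "compactin TX (r ` (C \<inter> Stab))" using image_compactin cont_r by blast
  then have "closedin TX (r ` (C \<inter> Stab))" using compactin_imp_closedin X.haus by blast
  then have "openin TX (Xs - r ` (C \<inter> Stab))" by blast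
  moreover have "x \<in> Xs - r ` (C \<inter> Stab)" using d x unfolding Stab_def St_def by force
  moreover have "C \<inter> St y = {}" if "y \<in> Xs - r ` (C \<inter> Stab)" for y
    using that unfolding Stab_def St_def by force
  ultimately show ?thesis unfolding eventually_nhdsin by blast
qed

text \<open>h |-> \<phi> (g h) lives on the fibre of r over \<open>s g\<close>, which moves with g.
  Its extension \<psi> from the fibre at g0 to all of G can be compared with the translates for all
  g near g0, and one compact K carries them all.\<close>

lemma translate_approx:
  assumes p: "\<phi> \<in> Ccp TG" and g0: "g0 \<in> Gs"
  obtains \<psi> K where "\<psi> \<in> Ccp TG" "compactin TG K"
    "\<And>h. h \<in> Gs \<Longrightarrow> r h = s g0 \<Longrightarrow> \<psi> h = \<phi> (m g0 h)"
    "\<And>\<epsilon>. 0 < \<epsilon> \<Longrightarrow> \<exists>N. openin TG N \<and> g0 \<in> N \<and> (\<forall>g\<in>N. \<forall>h\<in>Gs. r h = s g \<longrightarrow>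
        \<bar>\<phi> (m g h) - \<psi> h\<bar> \<le> \<epsilon> \<and> (h \<notin> K \<longrightarrow> \<phi> (m g h) = 0 \<and> \<psi> h = 0))"
proof -
  obtain S where S: "compactin TG S" "\<And>x. x \<in> Gs \<Longrightarrow> x \<notin> S \<Longrightarrow> \<phi> x = 0"
    using Ccp_supp[OF p] by metis
  obtain N0 C0 where N0: "openin TG N0" "compactin TG C0" "{g0} \<subseteq> N0" "N0 \<subseteq> C0"
    by (rule G.compact_nhd[OF _ openin_topspace, of "{g0}"]) (use g0 in auto)
  have C0G: "C0 \<subseteq> Gs" using N0(2) compactin_subset_topspace by blast
  let ?P = "prod_topology TG TG"
  let ?Q = "{p \<in> topspace ?P. r (fst p) = r (snd p)}"
  have rc: "continuous_map ?P TX (\<lambda>p. r (fst p))" "continuous_map ?P TX (\<lambda>p. r (snd p))" "continuous_map ?P TX (\<lambda>p. s (fst p))"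
    using continuous_map_compose[OF continuous_map_fst cont_r, of TG]
      continuous_map_compose[OF continuous_map_snd cont_r, of TG]
      continuous_map_compose[OF continuous_map_fst cont_s, of TG] by (simp_all add: o_def)
  have "closedin ?P ?Q"
    using closedin_continuous_maps_eq[OF X.haus rc(1,2)] .
  moreover have "compactin ?P (C0 \<times> S)" using N0(2) S(1) by (simp add: compactin_Times)
  ultimately have "compactin ?P (?Q \<inter> (C0 \<times> S))" by (rule closed_Int_compactin)
  then have Qc: "compactin (subtopology ?P ?Q) (?Q \<inter> (C0 \<times> S))" by (simp add: compactin_subtopology)
  have "continuous_map (subtopology ?P ?Q) TG (\<lambda>p. m (i (fst p)) (snd p))"
  proof (rule cont_gm)
    show "continuous_map (subtopology ?P ?Q) TG (\<lambda>p. i (fst p))"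
      using continuous_map_from_subtopology[OF continuous_map_compose[OF continuous_map_fst cont_i, of TG]]
      by (simp add: o_def)
    show "continuous_map (subtopology ?P ?Q) TG snd"
      by (rule continuous_map_from_subtopology[OF continuous_map_snd])
  qed auto
  from image_compactin[OF Qc this]
  have K1: "compactin TG ((\<lambda>p. m (i (fst p)) (snd p)) ` (?Q \<inter> (C0 \<times> S)))" .
  \<comment> \<open>These are the products g^-1 k with g in C0 and k in the support S. They contain
    every h with \<phi> (g h) nonzero for some g in C0.\<close>
  let ?K1 = "(\<lambda>p. m (i (fst p)) (snd p)) ` (?Q \<inter> (C0 \<times> S))"
  have inK1: "h \<in> ?K1" if "g \<in> C0" "h \<in> Gs" "r h = s g" "\<phi> (m g h) \<noteq> 0" for g h
  proof -
    have gG: "g \<in> Gs" using that C0G by auto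
    have "m g h \<in> S" using S(2)[of "m g h"] that gG by auto
    then have "(g, m g h) \<in> ?Q \<inter> (C0 \<times> S)" using that gG by simp
    moreover have "h = m (i (fst (g, m g h))) (snd (g, m g h))" using that gG by simp
    ultimately show ?thesis by (rule rev_image_eqI)
  qed
  let ?F = "{h \<in> Gs. r h = s g0}"
  have F: "closedin TG ?F" using closedin_r_fibre g0 by simp
  have "(\<lambda>h. \<phi> (m g0 h)) \<in> Ccp (subtopology TG ?F)"
  proof (rule CcpI)
    have "continuous_map (subtopology TG ?F) TG (\<lambda>h. m g0 h)"
      by (rule cont_gm) (use g0 in \<open>auto intro: continuous_map_from_subtopology\<close>)
    from continuous_map_compose[OF this CcpD(1)[OF p]]
    show "continuous_map (subtopology TG ?F) euclideanreal (\<lambda>h. \<phi> (m g0 h))" by (simp add: o_def)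
    show "compactin (subtopology TG ?F) (?F \<inter> ?K1)"
      using closed_Int_compactin[OF F K1] by (simp add: compactin_subtopology)
    show "\<phi> (m g0 h) = 0" if "h \<in> topspace (subtopology TG ?F)" "h \<notin> ?F \<inter> ?K1" for h
      using inK1[of g0 h] that N0 by auto
  qed (use CcpD(2)[OF p] g0 in auto)
  then obtain \<psi> where psi: "\<psi> \<in> Ccp TG" "\<And>h. h \<in> ?F \<Longrightarrow> \<psi> h = \<phi> (m g0 h)"
    by (rule G.Ccp_extend[OF F]) blast
  obtain K2 where K2: "compactin TG K2" "\<And>x. x \<in> Gs \<Longrightarrow> x \<notin> K2 \<Longrightarrow> \<psi> x = 0"
    using Ccp_supp[OF psi(1)] by metis
  show ?thesis
  proof (rule that[of \<psi> "?K1 \<union> K2"])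
    show "\<psi> \<in> Ccp TG" by (rule psi)
    show K: "compactin TG (?K1 \<union> K2)" using K1 K2(1) by (rule compactin_Un)
    show "\<psi> h = \<phi> (m g0 h)" if "h \<in> Gs" "r h = s g0" for h using psi(2) that by simp
    fix \<epsilon> :: real assume eps: "0 < \<epsilon>"
    let ?C = "{p \<in> topspace ?P. s (fst p) = r (snd p)}"
    have Cc: "closedin ?P ?C" using closedin_continuous_maps_eq[OF X.haus rc(3,2)] .
    define D where "D p = \<bar>\<phi> (m (fst p) (snd p)) - \<psi> (snd p)\<bar>" for p
    have "continuous_map (subtopology ?P ?C) TG (\<lambda>p. m (fst p) (snd p))"
      by (rule cont_gm) (auto intro: continuous_map_from_subtopology continuous_map_fst continuous_map_snd)
    from continuous_map_compose[OF this CcpD(1)[OF p]]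
      continuous_map_compose[OF continuous_map_from_subtopology[OF continuous_map_snd] CcpD(1)[OF psi(1)], of TG ?C]
    have "continuous_map (subtopology ?P ?C) euclideanreal D"
      unfolding D_def by (intro continuous_intros) (simp_all add: o_def)
    then have "openin (subtopology ?P ?C) {p \<in> topspace (subtopology ?P ?C). D p \<in> {..<\<epsilon>}}"
      by (rule openin_continuous_map_preimage) simp
    then obtain W where W: "openin ?P W" "{p \<in> topspace (subtopology ?P ?C). D p \<in> {..<\<epsilon>}} = W \<inter> ?C"
      unfolding openin_subtopology by blast
    \<comment> \<open>Adjoining the noncomposable pairs, an open set, makes the condition open in
      the full product, where Wallace's theorem can be applied.\<close>
    have Wo: "openin ?P (W \<union> (topspace ?P - ?C))" using W(1) Cc by blast
    have "{g0} \<times> (?K1 \<union> K2) \<subseteq> W \<union> (topspace ?P - ?C)"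
    proof
      fix p assume pp: "p \<in> {g0} \<times> (?K1 \<union> K2)"
      then have pt: "p \<in> topspace ?P" using g0 compactin_subset_topspace[OF K] by auto
      show "p \<in> W \<union> (topspace ?P - ?C)"
      proof (cases "p \<in> ?C")
        case True
        then have "D p = 0" unfolding D_def using psi(2)[of "snd p"] pp by auto
        then have "p \<in> W \<inter> ?C" using True eps unfolding W(2)[symmetric] by simp
        then show ?thesis by blast
      qed (use pt in blast)
    qed
    then obtain N V where NV: "openin TG N" "openin TG V" "{g0} \<subseteq> N" "?K1 \<union> K2 \<subseteq> V"
      "N \<times> V \<subseteq> W \<union> (topspace ?P - ?C)"
      by (rule Wallace_theorem_prod_topology[OF _ K Wo, of "{g0}", rotated]) (use g0 in auto)
    show "\<exists>N. openin TG N \<and> g0 \<in> N \<and> (\<forall>g\<in>N. \<forall>h\<in>Gs. r h = s g \<longrightarrow>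
        \<bar>\<phi> (m g h) - \<psi> h\<bar> \<le> \<epsilon> \<and> (h \<notin> ?K1 \<union> K2 \<longrightarrow> \<phi> (m g h) = 0 \<and> \<psi> h = 0))"
    proof (intro exI[of _ "N \<inter> N0"] conjI ballI impI)
      show "openin TG (N \<inter> N0)" "g0 \<in> N \<inter> N0" using NV N0 by auto
      fix g h assume g: "g \<in> N \<inter> N0" and h: "h \<in> Gs" and rh: "r h = s g"
      have gC: "g \<in> C0" using g N0 by auto
      have gG: "g \<in> Gs" using gC C0G by auto
      show out: "\<phi> (m g h) = 0" if "h \<notin> ?K1 \<union> K2" using inK1[OF gC h rh] that by blast
      show out': "\<psi> h = 0" if "h \<notin> ?K1 \<union> K2" using K2(2)[OF h] that by blast
      show "\<bar>\<phi> (m g h) - \<psi> h\<bar> \<le> \<epsilon>"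
      proof (cases "h \<in> ?K1 \<union> K2")
        case True
        then have "(g, h) \<in> W \<union> (topspace ?P - ?C)" using NV(4,5) g by blast
        moreover have "(g, h) \<in> ?C" using gG h rh by simp
        ultimately have "(g, h) \<in> W \<inter> ?C" by blast
        then have "D (g, h) < \<epsilon>" unfolding W(2)[symmetric] by simp
        then show ?thesis unfolding D_def by simp
      next
        case False
        then show ?thesis using out out' eps by simp
      qed
    qed
  qed
qed

end

section \<open>Continuity along the stability groups\<close>

locale stab_groupoid = lc_groupoid TG TX r s e m i
  for TG :: "'g topology" and TX :: "'x topology"
    and r s :: "'g \<Rightarrow> 'x" and e :: "'x \<Rightarrow> 'g" and m :: "'g \<Rightarrow> 'g \<Rightarrow> 'g" and i :: "'g \<Rightarrow> 'g" +
  assumes stab_open: "open_map (subtopology TG {g \<in> topspace TG. r g = s g}) TX r"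
begin

lemma near_Xs: "\<forall>\<^sub>F x in nhdsin TX x0. x \<in> Xs"
  unfolding eventually_nhdsin by blast

lemma near_open: "openin TX U \<Longrightarrow> x0 \<in> U \<Longrightarrow> \<forall>\<^sub>F x in nhdsin TX x0. x \<in> U"
  unfolding eventually_nhdsin by blast

text \<open>Neighbourhoods in \<open>nhdsin\<close> contain the point itself, so an eventual
  estimate may be evaluated at x0.\<close>

lemma near_self: "x0 \<in> Xs \<Longrightarrow> \<forall>\<^sub>F x in nhdsin TX x0. P x \<Longrightarrow> P x0"
  unfolding eventually_nhdsin by blast

text \<open>Lower semicontinuity of the stability groups: the open image under r of the stability
  elements in N contains x0, hence all nearby x.\<close>

lemma near_stab:
  assumes N: "openin TG N" and k: "k \<in> N" "k \<in> St x0"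
  shows "\<forall>\<^sub>F x in nhdsin TX x0. \<exists>g\<in>N. g \<in> St x"
proof -
  let ?S = "{g \<in> Gs. r g = s g}"
  have "openin (subtopology TG ?S) (?S \<inter> N)"
    using openin_subtopology_Int2[OF N] .
  then have o: "openin TX (r ` (?S \<inter> N))" using stab_open unfolding open_map_def by blast
  have "k \<in> ?S \<inter> N" using k unfolding St_def by auto
  then have "x0 \<in> r ` (?S \<inter> N)" using StD(2)[OF k(2)] by force
  then have "\<forall>\<^sub>F x in nhdsin TX x0. x \<in> r ` (?S \<inter> N)" using near_open[OF o] by blast
  then show ?thesis by (rule eventually_mono) (auto simp: St_def)
qed

end

locale haar_family = stab_groupoid TG TX r s e m i
  for TG :: "'g topology" and TX :: "'x topology"
    and r s :: "'g \<Rightarrow> 'x" and e :: "'x \<Rightarrow> 'g" and m :: "'g \<Rightarrow> 'g \<Rightarrow> 'g" and i :: "'g \<Rightarrow> 'g" +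
  fixes J :: "'x \<Rightarrow> ('g \<Rightarrow> real) \<Rightarrow> real"
  assumes J: "x \<in> topspace TX \<Longrightarrow> haar_group (T x) m (e x) i (J x)"
begin

lemma J_pf: "x \<in> Xs \<Longrightarrow> pos_functional (T x) (J x)"
  by (rule haar_group.pf[OF J])

lemma J_inv: "x \<in> Xs \<Longrightarrow> f \<in> Ccp (T x) \<Longrightarrow> k \<in> St x \<Longrightarrow> J x (\<lambda>h. f (m (i k) h)) = J x f"
  using haar_group.I_inv[OF J] by simp

lemma J_pos: "x \<in> Xs \<Longrightarrow> f \<in> Ccp (T x) \<Longrightarrow> k \<in> St x \<Longrightarrow> 0 < f k \<Longrightarrow> 0 < J x f"
  using haar_group.I_pos[OF J] by simp

lemma e_St: "x \<in> Xs \<Longrightarrow> e x \<in> St x"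
  unfolding St_def by simp

lemma J_nonneg: "x \<in> Xs \<Longrightarrow> f \<in> Ccp TG \<Longrightarrow> 0 \<le> J x f"
  using pos_functional.nonneg[OF J_pf] Ccp_T by blast

lemma J_mono: "x \<in> Xs \<Longrightarrow> f \<in> Ccp TG \<Longrightarrow> g \<in> Ccp TG \<Longrightarrow> (\<And>h. h \<in> St x \<Longrightarrow> f h \<le> g h) \<Longrightarrow> J x f \<le> J x g"
  using pos_functional.mono[OF J_pf] Ccp_T by simp

lemma J_scale: "x \<in> Xs \<Longrightarrow> f \<in> Ccp TG \<Longrightarrow> 0 \<le> c \<Longrightarrow> J x (\<lambda>h. c * f h) = c * J x f"
  using pos_functional.scale[OF J_pf] Ccp_T by blast

lemma J_add: "x \<in> Xs \<Longrightarrow> f \<in> Ccp TG \<Longrightarrow> g \<in> Ccp TG \<Longrightarrow> J x (\<lambda>h. f h + g h) = J x f + J x g"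
  using pos_functional.add[OF J_pf] Ccp_T by blast

lemma J_pos_near:
  assumes x0: "x0 \<in> Xs" and F: "F \<in> Ccp TG" "0 < F (e x0)"
  shows "\<forall>\<^sub>F x in nhdsin TX x0. x \<in> Xs \<and> F (e x0) / 2 < F (e x) \<and> 0 < J x F"
proof -
  have "continuous_map TX euclideanreal (\<lambda>x. F (e x))"
    using continuous_map_compose[OF cont_e CcpD(1)[OF F(1)]] by (simp add: o_def)
  then have "openin TX {x \<in> Xs. F (e x0) / 2 < F (e x)}" by (rule open_pos_set)
  then have "\<forall>\<^sub>F x in nhdsin TX x0. x \<in> {x \<in> Xs. F (e x0) / 2 < F (e x)}"
    using F x0 by (intro near_open) auto
  then show ?thesis
  proof (rule eventually_mono)
    fix x assume x: "x \<in> {x \<in> Xs. F (e x0) / 2 < F (e x)}"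
    then have "0 < F (e x)" using F by auto
    then show "x \<in> Xs \<and> F (e x0) / 2 < F (e x) \<and> 0 < J x F"
      using x J_pos[OF _ Ccp_T[OF _ F(1)] e_St] by auto
  qed
qed

lemma inv_mult_nhd:
  assumes U: "openin TG U" and k: "k \<in> Gs" "e (s k) \<in> U"
  obtains N where "openin TG N" "k \<in> N" "\<And>a b. a \<in> N \<Longrightarrow> b \<in> N \<Longrightarrow> r a = r b \<Longrightarrow> m (i a) b \<in> U"
proof -
  obtain A B where AB: "openin TG A" "openin TG B" "k \<in> A" "k \<in> B"
    "\<And>a b. a \<in> A \<Longrightarrow> b \<in> B \<Longrightarrow> s (i a) = r (id b) \<Longrightarrow> m (i a) (id b) \<in> U"
    by (rule mult_nhds[OF cont_i continuous_map_id U, of k k]) (use k in auto)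
  show ?thesis
  proof (rule that[of "A \<inter> B"])
    fix a b assume "a \<in> A \<inter> B" "b \<in> A \<inter> B" "r a = r b"
    then show "m (i a) b \<in> U" using AB(5)[of a b] openin_subset[OF AB(1)] by auto
  qed (use AB in auto)
qed

text \<open>On G(x0) the support of L is covered by finitely many sets N with N^-1 N inside the
  region where F exceeds \<open>?d\<close>. For x near x0 the same sets still cover, and any element
  of G(x) in N can be the centre of a translate of F. Their number does not depend on x, so C does
  not either.\<close>

lemma J_bound:
  assumes x0: "x0 \<in> Xs" and F: "F \<in> Ccp TG" "0 < F (e x0)" and L: "L \<in> Ccp TG"
  obtains C where "0 \<le> C" "\<forall>\<^sub>F x in nhdsin TX x0. J x L \<le> C * J x F"
proof -
  let ?d = "F (e x0) / 2"
  define U where "U = {g \<in> Gs. ?d < F g}"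
  have U: "openin TG U" unfolding U_def by (rule open_pos_set[OF CcpD(1)[OF F(1)]])
  obtain K where K: "compactin TG K" "\<And>x. x \<in> Gs \<Longrightarrow> x \<notin> K \<Longrightarrow> L x = 0"
    using Ccp_supp[OF L] by metis
  obtain B where B: "B > 0" "\<And>x. x \<in> Gs \<Longrightarrow> L x \<le> B" using Ccp_bounded[OF L] by metis
  have "\<forall>k\<in>K \<inter> St x0. \<exists>N. openin TG N \<and> k \<in> N \<and> (\<forall>a\<in>N. \<forall>b\<in>N. r a = r b \<longrightarrow> m (i a) b \<in> U)"
  proof
    fix k assume k: "k \<in> K \<inter> St x0"
    have kG: "k \<in> Gs" "e (s k) \<in> U" using k F x0 StD[of k x0] unfolding U_def by auto
    show "\<exists>N. openin TG N \<and> k \<in> N \<and> (\<forall>a\<in>N. \<forall>b\<in>N. r a = r b \<longrightarrow> m (i a) b \<in> U)"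
      by (rule inv_mult_nhd[OF U kG]) blast
  qed
  then obtain N where N': "\<forall>k\<in>K \<inter> St x0. openin TG (N k) \<and> k \<in> N k \<and> (\<forall>a\<in>N k. \<forall>b\<in>N k. r a = r b \<longrightarrow> m (i a) b \<in> U)"
    by (rule bchoice[THEN exE]) blast
  have N: "openin TG (N k)" "k \<in> N k" "\<And>a b. a \<in> N k \<Longrightarrow> b \<in> N k \<Longrightarrow> r a = r b \<Longrightarrow> m (i a) b \<in> U"
    if "k \<in> K \<inter> St x0" for k using bspec[OF N' that] by blast+
  have KS: "compactin TG (K \<inter> St x0)" using compact_Int_closedin[OF K(1) closedin_St[OF x0]] .
  obtain A where A: "finite A" "A \<subseteq> K \<inter> St x0" "K \<inter> St x0 \<subseteq> (\<Union>a\<in>A. N a)"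
    by (rule compactin_pointwise_subcover[OF KS N(1,2)])
  have oN: "openin TG (\<Union>a\<in>A. N a)" using N(1) A(2) by (intro openin_Union) auto
  \<comment> \<open>The part of the support left uncovered is compact and misses G(x0), so it misses
    G(x) for x near x0.\<close>
  have "compactin TG (K \<inter> (Gs - (\<Union>a\<in>A. N a)))" using K(1) oN compact_Int_closedin by blast
  moreover have "(K \<inter> (Gs - (\<Union>a\<in>A. N a))) \<inter> St x0 = {}" using A(3) by blast
  ultimately have "\<forall>\<^sub>F x in nhdsin TX x0. (K \<inter> (Gs - (\<Union>a\<in>A. N a))) \<inter> St x = {}"
    using compact_avoid[OF _ x0] by blast
  moreover have "\<forall>\<^sub>F x in nhdsin TX x0. x \<in> Xs \<and> ?d < F (e x) \<and> 0 < J x F"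
    by (rule J_pos_near[OF x0 F])
  ultimately have "\<forall>\<^sub>F x in nhdsin TX x0. J x L \<le> (real (card A) * (B / ?d)) * J x F"
  proof eventually_elim
    case (elim x)
    then have x: "x \<in> Xs" by simp
    interpret Jx: pos_functional "T x" "J x" by (rule J_pf[OF x])
    interpret K: haar_group "T x" m "e x" i "J x" by (rule J[OF x])
    \<comment> \<open>Centres must lie in G(x) for invariance of \<open>J x\<close> to apply. The
      unit is a default for sets that miss G(x); its term is nonnegative and only enlarges the
      sum.\<close>
    define t where "t a = (if N a \<inter> St x = {} then e x else (SOME k. k \<in> N a \<inter> St x))" for a
    have tN: "t a \<in> N a" if "h \<in> N a" "h \<in> St x" for a h
      using someI[of "\<lambda>k. k \<in> N a \<inter> St x" h] that unfolding t_def by auto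
    have tS: "t a \<in> St x" for a
    proof (cases "N a \<inter> St x = {}")
      case False
      then have "\<exists>k. k \<in> N a \<inter> St x" by blast
      from someI_ex[OF this] show ?thesis using False unfolding t_def by simp
    qed (simp add: t_def e_St[OF x])
    have FT: "F \<in> Ccp (T x)" by (rule Ccp_T[OF x F(1)])
    have trC: "(\<lambda>h. F (m (i (t a)) h)) \<in> Ccp (T x)" for a
      using K.shift_in_Ccp[of "t a", OF _ FT] tS unfolding K.shift_def by simp
    have "L h \<le> (\<Sum>a\<in>A. (B / ?d) * F (m (i (t a)) h))" if h: "h \<in> St x" for h
    proof -
      have t0: "0 \<le> (B / ?d) * F (m (i (t a)) h)" for a
        using CcpD(2)[OF trC, of h] h B F by simp
      show ?thesis
      proof (cases "h \<in> K")
        case True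
        then obtain a where a: "a \<in> A" "h \<in> N a" using elim(1) h StD(1)[OF h] by blast
        have "m (i (t a)) h \<in> U"
          using N(3)[OF _ tN[OF a(2) h] a(2)] a(1) A(2) StD(2)[OF tS] StD(2)[OF h] by auto
        then have "?d \<le> F (m (i (t a)) h)" unfolding U_def by simp
        then have "(B / ?d) * ?d \<le> (B / ?d) * F (m (i (t a)) h)" using B F by (intro mult_left_mono) auto
        moreover have "(B / ?d) * ?d = B" using F by simp
        moreover have "(B / ?d) * F (m (i (t a)) h) \<le> (\<Sum>a\<in>A. (B / ?d) * F (m (i (t a)) h))"
          using a(1) A(1) t0 by (intro member_le_sum) auto
        ultimately show ?thesis using B(2)[OF StD(1)[OF h]] by linarith
      next
        case False
        then have "L h = 0" using K(2) StD(1)[OF h] by blast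
        then show ?thesis using sum_nonneg[of A, OF t0] by simp
      qed
    qed
    then have "J x L \<le> J x (\<lambda>h. \<Sum>a\<in>A. (B / ?d) * F (m (i (t a)) h))"
      using B F by (intro Jx.mono Ccp_T[OF x L] Ccp_sum A Ccp_scale trC) auto
    also have "\<dots> = (\<Sum>a\<in>A. J x (\<lambda>h. (B / ?d) * F (m (i (t a)) h)))"
      using B F by (intro Jx.sum A Ccp_scale trC) auto
    also have "\<dots> = (\<Sum>a\<in>A. (B / ?d) * J x F)"
    proof (rule sum.cong[OF refl])
      fix a
      have "J x (\<lambda>h. (B / ?d) * F (m (i (t a)) h)) = (B / ?d) * J x (\<lambda>h. F (m (i (t a)) h))"
        using B F by (intro Jx.scale trC) auto
      then show "J x (\<lambda>h. (B / ?d) * F (m (i (t a)) h)) = (B / ?d) * J x F"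
        using J_inv[OF x FT tS] by simp
    qed
    finally show ?case by simp
  qed
  then show ?thesis using that[of "real (card A) * (B / ?d)"] B F by simp
qed

lemma J_bound_small:
  assumes x0: "x0 \<in> Xs" and F: "F \<in> Ccp TG" "0 < F (e x0)" and L: "L \<in> Ccp TG" and \<epsilon>: "0 < \<epsilon>"
  obtains \<eta> where "0 < \<eta>" "\<forall>\<^sub>F x in nhdsin TX x0. \<eta> * J x L \<le> \<epsilon> * J x F"
proof -
  obtain C where C: "0 \<le> C" "\<forall>\<^sub>F x in nhdsin TX x0. J x L \<le> C * J x F"
    by (rule J_bound[OF x0 F L]) blast
  define \<eta> where "\<eta> = \<epsilon> / (C + 1)"
  have eta: "0 < \<eta>" "\<eta> * C \<le> \<epsilon>" unfolding \<eta>_def using C(1) \<epsilon> by (auto simp: field_simps)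
  from C(2) near_Xs have "\<forall>\<^sub>F x in nhdsin TX x0. \<eta> * J x L \<le> \<epsilon> * J x F"
  proof eventually_elim
    case (elim x)
    have "\<eta> * J x L \<le> (\<eta> * C) * J x F" using elim eta by simp
    also have "\<dots> \<le> \<epsilon> * J x F" using eta J_nonneg[OF _ F(1)] elim by (intro mult_right_mono) auto
    finally show ?case .
  qed
  then show ?thesis using that eta by blast
qed

text \<open>The compact set where f \<ge> \<eta> misses G(x0) and hence nearby G(x); on those groups
  f \<le> \<eta> L, with L equal to 1 on a support of f.\<close>

lemma J_small:
  assumes x0: "x0 \<in> Xs" and F: "F \<in> Ccp TG" "0 < F (e x0)"
    and f: "f \<in> Ccp TG" "\<And>h. h \<in> St x0 \<Longrightarrow> f h = 0" and \<epsilon>: "0 < \<epsilon>"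
  shows "\<forall>\<^sub>F x in nhdsin TX x0. J x f \<le> \<epsilon> * J x F"
proof -
  obtain K where K: "compactin TG K" "\<And>x. x \<in> Gs \<Longrightarrow> x \<notin> K \<Longrightarrow> f x = 0"
    using Ccp_supp[OF f(1)] by metis
  obtain L where L: "L \<in> Ccp TG" "\<And>x. x \<in> topspace TG \<Longrightarrow> 0 \<le> L x \<and> L x \<le> 1" "\<And>x. x \<in> K \<Longrightarrow> L x = 1"
    by (rule G.Ccp_one_on[OF K(1)]) blast
  obtain \<eta> where eta: "0 < \<eta>" "\<forall>\<^sub>F x in nhdsin TX x0. \<eta> * J x L \<le> \<epsilon> * J x F"
    by (rule J_bound_small[OF x0 F L(1) \<epsilon>])
  have "closedin TG {g \<in> Gs. f g \<in> {\<eta>..}}"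
    by (rule closedin_continuous_map_preimage[OF CcpD(1)[OF f(1)]]) simp
  then have "compactin TG (K \<inter> {g \<in> Gs. f g \<in> {\<eta>..}})" using compact_Int_closedin[OF K(1)] by blast
  moreover have "(K \<inter> {g \<in> Gs. f g \<in> {\<eta>..}}) \<inter> St x0 = {}" using f(2) eta by auto
  ultimately have "\<forall>\<^sub>F x in nhdsin TX x0. (K \<inter> {g \<in> Gs. f g \<in> {\<eta>..}}) \<inter> St x = {}"
    using compact_avoid[OF _ x0] by blast
  then show ?thesis using eta(2) near_Xs
  proof eventually_elim
    case (elim x)
    have "f h \<le> \<eta> * L h" if h: "h \<in> St x" for h
    proof (cases "h \<in> K")
      case True
      then have "f h < \<eta>" using elim(1) h StD(1)[OF h] by force
      then show ?thesis using L(3)[OF True] by simp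
    next
      case False
      then show ?thesis using K(2)[OF StD(1)[OF h]] L(2)[OF StD(1)[OF h]] eta by simp
    qed
    then have "J x f \<le> J x (\<lambda>h. \<eta> * L h)" using elim eta by (intro J_mono f Ccp_scale L) auto
    also have "\<dots> = \<eta> * J x L" using elim eta by (intro J_scale L) auto
    also have "\<dots> \<le> \<epsilon> * J x F" using elim by simp
    finally show ?case .
  qed
qed

text \<open>The hypothesis compares f and g on G(x0) alone. The excess D over the permitted error
  vanishes there, so \<open>J_small\<close> controls it on nearby groups.\<close>

lemma J_compare:
  assumes x0: "x0 \<in> Xs" and F: "F \<in> Ccp TG" "0 < F (e x0)"
    and f: "f \<in> Ccp TG" and g: "g \<in> Ccp TG" and L: "L \<in> Ccp TG" and c: "0 \<le> c" and \<epsilon>: "0 < \<epsilon>"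
    and le: "\<And>h. h \<in> St x0 \<Longrightarrow> \<bar>f h - g h\<bar> \<le> c * L h"
  shows "\<forall>\<^sub>F x in nhdsin TX x0. \<bar>J x f - J x g\<bar> \<le> c * J x L + \<epsilon> * J x F"
proof -
  define D where "D h = max 0 (\<bar>f h - g h\<bar> - c * L h)" for h
  have cL: "(\<lambda>h. c * L h) \<in> Ccp TG" by (rule Ccp_scale[OF L c])
  have D: "D \<in> Ccp TG"
    unfolding D_def by (rule Ccp_pos_diff[OF Ccp_abs_diff[OF f g] CcpD[OF cL]])
  have "\<forall>\<^sub>F x in nhdsin TX x0. J x D \<le> \<epsilon> * J x F"
    by (rule J_small[OF x0 F D _ \<epsilon>]) (use le in \<open>simp add: D_def\<close>)
  then show ?thesis using near_Xs
  proof eventually_elim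
    case (elim x)
    interpret Jx: pos_functional "T x" "J x" by (rule J_pf) (use elim in simp)
    have x: "x \<in> Xs" using elim by simp
    have "\<bar>J x f - J x g\<bar> \<le> 1 * J x (\<lambda>h. c * L h + D h)"
    proof (rule Jx.approx[OF Ccp_T[OF x f] Ccp_T[OF x g] Ccp_T[OF x Ccp_add[OF cL D]]])
      show "\<bar>f h - g h\<bar> \<le> 1 * (c * L h + D h)" for h by (simp add: D_def)
    qed simp
    also have "\<dots> = c * J x L + J x D" using J_add[OF x cL D] J_scale[OF x L c] by simp
    finally show ?case using elim by simp
  qed
qed

text \<open>On G(x) the function \<psi> is compared with h |-> \<phi> (g h) for an element g of G(x)
  close to \<open>i k\<close>, supplied by \<open>near_stab\<close>; invariance of
  \<open>J x\<close> then removes g.\<close>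

lemma J_translate:
  assumes x0: "x0 \<in> Xs" and F: "F \<in> Ccp TG" "0 < F (e x0)" and p: "\<phi> \<in> Ccp TG" and k: "k \<in> St x0"
  obtains \<psi> where "\<psi> \<in> Ccp TG" "\<And>h. h \<in> St x0 \<Longrightarrow> \<psi> h = \<phi> (m (i k) h)"
    "\<And>\<epsilon>. 0 < \<epsilon> \<Longrightarrow> \<forall>\<^sub>F x in nhdsin TX x0. \<bar>J x \<psi> - J x \<phi>\<bar> \<le> \<epsilon> * J x F"
proof -
  have ik: "i k \<in> Gs" "s (i k) = x0" "i k \<in> St x0" using k by (auto simp: St_def)
  obtain \<psi> K where psi: "\<psi> \<in> Ccp TG" and K: "compactin TG K"
    and eq: "\<And>h. h \<in> Gs \<Longrightarrow> r h = s (i k) \<Longrightarrow> \<psi> h = \<phi> (m (i k) h)"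
    and appr: "\<And>\<epsilon>. 0 < \<epsilon> \<Longrightarrow> \<exists>N. openin TG N \<and> i k \<in> N \<and> (\<forall>g\<in>N. \<forall>h\<in>Gs. r h = s g \<longrightarrow>
        \<bar>\<phi> (m g h) - \<psi> h\<bar> \<le> \<epsilon> \<and> (h \<notin> K \<longrightarrow> \<phi> (m g h) = 0 \<and> \<psi> h = 0))"
    by (rule translate_approx[OF p ik(1)]) blast
  obtain L where L: "L \<in> Ccp TG" "\<And>x. x \<in> topspace TG \<Longrightarrow> 0 \<le> L x \<and> L x \<le> 1" "\<And>x. x \<in> K \<Longrightarrow> L x = 1"
    by (rule G.Ccp_one_on[OF K]) blast
  show ?thesis
  proof (rule that[OF psi])
    show "\<psi> h = \<phi> (m (i k) h)" if "h \<in> St x0" for h using eq that ik StD[OF that] by simp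
    fix \<epsilon> :: real assume eps: "0 < \<epsilon>"
    obtain \<eta> where eta: "0 < \<eta>" "\<forall>\<^sub>F x in nhdsin TX x0. \<eta> * J x L \<le> \<epsilon> * J x F"
      by (rule J_bound_small[OF x0 F L(1) eps])
    obtain N where N: "openin TG N" "i k \<in> N" "\<And>g h. g \<in> N \<Longrightarrow> h \<in> Gs \<Longrightarrow> r h = s g \<Longrightarrow>
        \<bar>\<phi> (m g h) - \<psi> h\<bar> \<le> \<eta> \<and> (h \<notin> K \<longrightarrow> \<phi> (m g h) = 0 \<and> \<psi> h = 0)"
      using appr[OF eta(1)] by metis
    have "\<forall>\<^sub>F x in nhdsin TX x0. \<exists>g\<in>N. g \<in> St x" by (rule near_stab[OF N(1,2) ik(3)])
    then show "\<forall>\<^sub>F x in nhdsin TX x0. \<bar>J x \<psi> - J x \<phi>\<bar> \<le> \<epsilon> * J x F" using eta(2) near_Xs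
    proof eventually_elim
      case (elim x)
      then obtain g where g: "g \<in> N" "g \<in> St x" by blast
      have x: "x \<in> Xs" using elim by simp
      interpret Jx: pos_functional "T x" "J x" by (rule J_pf[OF x])
      interpret K: haar_group "T x" m "e x" i "J x" by (rule J[OF x])
      have ig: "i g \<in> St x" "i (i g) = g" using g by (auto simp: St_def)
      have C1: "(\<lambda>h. \<phi> (m g h)) \<in> Ccp (T x)"
        using K.shift_in_Ccp[of "i g", OF _ Ccp_T[OF x p]] ig unfolding K.shift_def by simp
      have "\<bar>J x \<psi> - J x (\<lambda>h. \<phi> (m g h))\<bar> \<le> \<eta> * J x L"
      proof (rule Jx.approx)
        fix h assume "h \<in> topspace (T x)"
        then have h: "h \<in> Gs" "r h = s g" using g by (auto simp: St_def)
        show "\<bar>\<psi> h - \<phi> (m g h)\<bar> \<le> \<eta> * L h"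
          using N(3)[OF g(1) h] L(3)[of h] L(2)[of h] h eta by (cases "h \<in> K") auto
      qed (use eta in \<open>auto intro!: Ccp_T[OF x] psi C1 L(1)\<close>)
      also have "J x (\<lambda>h. \<phi> (m g h)) = J x \<phi>"
        using J_inv[OF x Ccp_T[OF x p] ig(1)] ig(2) by simp
      also have "\<eta> * J x L \<le> \<epsilon> * J x F" using elim by simp
      finally show ?case .
    qed
  qed
qed

text \<open>Up to small relative error each translate integrates like \<phi> on nearby groups, so
  only the total weight of the combination survives.\<close>

lemma J_comb:
  assumes x0: "x0 \<in> Xs" and F: "F \<in> Ccp TG" "0 < F (e x0)" and p: "\<phi> \<in> Ccp TG"
    and l: "\<forall>q\<in>set l. 0 \<le> fst q \<and> snd q \<in> St x0"
  shows "\<exists>g\<in>Ccp TG. (\<forall>h\<in>St x0. g h = (\<Sum>q\<leftarrow>l. fst q * \<phi> (m (i (snd q)) h))) \<and>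
    (\<forall>\<epsilon>>0. \<forall>\<^sub>F x in nhdsin TX x0. \<bar>J x g - (\<Sum>q\<leftarrow>l. fst q) * J x \<phi>\<bar> \<le> \<epsilon> * J x F)"
  using l
proof (induction l)
  case Nil
  have z: "J x (\<lambda>h. 0) = 0" if "x \<in> Xs" for x using pos_functional.zero[OF J_pf[OF that]] .
  have "\<forall>\<^sub>F x in nhdsin TX x0. \<bar>J x (\<lambda>h. 0) - 0 * J x \<phi>\<bar> \<le> \<epsilon> * J x F" if "0 < \<epsilon>" for \<epsilon>
    by (rule eventually_mono[OF near_Xs]) (use that z J_nonneg[OF _ F(1)] in auto)
  then show ?case using Ccp_zero[of TG] by (intro bexI[of _ "\<lambda>h. 0"]) auto
next
  case (Cons q l)
  then obtain g where g: "g \<in> Ccp TG" "\<And>h. h \<in> St x0 \<Longrightarrow> g h = (\<Sum>q\<leftarrow>l. fst q * \<phi> (m (i (snd q)) h))"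
    "\<And>\<epsilon>. 0 < \<epsilon> \<Longrightarrow> \<forall>\<^sub>F x in nhdsin TX x0. \<bar>J x g - (\<Sum>q\<leftarrow>l. fst q) * J x \<phi>\<bar> \<le> \<epsilon> * J x F" by auto
  have q: "0 \<le> fst q" "snd q \<in> St x0" using Cons.prems by auto
  obtain \<psi> where psi: "\<psi> \<in> Ccp TG" "\<And>h. h \<in> St x0 \<Longrightarrow> \<psi> h = \<phi> (m (i (snd q)) h)"
    "\<And>\<epsilon>. 0 < \<epsilon> \<Longrightarrow> \<forall>\<^sub>F x in nhdsin TX x0. \<bar>J x \<psi> - J x \<phi>\<bar> \<le> \<epsilon> * J x F"
    by (rule J_translate[OF x0 F p q(2)]) blast
  have qp: "(\<lambda>h. fst q * \<psi> h) \<in> Ccp TG" by (rule Ccp_scale[OF psi(1) q(1)])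
  show ?case
  proof (intro bexI[of _ "\<lambda>h. fst q * \<psi> h + g h"] conjI allI impI ballI)
    show "(\<lambda>h. fst q * \<psi> h + g h) \<in> Ccp TG" by (rule Ccp_add[OF qp g(1)])
    show "fst q * \<psi> h + g h = (\<Sum>q\<leftarrow>q # l. fst q * \<phi> (m (i (snd q)) h))" if "h \<in> St x0" for h
      using psi(2)[OF that] g(2)[OF that] by simp
    fix \<epsilon> :: real assume eps: "0 < \<epsilon>"
    \<comment> \<open>Dividing by \<open>fst q + 1\<close> makes the cost after multiplication by
      the coefficient at most half of \<epsilon>, also when the coefficient is 0.\<close>
    have "0 < \<epsilon> / (2 * (fst q + 1))" "0 < \<epsilon> / 2" using eps q by auto
    from psi(3)[OF this(1)] g(3)[OF this(2)] near_Xs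
    show "\<forall>\<^sub>F x in nhdsin TX x0. \<bar>J x (\<lambda>h. fst q * \<psi> h + g h) - (\<Sum>q\<leftarrow>q # l. fst q) * J x \<phi>\<bar> \<le> \<epsilon> * J x F"
    proof eventually_elim
      case (elim x)
      have JF: "0 \<le> J x F" using J_nonneg[OF _ F(1)] elim by simp
      have "fst q * \<bar>J x \<psi> - J x \<phi>\<bar> \<le> fst q * (\<epsilon> / (2 * (fst q + 1)) * J x F)"
        using elim q by (intro mult_left_mono) auto
      also have "\<dots> = (fst q / (fst q + 1)) * (\<epsilon> / 2 * J x F)" by (simp add: field_simps)
      also have "\<dots> \<le> 1 * (\<epsilon> / 2 * J x F)" using q eps JF by (intro mult_right_mono) auto
      finally have 1: "\<bar>fst q * (J x \<psi> - J x \<phi>)\<bar> \<le> \<epsilon> / 2 * J x F" using q by (simp add: abs_mult)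
      have "J x (\<lambda>h. fst q * \<psi> h + g h) = fst q * J x \<psi> + J x g"
        using J_add[OF _ qp g(1)] J_scale[OF _ psi(1) q(1)] elim by simp
      then have "J x (\<lambda>h. fst q * \<psi> h + g h) - (\<Sum>q\<leftarrow>q # l. fst q) * J x \<phi>
        = fst q * (J x \<psi> - J x \<phi>) + (J x g - (\<Sum>q\<leftarrow>l. fst q) * J x \<phi>)" by (simp add: algebra_simps)
      moreover have "\<bar>a + b\<bar> \<le> \<epsilon> * c" if "\<bar>a\<bar> \<le> \<epsilon> / 2 * c" "\<bar>b\<bar> \<le> \<epsilon> / 2 * c" for a b c :: real
        using that by (simp add: field_simps)
      ultimately show ?case using 1 elim(2) by metis
    qed
  qed
qed

(* The same bump function \<phi> can be used for several f, so that J x \<phi> cancels in ratios. *)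
lemma J_proportional:
  assumes x0: "x0 \<in> Xs" and F: "F \<in> Ccp TG" "0 < F (e x0)" and f: "f \<in> Ccp TG" and \<epsilon>: "0 < \<epsilon>"
  obtains V where "openin TG V" "e x0 \<in> V"
    "\<And>\<phi>. \<phi> \<in> Ccp TG \<Longrightarrow> (\<And>g. g \<in> Gs \<Longrightarrow> g \<notin> V \<Longrightarrow> \<phi> g = 0) \<Longrightarrow> 0 < \<phi> (e x0) \<Longrightarrow>
      \<exists>A. \<forall>\<^sub>F x in nhdsin TX x0. \<bar>J x f - A * J x \<phi>\<bar> \<le> \<epsilon> * J x F"
proof -
  interpret K: haar_group "T x0" m "e x0" i "J x0" by (rule J[OF x0])
  obtain L0 where L0: "L0 \<in> Ccp (T x0)"
    "\<And>\<epsilon>. 0 < \<epsilon> \<Longrightarrow> \<exists>V. openin (T x0) V \<and> e x0 \<in> V \<and> (\<forall>\<phi>\<in>Ccp (T x0). (\<forall>x\<in>topspace (T x0) - V. \<phi> x = 0) \<longrightarrow> 0 < \<phi> (e x0) \<longrightarrow>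
       (\<exists>l. K.good l \<and> (\<forall>x\<in>topspace (T x0). \<bar>f x - K.comb l \<phi> x\<bar> \<le> \<epsilon> * L0 x)))"
    by (rule K.approx_comb[OF Ccp_T[OF x0 f]]) blast
  \<comment> \<open>The error weight arises on the group G(x0); extended to G it can be integrated
    on the neighbouring groups.\<close>
  obtain L where L: "L \<in> Ccp TG" "\<And>h. h \<in> St x0 \<Longrightarrow> L h = L0 h"
    by (rule G.Ccp_extend[OF closedin_St[OF x0] L0(1)[unfolded T_def]]) blast
  have e3: "0 < \<epsilon>/3" using \<epsilon> by simp
  obtain \<eta> where eta: "0 < \<eta>" "\<forall>\<^sub>F x in nhdsin TX x0. \<eta> * J x L \<le> \<epsilon>/3 * J x F"
    by (rule J_bound_small[OF x0 F L(1) e3])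
  obtain V0 where V0: "openin (T x0) V0" "e x0 \<in> V0"
    "\<And>\<phi>. \<phi>\<in>Ccp (T x0) \<Longrightarrow> (\<forall>x\<in>topspace (T x0) - V0. \<phi> x = 0) \<Longrightarrow> 0 < \<phi> (e x0) \<Longrightarrow>
       (\<exists>l. K.good l \<and> (\<forall>x\<in>topspace (T x0). \<bar>f x - K.comb l \<phi> x\<bar> \<le> \<eta> * L0 x))"
    using L0(2)[OF eta(1)] by blast
  obtain V where V: "openin TG V" "V0 = V \<inter> St x0" using V0(1) unfolding T_def openin_subtopology by blast
  show ?thesis
  proof (rule that[of V])
    show "openin TG V" "e x0 \<in> V" using V V0(2) by auto
    fix \<phi> assume p: "\<phi> \<in> Ccp TG" "\<And>g. g \<in> Gs \<Longrightarrow> g \<notin> V \<Longrightarrow> \<phi> g = 0" "0 < \<phi> (e x0)"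
    have "\<forall>x\<in>topspace (T x0) - V0. \<phi> x = 0" using p(2) V(2) StD(1) by auto
    from V0(3)[OF Ccp_T[OF x0 p(1)] this p(3)]
    obtain l where l: "K.good l" "\<And>h. h \<in> St x0 \<Longrightarrow> \<bar>f h - K.comb l \<phi> h\<bar> \<le> \<eta> * L0 h" by auto
    have "\<forall>q\<in>set l. 0 \<le> fst q \<and> snd q \<in> St x0" using l(1) unfolding K.good_def by simp
    from J_comb[OF x0 F p(1) this] obtain g where g: "g \<in> Ccp TG"
      "\<And>h. h \<in> St x0 \<Longrightarrow> g h = (\<Sum>q\<leftarrow>l. fst q * \<phi> (m (i (snd q)) h))"
      "\<And>\<epsilon>. 0 < \<epsilon> \<Longrightarrow> \<forall>\<^sub>F x in nhdsin TX x0. \<bar>J x g - (\<Sum>q\<leftarrow>l. fst q) * J x \<phi>\<bar> \<le> \<epsilon> * J x F" by blast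
    have "\<forall>\<^sub>F x in nhdsin TX x0. \<bar>J x f - J x g\<bar> \<le> \<eta> * J x L + \<epsilon>/3 * J x F"
      by (rule J_compare[OF x0 F f g(1) L(1) _ e3])
        (use eta l(2) g(2) L(2) in \<open>auto simp: K.comb_def K.shift_def\<close>)
    then have "\<forall>\<^sub>F x in nhdsin TX x0. \<bar>J x f - (\<Sum>q\<leftarrow>l. fst q) * J x \<phi>\<bar> \<le> \<epsilon> * J x F"
      using g(3)[OF e3] eta(2)
    proof eventually_elim
      case (elim x)
      then show ?case by linarith
    qed
    then show "\<exists>A. \<forall>\<^sub>F x in nhdsin TX x0. \<bar>J x f - A * J x \<phi>\<bar> \<le> \<epsilon> * J x F" by blast
  qed
qed

text \<open>A t approximates R while A' t approximates 1, so t has small relative variation and A t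
  inherits it. Multiplying by A' t0 \<ge> 1/2 avoids division by A'; the contributions 2 \<delta>
  and 4 \<delta> (|R0| + 1) add up to the bound.\<close>

lemma ratio_close:
  fixes R R0 A A' t t0 \<delta> :: real
  assumes "\<bar>R - A * t\<bar> \<le> \<delta>" "\<bar>R0 - A * t0\<bar> \<le> \<delta>" "\<bar>1 - A' * t\<bar> \<le> \<delta>" "\<bar>1 - A' * t0\<bar> \<le> \<delta>"
    and d: "0 < \<delta>" "\<delta> \<le> 1/2"
  shows "\<bar>R - R0\<bar> \<le> \<delta> * (6 + 4 * \<bar>R0\<bar>)"
proof -
  have h: "1/2 \<le> A' * t0" using assms by linarith
  have "(A * t - A * t0) * (A' * t0) = (A * t0) * (A' * t - A' * t0)" by (simp add: algebra_simps)
  then have "\<bar>A * t - A * t0\<bar> * \<bar>A' * t0\<bar> = \<bar>A * t0\<bar> * \<bar>A' * t - A' * t0\<bar>" by (metis abs_mult)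
  moreover have "\<bar>A * t0\<bar> * \<bar>A' * t - A' * t0\<bar> \<le> (\<bar>R0\<bar> + 1) * (2 * \<delta>)"
    using assms by (intro mult_mono) linarith+
  moreover have "\<bar>A * t - A * t0\<bar> * (1/2) \<le> \<bar>A * t - A * t0\<bar> * \<bar>A' * t0\<bar>"
    using h by (intro mult_left_mono) auto
  ultimately have "\<bar>A * t - A * t0\<bar> \<le> (\<bar>R0\<bar> + 1) * (4 * \<delta>)" by linarith
  then have "\<bar>R - R0\<bar> \<le> 2 * \<delta> + (\<bar>R0\<bar> + 1) * (4 * \<delta>)" using assms by linarith
  then show ?thesis by (simp add: algebra_simps)
qed

theorem J_ratio_continuous:
  assumes x0: "x0 \<in> Xs" and F: "F \<in> Ccp TG" "0 < F (e x0)" and f: "f \<in> Ccp TG"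
  shows "((\<lambda>x. J x f / J x F) \<longlongrightarrow> J x0 f / J x0 F) (nhdsin TX x0)"
  unfolding tendsto_iff
proof (intro allI impI)
  fix \<epsilon> :: real assume eps: "0 < \<epsilon>"
  define R where "R x = J x f / J x F" for x
  \<comment> \<open>The 7 against the 6 of \<open>ratio_close\<close> leaves a margin of one
    \<delta>, giving strict inequality; the cap 1/2 keeps A' t0 away from 0.\<close>
  define \<delta> where "\<delta> = min (1/2) (\<epsilon> / (7 + 4 * \<bar>R x0\<bar>))"
  have den: "0 < 7 + 4 * \<bar>R x0\<bar>" by linarith
  have d: "0 < \<delta>" using eps den by (simp add: \<delta>_def)
  have d2: "\<delta> \<le> 1/2" unfolding \<delta>_def by (rule min.cobounded1)
  have "\<delta> \<le> \<epsilon> / (7 + 4 * \<bar>R x0\<bar>)" unfolding \<delta>_def by simp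
  then have "\<delta> * (7 + 4 * \<bar>R x0\<bar>) \<le> \<epsilon>" using den by (simp add: pos_le_divide_eq)
  then have de: "\<delta> * (6 + 4 * \<bar>R x0\<bar>) < \<epsilon>" using d by (simp add: algebra_simps)
  obtain V where V: "openin TG V" "e x0 \<in> V"
    "\<And>\<phi>. \<phi> \<in> Ccp TG \<Longrightarrow> (\<And>g. g \<in> Gs \<Longrightarrow> g \<notin> V \<Longrightarrow> \<phi> g = 0) \<Longrightarrow> 0 < \<phi> (e x0) \<Longrightarrow>
      \<exists>A. \<forall>\<^sub>F x in nhdsin TX x0. \<bar>J x f - A * J x \<phi>\<bar> \<le> \<delta> * J x F"
    by (rule J_proportional[OF x0 F f d]) blast
  \<comment> \<open>The approximation of F itself by the same bump becomes, after division by
    \<open>J x F\<close>, an approximation of 1; it eliminates the unknown integral of the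
    bump.\<close>
  obtain V' where V': "openin TG V'" "e x0 \<in> V'"
    "\<And>\<phi>. \<phi> \<in> Ccp TG \<Longrightarrow> (\<And>g. g \<in> Gs \<Longrightarrow> g \<notin> V' \<Longrightarrow> \<phi> g = 0) \<Longrightarrow> 0 < \<phi> (e x0) \<Longrightarrow>
      \<exists>A. \<forall>\<^sub>F x in nhdsin TX x0. \<bar>J x F - A * J x \<phi>\<bar> \<le> \<delta> * J x F"
    by (rule J_proportional[OF x0 F F(1) d]) blast
  have VV: "openin TG (V \<inter> V')" "{e x0} \<subseteq> V \<inter> V'" using V V' by auto
  obtain \<phi> D where p: "\<phi> \<in> Ccp TG" "compactin TG D" "D \<subseteq> V \<inter> V'" "{e x0} \<subseteq> D"
    "\<And>x. x \<in> Gs \<Longrightarrow> 0 \<le> \<phi> x \<and> \<phi> x \<le> 1" "\<And>x. x \<in> {e x0} \<Longrightarrow> \<phi> x = 1"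
    "\<And>x. x \<in> Gs \<Longrightarrow> x \<notin> D \<Longrightarrow> \<phi> x = 0"
    by (rule G.Urysohn_Ccp[OF _ VV]) (use x0 in auto)
  have pV: "\<phi> g = 0" if "g \<in> Gs" "g \<notin> V" for g using p(3,7) that by blast
  have pV': "\<phi> g = 0" if "g \<in> Gs" "g \<notin> V'" for g using p(3,7) that by blast
  obtain A where A: "\<forall>\<^sub>F x in nhdsin TX x0. \<bar>J x f - A * J x \<phi>\<bar> \<le> \<delta> * J x F"
    using V(3)[OF p(1) pV] p(6) by auto
  obtain A' where A': "\<forall>\<^sub>F x in nhdsin TX x0. \<bar>J x F - A' * J x \<phi>\<bar> \<le> \<delta> * J x F"
    using V'(3)[OF p(1) pV'] p(6) by auto
  define t where "t x = J x \<phi> / J x F" for x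
  have ev: "\<forall>\<^sub>F x in nhdsin TX x0. \<bar>R x - A * t x\<bar> \<le> \<delta> \<and> \<bar>1 - A' * t x\<bar> \<le> \<delta>"
    using A A' J_pos_near[OF x0 F]
  proof eventually_elim
    case (elim x)
    then have pos: "0 < J x F" by simp
    have "R x - A * t x = (J x f - A * J x \<phi>) / J x F" "1 - A' * t x = (J x F - A' * J x \<phi>) / J x F"
      unfolding R_def t_def using pos by (simp_all add: field_simps)
    then show ?case using elim pos by (simp add: abs_divide pos_divide_le_eq)
  qed
  then have at0: "\<bar>R x0 - A * t x0\<bar> \<le> \<delta>" "\<bar>1 - A' * t x0\<bar> \<le> \<delta>" using near_self[OF x0] by blast+
  show "\<forall>\<^sub>F x in nhdsin TX x0. dist (J x f / J x F) (J x0 f / J x0 F) < \<epsilon>"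
    using ev
  proof eventually_elim
    case (elim x)
    then have "\<bar>R x - R x0\<bar> \<le> \<delta> * (6 + 4 * \<bar>R x0\<bar>)"
      using ratio_close[of "R x" A "t x" \<delta> "R x0" "t x0" A'] at0 d d2 by blast
    then show ?case using de unfolding dist_real_def R_def by linarith
  qed
qed

end

section \<open>Continuous families of Haar functionals\<close>

lemma continuous_map_nhdsin:
  fixes f :: "'a \<Rightarrow> 'b::topological_space"
  shows "continuous_map X euclidean f \<longleftrightarrow> (\<forall>x\<in>topspace X. (f \<longlongrightarrow> f x) (nhdsin X x))"
proof
  assume f: "continuous_map X euclidean f"
  show "\<forall>x\<in>topspace X. (f \<longlongrightarrow> f x) (nhdsin X x)"
  proof (intro ballI topological_tendstoI)
    fix x S assume x: "x \<in> topspace X" "open S" "f x \<in> S"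
    then have "openin X {y \<in> topspace X. f y \<in> S}"
      using openin_continuous_map_preimage[OF f] by simp
    then show "\<forall>\<^sub>F y in nhdsin X x. f y \<in> S"
      unfolding eventually_nhdsin using x by blast
  qed
next
  assume *: "\<forall>x\<in>topspace X. (f \<longlongrightarrow> f x) (nhdsin X x)"
  have "atin X x \<le> nhdsin X x" for x unfolding atin_def by simp
  then show "continuous_map X euclidean f"
    unfolding continuous_map_atin using * tendsto_mono by (metis limitin_canonical_iff)
qed

(* In a locally finite cover by relatively compact open sets each star is a finite union, and the
   stars are again locally finite; a Urysohn function for closure V inside star V then replaces a
   shrinking of the cover. *)
lemma (in lc_Hausdorff) paracompact_bumps:
  assumes "paracompact_space X"
  obtains P where "P \<subseteq> Ccp X" "\<And>x. x \<in> topspace X \<Longrightarrow> \<exists>p\<in>P. 0 < p x"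
    "\<And>x. x \<in> topspace X \<Longrightarrow> \<exists>N. openin X N \<and> x \<in> N \<and> finite {p\<in>P. \<exists>y\<in>N. p y \<noteq> 0}"
proof -
  let ?U = "{U. openin X U \<and> (\<exists>K. compactin X K \<and> U \<subseteq> K)}"
  have U: "topspace X \<subseteq> \<Union>?U"
    using loc_comp unfolding locally_compact_space_def by blast
  have "\<exists>\<V>. (\<forall>V\<in>\<V>. openin X V) \<and> topspace X \<subseteq> \<Union>\<V> \<and> (\<forall>V\<in>\<V>. \<exists>U\<in>?U. V \<subseteq> U) \<and>
     (\<forall>x\<in>topspace X. \<exists>W. openin X W \<and> x \<in> W \<and> finite {V\<in>\<V>. V \<inter> W \<noteq> {}})"
    by (rule mp[OF spec[OF conjunct2[OF assms[unfolded paracompact_space_def]]]]) (use U in simp)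
  then obtain \<V> where V': "\<forall>V\<in>\<V>. openin X V" "topspace X \<subseteq> \<Union>\<V>" "\<forall>V\<in>\<V>. \<exists>U\<in>?U. V \<subseteq> U"
     "\<forall>x\<in>topspace X. \<exists>W. openin X W \<and> x \<in> W \<and> finite {V\<in>\<V>. V \<inter> W \<noteq> {}}"
    by (elim exE conjE)
  note V = V'(1)[rule_format] V'(2) V'(3)[rule_format] V'(4)[rule_format]
  define cl where "cl V = X closure_of V" for V
  have clc: "compactin X (cl V)" if VV: "V \<in> \<V>" for V
  proof -
    obtain K where K: "compactin X K" "V \<subseteq> K" using V(3)[OF VV] by blast
    then have "cl V \<subseteq> K"
      unfolding cl_def using closure_of_minimal compactin_imp_closedin[OF haus K(1)] by blast
    then show ?thesis using closed_compactin[OF K(1)] closedin_closure_of unfolding cl_def by blast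
  qed
  have Vcl: "V \<subseteq> cl V" if "V \<in> \<V>" for V
    unfolding cl_def using closure_of_subset openin_subset[OF V(1)[OF that]] by blast
  have fin: "finite {V\<in>\<V>. V \<inter> K \<noteq> {}}" if K: "compactin X K" for K
  proof -
    have KX: "K \<subseteq> topspace X" using K compactin_subset_topspace by blast
    obtain W where W': "\<forall>x\<in>topspace X. openin X (W x) \<and> x \<in> W x \<and> finite {V\<in>\<V>. V \<inter> W x \<noteq> {}}"
      using bchoice[OF V'(4)] by (elim exE)
    have W: "openin X (W x)" "x \<in> W x" "finite {V\<in>\<V>. V \<inter> W x \<noteq> {}}" if "x \<in> topspace X" for x
      using bspec[OF W' that] by simp_all
    obtain A where A: "finite A" "A \<subseteq> K" "K \<subseteq> (\<Union>a\<in>A. W a)"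
      by (rule compactin_pointwise_subcover[OF K, of W]) (use W KX in auto)
    have "{V\<in>\<V>. V \<inter> K \<noteq> {}} \<subseteq> (\<Union>a\<in>A. {V\<in>\<V>. V \<inter> W a \<noteq> {}})" using A by blast
    moreover have "finite (\<Union>a\<in>A. {V\<in>\<V>. V \<inter> W a \<noteq> {}})" using A KX W(3) by blast
    ultimately show ?thesis by (rule finite_subset)
  qed
  define star where "star V = \<Union>{W\<in>\<V>. W \<inter> cl V \<noteq> {}}" for V
  have st: "openin X (star V)" "cl V \<subseteq> star V" if "V \<in> \<V>" for V
  proof -
    show "openin X (star V)" unfolding star_def using V(1) by (intro openin_Union) blast
    show "cl V \<subseteq> star V"
      unfolding star_def using V(2) compactin_subset_topspace[OF clc[OF that]] by blast
  qed
  have "\<exists>p. p \<in> Ccp X \<and> (\<forall>x\<in>cl V. p x = 1) \<and> (\<forall>x\<in>topspace X. x \<notin> star V \<longrightarrow> p x = 0)" if "V \<in> \<V>" for V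
    by (rule Urysohn_Ccp[OF clc[OF that] st[OF that]]) blast
  then obtain p where p: "\<And>V. V \<in> \<V> \<Longrightarrow> p V \<in> Ccp X" "\<And>V x. V \<in> \<V> \<Longrightarrow> x \<in> cl V \<Longrightarrow> p V x = 1"
    "\<And>V x. V \<in> \<V> \<Longrightarrow> x \<in> topspace X \<Longrightarrow> x \<notin> star V \<Longrightarrow> p V x = (0::real)" by metis
  show ?thesis
  proof (rule that[of "p ` \<V>"])
    show "p ` \<V> \<subseteq> Ccp X" using p by blast
    show "\<exists>q\<in>p ` \<V>. 0 < q x" if xX: "x \<in> topspace X" for x
    proof -
      obtain V where "V \<in> \<V>" "x \<in> V" using V(2) xX by blast
      then have "p V x = 1" using p(2) Vcl by blast
      then show ?thesis using \<open>V \<in> \<V>\<close> by force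
    qed
    fix x assume "x \<in> topspace X"
    then obtain N where N: "openin X N" "x \<in> N" "finite {V\<in>\<V>. V \<inter> N \<noteq> {}}" using V(4) by blast
    have "{q \<in> p ` \<V>. \<exists>y\<in>N. q y \<noteq> 0} \<subseteq> p ` (\<Union>W\<in>{V\<in>\<V>. V \<inter> N \<noteq> {}}. {V\<in>\<V>. V \<inter> cl W \<noteq> {}})"
    proof
      fix q assume "q \<in> {q \<in> p ` \<V>. \<exists>y\<in>N. q y \<noteq> 0}"
      then obtain V' y where q: "q = p V'" "V' \<in> \<V>" "y \<in> N" "p V' y \<noteq> 0" by blast
      then have "y \<in> star V'" using p(3) openin_subset[OF N(1)] by blast
      then obtain W where W: "W \<in> \<V>" "W \<inter> cl V' \<noteq> {}" "y \<in> W" unfolding star_def by blast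
      \<comment> \<open>An open set meeting a closure meets the set itself. Hence V' meets the
        compact \<open>cl W\<close> for one of the finitely many W meeting N, which leaves finitely
        many V'.\<close>
      have "W \<inter> V' \<noteq> {}"
        using W(2) openin_Int_closure_of_eq_empty[OF V(1)[OF W(1)], of V'] unfolding cl_def by blast
      then have "V' \<inter> cl W \<noteq> {}" using Vcl[OF W(1)] by blast
      then show "q \<in> p ` (\<Union>W\<in>{V\<in>\<V>. V \<inter> N \<noteq> {}}. {V\<in>\<V>. V \<inter> cl W \<noteq> {}})"
        using q W by blast
    qed
    moreover have "finite (p ` (\<Union>W\<in>{V\<in>\<V>. V \<inter> N \<noteq> {}}. {V\<in>\<V>. V \<inter> cl W \<noteq> {}}))"
      using N(3) fin[OF clc] by blast
    ultimately have "finite {q \<in> p ` \<V>. \<exists>y\<in>N. q y \<noteq> 0}" by (rule finite_subset)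
    then show "\<exists>N. openin X N \<and> x \<in> N \<and> finite {q \<in> p ` \<V>. \<exists>y\<in>N. q y \<noteq> 0}" using N by blast
  qed
qed

lemma (in haar_group) scaled:
  assumes c: "0 < c"
  shows "haar_group X m u i (\<lambda>f. c * I f)"
proof -
  interpret I: pos_functional X I by (rule pf)
  have "pos_functional X (\<lambda>f. c * I f)"
    by unfold_locales (use c in \<open>auto simp: I.add I.scale algebra_simps intro!: mult_left_mono I.mono\<close>)
  then show ?thesis
    by (rule haar_group.intro[OF lc_group_axioms haar_group_axioms.intro]) (use c in \<open>auto simp: I_inv I_pos\<close>)
qed

lemma (in lc_group) haar_group_exists: "\<exists>I. haar_group X m u i I"
proof -
  obtain I where I: "pos_functional X I" "\<And>f s. f \<in> Ccp X \<Longrightarrow> s \<in> H \<Longrightarrow> I (shift s f) = I f"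
    "\<And>f. bump f \<Longrightarrow> 0 < I f"
    by (rule haar_functional_exists) blast
  have "haar_group X m u i I"
  proof (rule haar_group.intro[OF lc_group_axioms haar_group_axioms.intro])
    show "pos_functional X I" by (rule I(1))
    show "I (\<lambda>x. f (m (i k) x)) = I f" if "f \<in> Ccp X" "k \<in> H" for f k
    proof -
      have "shift k f = (\<lambda>x. f (m (i k) x))" by (rule ext) (simp add: shift_def)
      then show ?thesis using I(2)[OF that] by simp
    qed
    show "0 < I f" if "f \<in> Ccp X" "k \<in> H" "0 < f k" for f k
      using I(3)[of f] that unfolding bump_def by blast
  qed
  then show ?thesis by blast
qed

lemma (in stab_groupoid) haar_family_exists: "\<exists>J. haar_family TG TX r s e m i J"
proof -
  have "\<forall>x\<in>Xs. \<exists>I. haar_group (T x) m (e x) i I"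
    using lc_group.haar_group_exists[OF lc_group_T] by blast
  then obtain J where "\<forall>x\<in>Xs. haar_group (T x) m (e x) i (J x)" by metis
  then have "haar_family TG TX r s e m i J"
    by (intro haar_family.intro[OF stab_groupoid_axioms haar_family_axioms.intro]) blast
  then show ?thesis by blast
qed

locale cont_haar_family = haar_family TG TX r s e m i J
  for TG :: "'g topology" and TX :: "'x topology"
    and r s :: "'g \<Rightarrow> 'x" and e :: "'x \<Rightarrow> 'g" and m :: "'g \<Rightarrow> 'g \<Rightarrow> 'g" and i :: "'g \<Rightarrow> 'g" and J +
  assumes J_cont: "f \<in> Ccp TG \<Longrightarrow> continuous_map TX euclideanreal (\<lambda>x. J x f)"

text \<open>The factor c x is a sum of weights p x / J x (F p), so the rescaled value of f is a
  locally finite sum of p x times ratios. \<open>F p\<close> is 1 at the units over a support of p,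
  which makes these ratios continuous there.\<close>

lemma (in haar_family) cont_haar_family_exists:
  assumes para: "paracompact_space TX"
  shows "\<exists>J'. cont_haar_family TG TX r s e m i J'"
proof -
  obtain P where P: "P \<subseteq> Ccp TX" "\<And>x. x \<in> Xs \<Longrightarrow> \<exists>p\<in>P. 0 < p x"
    "\<And>x. x \<in> Xs \<Longrightarrow> \<exists>N. openin TX N \<and> x \<in> N \<and> finite {p\<in>P. \<exists>y\<in>N. p y \<noteq> 0}"
    by (rule X.paracompact_bumps[OF para]) blast
  have "\<exists>K. compactin TX K \<and> (\<forall>x\<in>Xs. x \<notin> K \<longrightarrow> p x = 0)" if "p \<in> P" for p
  proof -
    have "p \<in> Ccp TX" using P(1) that by blast
    then show ?thesis unfolding Ccp_def by blast
  qed
  then obtain K where K: "\<And>p. p \<in> P \<Longrightarrow> compactin TX (K p)" "\<And>p x. p \<in> P \<Longrightarrow> x \<in> Xs \<Longrightarrow> x \<notin> K p \<Longrightarrow> p x = 0"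
    by metis
  have "\<exists>F. F \<in> Ccp TG \<and> (\<forall>x\<in>K p. F (e x) = 1)" if "p \<in> P" for p
    by (rule G.Ccp_one_on[OF image_compactin[OF K(1)[OF that] cont_e]]) blast
  then obtain F where F: "\<And>p. p \<in> P \<Longrightarrow> F p \<in> Ccp TG" "\<And>p x. p \<in> P \<Longrightarrow> x \<in> K p \<Longrightarrow> F p (e x) = 1" by metis
  have JF: "0 < J x (F p)" if "p \<in> P" "x \<in> Xs" "p x \<noteq> 0" for p x
    using J_pos[OF that(2) Ccp_T[OF that(2) F(1)[OF that(1)]] e_St[OF that(2)]] F(2) K(2) that by fastforce
  \<comment> \<open>Restricting to p x nonzero keeps the sum finite and every denominator
    positive.\<close>
  define c where "c x = (\<Sum>p\<in>{p\<in>P. p x \<noteq> 0}. p x / J x (F p))" for x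
  have c_pos: "0 < c x" if x: "x \<in> Xs" for x
  proof -
    obtain N where N: "openin TX N" "x \<in> N" "finite {p\<in>P. \<exists>y\<in>N. p y \<noteq> 0}" using P(3)[OF x] by blast
    have "finite {p\<in>P. p x \<noteq> 0}" by (rule finite_subset[OF _ N(3)]) (use N(2) in blast)
    moreover have "{p\<in>P. p x \<noteq> 0} \<noteq> {}" using P(2)[OF x] by force
    moreover have "0 < p x / J x (F p)" if "p \<in> {p\<in>P. p x \<noteq> 0}" for p
      using that JF x P(1) CcpD(2)[of p TX x] by (intro divide_pos_pos) force+
    ultimately show ?thesis unfolding c_def by (intro sum_pos) auto
  qed
  define J' where "J' x f = c x * J x f" for x f
  have J'_eq: "J' x = (\<lambda>f. c x * J x f)" for x unfolding J'_def by (rule ext) simp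
  have hf: "haar_family TG TX r s e m i J'"
  proof (rule haar_family.intro[OF stab_groupoid_axioms haar_family_axioms.intro])
    show "haar_group (T x) m (e x) i (J' x)" if "x \<in> Xs" for x
      unfolding J'_eq by (rule haar_group.scaled[OF J[OF that] c_pos[OF that]])
  qed
  have "cont_haar_family TG TX r s e m i J'"
  proof (rule cont_haar_family.intro[OF hf cont_haar_family_axioms.intro])
    fix f assume f: "f \<in> Ccp TG"
    show "continuous_map TX euclideanreal (\<lambda>x. J' x f)"
      unfolding continuous_map_nhdsin
    proof
      fix x0 assume x0: "x0 \<in> Xs"
      obtain N where N: "openin TX N" "x0 \<in> N" "finite {p\<in>P. \<exists>y\<in>N. p y \<noteq> 0}" using P(3)[OF x0] by blast
      let ?A = "{p\<in>P. \<exists>y\<in>N. p y \<noteq> 0}"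
      have eq: "(\<Sum>p\<in>?A. p x * (J x f / J x (F p))) = J' x f" if "x \<in> N" for x
      proof -
        have "J' x f = (\<Sum>p\<in>{p\<in>P. p x \<noteq> 0}. p x * (J x f / J x (F p)))"
          unfolding J'_def c_def sum_distrib_right by simp
        also have "\<dots> = (\<Sum>p\<in>?A. p x * (J x f / J x (F p)))"
          using N(3) that by (intro sum.mono_neutral_left) auto
        finally show ?thesis by simp
      qed
      have "((\<lambda>x. p x * (J x f / J x (F p))) \<longlongrightarrow> p x0 * (J x0 f / J x0 (F p))) (nhdsin TX x0)"
        if p: "p \<in> ?A" for p
      proof (cases "x0 \<in> K p")
        case True
        have "(p \<longlongrightarrow> p x0) (nhdsin TX x0)"
          using CcpD(1)[of p TX] P(1) p x0 continuous_map_nhdsin[of TX p] by blast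
        moreover have "((\<lambda>x. J x f / J x (F p)) \<longlongrightarrow> J x0 f / J x0 (F p)) (nhdsin TX x0)"
          using p F True by (intro J_ratio_continuous x0 f) auto
        ultimately show ?thesis by (rule tendsto_mult)
      next
        case False
        have "closedin TX (K p)" using compactin_imp_closedin[OF X.haus K(1)] p by blast
        then have "openin TX (Xs - K p)" by blast
        then have "\<forall>\<^sub>F x in nhdsin TX x0. x \<in> Xs - K p" using False x0 by (intro near_open) auto
        then have "\<forall>\<^sub>F x in nhdsin TX x0. p x * (J x f / J x (F p)) = 0"
          by (rule eventually_mono) (use K(2) p in auto)
        moreover have "p x0 = 0" using K(2)[OF _ x0 False] p by blast
        ultimately show ?thesis by (simp add: tendsto_eventually)
      qed
      then have lim: "((\<lambda>x. \<Sum>p\<in>?A. p x * (J x f / J x (F p))) \<longlongrightarrow> (\<Sum>p\<in>?A. p x0 * (J x0 f / J x0 (F p)))) (nhdsin TX x0)"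
        by (rule tendsto_sum)
      have "\<forall>\<^sub>F x in nhdsin TX x0. (\<Sum>p\<in>?A. p x * (J x f / J x (F p))) = J' x f"
        using near_open[OF N(1,2)] by (rule eventually_mono) (rule eq)
      then show "((\<lambda>x. J' x f) \<longlongrightarrow> J' x0 f) (nhdsin TX x0)"
        using lim eq[OF N(2)] tendsto_cong by force
    qed
  qed
  then show ?thesis by blast
qed

section \<open>Integration over the stability groups\<close>

context cont_haar_family
begin

definition Phi :: "('g \<Rightarrow> real) \<Rightarrow> 'g \<Rightarrow> real" where
  "Phi \<phi> g = J (s g) (\<lambda>h. \<phi> (m g h))"

lemma shift_Ccp:
  assumes p: "\<phi> \<in> Ccp TG" and g: "g \<in> Gs"
  shows "(\<lambda>h. \<phi> (m g h)) \<in> Ccp (T (s g))"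
proof -
  obtain \<psi> where psi: "\<psi> \<in> Ccp TG" "\<And>h. h \<in> Gs \<Longrightarrow> r h = s g \<Longrightarrow> \<psi> h = \<phi> (m g h)"
    by (rule translate_approx[OF p g]) blast
  show ?thesis
    by (rule Ccp_cong[OF Ccp_T[OF _ psi(1)]]) (use psi(2) g in \<open>auto simp: St_def\<close>)
qed

lemma Phi_add: "\<phi> \<in> Ccp TG \<Longrightarrow> \<psi> \<in> Ccp TG \<Longrightarrow> g \<in> Gs \<Longrightarrow> Phi (\<lambda>h. \<phi> h + \<psi> h) g = Phi \<phi> g + Phi \<psi> g"
  unfolding Phi_def using pos_functional.add[OF J_pf[OF s_in] shift_Ccp shift_Ccp] by simp

lemma Phi_scale: "\<phi> \<in> Ccp TG \<Longrightarrow> 0 \<le> c \<Longrightarrow> g \<in> Gs \<Longrightarrow> Phi (\<lambda>h. c * \<phi> h) g = c * Phi \<phi> g"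
  unfolding Phi_def using pos_functional.scale[OF J_pf[OF s_in] shift_Ccp] by simp

lemma Phi_mono:
  assumes "\<phi> \<in> Ccp TG" "\<psi> \<in> Ccp TG" "g \<in> Gs" "\<And>h. h \<in> Gs \<Longrightarrow> \<phi> h \<le> \<psi> h"
  shows "Phi \<phi> g \<le> Phi \<psi> g"
  unfolding Phi_def
  by (rule pos_functional.mono[OF J_pf[OF s_in] shift_Ccp shift_Ccp]) (use assms in \<open>auto simp: St_def\<close>)

lemma Phi_nonneg: "\<phi> \<in> Ccp TG \<Longrightarrow> g \<in> Gs \<Longrightarrow> 0 \<le> Phi \<phi> g"
  unfolding Phi_def using pos_functional.nonneg[OF J_pf[OF s_in] shift_Ccp] by simp

lemma Phi_pos:
  assumes p: "\<phi> \<in> Ccp TG" and g: "g \<in> Gs" and "0 < \<phi> g"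
  shows "0 < Phi \<phi> g"
  unfolding Phi_def
  by (rule J_pos[OF s_in[OF g] shift_Ccp[OF p g] e_St[OF s_in[OF g]]]) (use assms in simp)

lemma Phi_zero:
  assumes g: "g \<in> Gs" and z: "\<And>k. k \<in> Gs \<Longrightarrow> r k = r g \<Longrightarrow> s k = s g \<Longrightarrow> \<phi> k = 0"
  shows "Phi \<phi> g = 0"
proof -
  interpret Jx: pos_functional "T (s g)" "J (s g)" by (rule J_pf) (use g in simp)
  have "J (s g) (\<lambda>h. 0) = J (s g) (\<lambda>h. \<phi> (m g h))"
    by (rule Jx.cong[OF Ccp_zero]) (use g z in \<open>auto simp: St_def\<close>)
  then show ?thesis unfolding Phi_def using Jx.zero by simp
qed

text \<open>With g' = g k and k in the stability group at \<open>s g\<close>, the integrand at g' is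
  the left translate by k^-1 of the integrand at g.\<close>

lemma Phi_class:
  assumes p: "\<phi> \<in> Ccp TG" and g: "g \<in> Gs" "g' \<in> Gs" "r g' = r g" "s g' = s g"
  shows "Phi \<phi> g' = Phi \<phi> g"
proof -
  interpret Jx: pos_functional "T (s g)" "J (s g)" by (rule J_pf) (use g in simp)
  define k where "k = m (i g) g'"
  have k: "k \<in> St (s g)" "i k \<in> St (s g)" "m g k = g'" using g unfolding k_def by (auto simp: St_def)
  have "J (s g) (\<lambda>h. \<phi> (m g (m (i (i k)) h))) = J (s g) (\<lambda>h. \<phi> (m g h))"
    using J_inv[OF _ shift_Ccp[OF p g(1)] k(2)] g by simp
  moreover have "J (s g) (\<lambda>h. \<phi> (m g' h)) = J (s g) (\<lambda>h. \<phi> (m g (m (i (i k)) h)))"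
    by (rule Jx.cong[OF shift_Ccp[OF p g(2), unfolded g(4)]])
      (use k g in \<open>auto simp: St_def m_assoc[symmetric]\<close>)
  ultimately show ?thesis unfolding Phi_def using g(4) by simp
qed

text \<open>The translate of \<phi> by \<alpha> exists only on the fibre over
  \<open>s \<alpha>\<close>, so it is represented by any \<psi> in the cone that agrees with it
  there.\<close>

lemma Phi_translate:
  assumes p: "\<phi> \<in> Ccp TG" and "\<psi> \<in> Ccp TG" and a: "\<alpha> \<in> Gs" "g \<in> Gs" "s \<alpha> = r g"
    and eq: "\<And>h. h \<in> Gs \<Longrightarrow> r h = s \<alpha> \<Longrightarrow> \<psi> h = \<phi> (m \<alpha> h)"
  shows "Phi \<psi> g = Phi \<phi> (m \<alpha> g)"
proof -
  interpret Jx: pos_functional "T (s g)" "J (s g)" by (rule J_pf) (use a in simp)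
  have "J (s g) (\<lambda>h. \<psi> (m g h)) = J (s g) (\<lambda>h. \<phi> (m (m \<alpha> g) h))"
    by (rule Jx.cong[OF shift_Ccp]) (use assms in \<open>auto simp: St_def m_assoc\<close>)
  then show ?thesis unfolding Phi_def using a by simp
qed

text \<open>Two variations are separated: h |-> \<phi> (g h) stays uniformly close to a fixed \<psi>
  within a fixed compact set, while \<open>J (s g) \<psi>\<close> is continuous in g by continuity
  of the family.\<close>

lemma Phi_cont:
  assumes p: "\<phi> \<in> Ccp TG"
  shows "continuous_map TG euclideanreal (Phi \<phi>)"
  unfolding continuous_map_nhdsin
proof
  fix g0 assume g0: "g0 \<in> Gs"
  obtain \<psi> K where psi: "\<psi> \<in> Ccp TG" and K: "compactin TG K"
    and eq: "\<And>h. h \<in> Gs \<Longrightarrow> r h = s g0 \<Longrightarrow> \<psi> h = \<phi> (m g0 h)"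
    and appr: "\<And>\<epsilon>. 0 < \<epsilon> \<Longrightarrow> \<exists>N. openin TG N \<and> g0 \<in> N \<and> (\<forall>g\<in>N. \<forall>h\<in>Gs. r h = s g \<longrightarrow>
        \<bar>\<phi> (m g h) - \<psi> h\<bar> \<le> \<epsilon> \<and> (h \<notin> K \<longrightarrow> \<phi> (m g h) = 0 \<and> \<psi> h = 0))"
    by (rule translate_approx[OF p g0]) blast
  obtain L where L: "L \<in> Ccp TG" "\<And>x. x \<in> topspace TG \<Longrightarrow> 0 \<le> L x \<and> L x \<le> 1" "\<And>x. x \<in> K \<Longrightarrow> L x = 1"
    by (rule G.Ccp_one_on[OF K]) blast
  have lim: "((\<lambda>g. J (s g) f) \<longlongrightarrow> J (s g0) f) (nhdsin TG g0)" if "f \<in> Ccp TG" for f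
    using continuous_map_compose[OF cont_s J_cont[OF that]] g0 by (auto simp: o_def continuous_map_nhdsin)
  have J0: "J (s g0) \<psi> = Phi \<phi> g0"
    unfolding Phi_def
    by (rule pos_functional.cong[OF J_pf[OF s_in[OF g0]] Ccp_T[OF s_in[OF g0] psi]])
      (use eq in \<open>auto simp: St_def\<close>)
  let ?b = "J (s g0) L + 1"
  have b: "0 < ?b" using J_nonneg[OF s_in[OF g0] L(1)] by simp
  show "(Phi \<phi> \<longlongrightarrow> Phi \<phi> g0) (nhdsin TG g0)"
    unfolding tendsto_iff
  proof (intro allI impI)
    fix \<epsilon> :: real assume eps: "0 < \<epsilon>"
    define \<eta> where "\<eta> = \<epsilon> / (2 * ?b)"
    have eta: "0 < \<eta>" "\<eta> * ?b = \<epsilon> / 2" unfolding \<eta>_def using eps b by (auto simp: field_simps)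
    obtain N where N: "openin TG N" "g0 \<in> N" "\<And>g h. g \<in> N \<Longrightarrow> h \<in> Gs \<Longrightarrow> r h = s g \<Longrightarrow>
        \<bar>\<phi> (m g h) - \<psi> h\<bar> \<le> \<eta> \<and> (h \<notin> K \<longrightarrow> \<phi> (m g h) = 0 \<and> \<psi> h = 0)"
      using appr[OF eta(1)] by metis
    have 1: "\<forall>\<^sub>F g in nhdsin TG g0. g \<in> N" unfolding eventually_nhdsin using N by blast
    have 2: "\<forall>\<^sub>F g in nhdsin TG g0. dist (J (s g) \<psi>) (J (s g0) \<psi>) < \<epsilon> / 2"
      using lim[OF psi, unfolded tendsto_iff, rule_format, of "\<epsilon> / 2"] eps by simp
    have 3: "\<forall>\<^sub>F g in nhdsin TG g0. dist (J (s g) L) (J (s g0) L) < 1"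
      using lim[OF L(1)] unfolding tendsto_iff by simp
    from 1 2 3 show "\<forall>\<^sub>F g in nhdsin TG g0. dist (Phi \<phi> g) (Phi \<phi> g0) < \<epsilon>"
    proof eventually_elim
      case (elim g)
      have g: "g \<in> Gs" using elim(1) openin_subset[OF N(1)] by blast
      interpret Jx: pos_functional "T (s g)" "J (s g)" by (rule J_pf) (use g in simp)
      have "\<bar>Phi \<phi> g - J (s g) \<psi>\<bar> \<le> \<eta> * J (s g) L"
        unfolding Phi_def
      proof (rule Jx.approx)
        fix h assume "h \<in> topspace (T (s g))"
        then have h: "h \<in> Gs" "r h = s g" by (auto simp: St_def)
        show "\<bar>\<phi> (m g h) - \<psi> h\<bar> \<le> \<eta> * L h"
          using N(3)[OF elim(1) h] L(3)[of h] L(2)[of h] h eta by (cases "h \<in> K") auto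
      qed (use eta g in \<open>auto intro!: Ccp_T psi shift_Ccp[OF p] L(1)\<close>)
      also have "\<dots> \<le> \<eta> * ?b"
        using elim(3) eta(1) by (intro mult_left_mono) (auto simp: dist_real_def)
      finally show ?case using elim(2) eta(2) unfolding J0 dist_real_def by linarith
    qed
  qed
qed

end

section \<open>The quotient groupoid and its Haar systems\<close>

lemma measure_support_closedin:
  "closedin X (measure_support X M)"
proof -
  let ?N = "\<Union>{U. openin X U \<and> emeasure M U = 0}"
  have "topspace X - measure_support X M = ?N"
    unfolding measure_support_def using openin_subset zero_less_iff_neq_zero by fastforce
  moreover have "openin X ?N" by (rule openin_Union) blast
  ultimately show ?thesis unfolding closedin_def measure_support_def by auto
qed

text \<open>The complement of the support is a possibly uncountable union of null open sets. A
  compact part of it is covered by finitely many of them, and inner regularity makes the whole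
  complement null.\<close>

lemma radon_AE_support:
  assumes M: "radon_measure X M"
  shows "AE x in M. x \<in> measure_support X M"
proof -
  let ?V = "topspace X - measure_support X M"
  have V: "openin X ?V" using measure_support_closedin by blast
  have K0: "emeasure M K = 0" if K: "compactin X K" "K \<subseteq> ?V" for K
  proof -
    let ?U = "{U. openin X U \<and> emeasure M U = 0}"
    have "K \<subseteq> \<Union>?U" using K(2) unfolding measure_support_def by (auto simp: zero_less_iff_neq_zero)
    then have "\<exists>\<F>. finite \<F> \<and> \<F> \<subseteq> ?U \<and> K \<subseteq> \<Union>\<F>" by (intro compactinD[OF K(1)]) auto
    then obtain \<F> where F: "finite \<F>" "\<F> \<subseteq> ?U" "K \<subseteq> \<Union>\<F>" by (elim exE conjE)
    have "\<Union>\<F> \<in> null_sets M"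
      using F radon_openin_sets[OF M] by (intro null_sets.finite_Union) (auto intro!: null_setsI)
    then show ?thesis using F(3) emeasure_mono[of K "\<Union>\<F>" M] by (auto simp: null_sets_def)
  qed
  have "emeasure M ?V = (SUP K\<in>{K. compactin X K \<and> K \<subseteq> ?V}. emeasure M K)"
    using M V unfolding radon_measure_def by blast
  also have "\<dots> \<le> 0" by (rule SUP_least) (use K0 in auto)
  finally have "emeasure M ?V = 0" by simp
  then have "?V \<in> null_sets M" using radon_openin_sets[OF M V] by blast
  moreover have "{x \<in> space M. x \<notin> measure_support X M} \<subseteq> ?V"
    using M unfolding radon_measure_def by auto
  ultimately show ?thesis by (rule AE_I'[rotated, rotated, THEN AE_mp]) auto
qed

text \<open>The integrands in the invariance axiom are cut off to 0 outside a fibre and need not be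
  continuous; almost everywhere they agree with a \<psi> in the cone.\<close>

lemma radon_integral_restrict:
  fixes f \<psi> :: "'a \<Rightarrow> real"
  assumes X: "Hausdorff_space X" and M: "radon_measure X M" and A: "closedin X A" "measure_support X M \<subseteq> A"
    and \<psi>: "\<psi> \<in> Ccp X" and f: "\<And>x. x \<in> A \<Longrightarrow> f x = \<psi> x" "\<And>x. x \<in> topspace X \<Longrightarrow> x \<notin> A \<Longrightarrow> f x = 0"
  shows "integrable M f" "integral\<^sup>L M f = integral\<^sup>L M \<psi>"
proof -
  have sp: "space M = topspace X" using M unfolding radon_measure_def by blast
  have pm: "\<psi> \<in> borel_measurable M" using radon_measurable_continuous[OF M CcpD(1)[OF \<psi>]] .
  have "(\<lambda>x. indicator A x * \<psi> x) \<in> borel_measurable M"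
    using radon_closedin_sets[OF M A(1)] pm by (intro borel_measurable_times borel_measurable_indicator)
  moreover have "indicator A x * \<psi> x = f x" if "x \<in> space M" for x
    using f that sp by (cases "x \<in> A") auto
  ultimately have fm: "f \<in> borel_measurable M" using measurable_cong[of M "\<lambda>x. indicator A x * \<psi> x" f] by blast
  have ae: "AE x in M. f x = \<psi> x" using radon_AE_support[OF M] by (rule AE_mp) (use A f in auto)
  show "integrable M f"
    using integrable_cong_AE[OF fm pm ae] radon_integrable_Ccp[OF X M \<psi>] by blast
  show "integral\<^sup>L M f = integral\<^sup>L M \<psi>" by (rule integral_cong_AE[OF fm pm ae])
qed

section \<open>Passage from nonnegative to complex functions\<close>

definition pos_part :: "('a \<Rightarrow> real) \<Rightarrow> 'a \<Rightarrow> real" where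
  "pos_part f = (\<lambda>x. max 0 (f x))"

lemma Cc_parts:
  assumes \<phi>: "\<phi> \<in> Cc X"
  shows "pos_part (\<lambda>x. Re (\<phi> x)) \<in> Ccp X" "pos_part (\<lambda>x. - Re (\<phi> x)) \<in> Ccp X"
    "pos_part (\<lambda>x. Im (\<phi> x)) \<in> Ccp X" "pos_part (\<lambda>x. - Im (\<phi> x)) \<in> Ccp X"
proof -
  have c: "continuous_map X euclidean \<phi>" using \<phi> unfolding Cc_def by blast
  obtain K where K: "compactin X K" "\<And>x. x \<in> topspace X \<Longrightarrow> x \<notin> K \<Longrightarrow> \<phi> x = 0"
    using \<phi> unfolding Cc_def by blast
  have ri: "continuous_map X euclideanreal (\<lambda>x. Re (\<phi> x))" "continuous_map X euclideanreal (\<lambda>x. Im (\<phi> x))"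
    using c unfolding continuous_map_nhdsin by (auto intro: tendsto_Re tendsto_Im)
  have *: "pos_part f \<in> Ccp X" if "continuous_map X euclideanreal f" "\<And>x. x \<in> topspace X \<Longrightarrow> x \<notin> K \<Longrightarrow> f x = 0" for f
    by (rule CcpI[OF _ _ K(1)]) (use that in \<open>auto simp: pos_part_def intro!: continuous_intros\<close>)
  show "pos_part (\<lambda>x. Re (\<phi> x)) \<in> Ccp X" "pos_part (\<lambda>x. - Re (\<phi> x)) \<in> Ccp X"
    "pos_part (\<lambda>x. Im (\<phi> x)) \<in> Ccp X" "pos_part (\<lambda>x. - Im (\<phi> x)) \<in> Ccp X"
    using K(2) ri by (intro *; simp)+
qed

text \<open>Applied to point evaluation this returns the function itself, so complex integrals
  reduce to four real ones without a proof that the extension is linear.\<close>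

definition complexify :: "(('a \<Rightarrow> real) \<Rightarrow> real) \<Rightarrow> ('a \<Rightarrow> complex) \<Rightarrow> complex" where
  "complexify L \<phi> = complex_of_real (L (pos_part (\<lambda>x. Re (\<phi> x))) - L (pos_part (\<lambda>x. - Re (\<phi> x))))
    + \<i> * complex_of_real (L (pos_part (\<lambda>x. Im (\<phi> x))) - L (pos_part (\<lambda>x. - Im (\<phi> x))))"

lemma complexify_eval: "complexify (\<lambda>f. f x) \<phi> = \<phi> x"
  by (simp add: complexify_def pos_part_def complex_eq_iff max_def)

lemma complexify_cong:
  assumes "\<phi> \<in> Cc X" "\<And>f. f \<in> Ccp X \<Longrightarrow> L f = L' f"
  shows "complexify L \<phi> = complexify L' \<phi>"
  unfolding complexify_def using assms Cc_parts[OF assms(1)] by simp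

text \<open>The parameter F covers two uses: the identity, and the cut-off translation in the
  invariance axiom.\<close>

lemma integral_complexify:
  assumes \<phi>: "\<phi> \<in> Cc X" and F: "\<And>f. f \<in> Ccp X \<Longrightarrow> integrable M (F f)"
  shows "integral\<^sup>L M (\<lambda>y. complexify (\<lambda>f. F f y) \<phi>) = complexify (\<lambda>f. integral\<^sup>L M (F f)) \<phi>"
proof -
  note I = F[OF Cc_parts(1)[OF \<phi>]] F[OF Cc_parts(2)[OF \<phi>]] F[OF Cc_parts(3)[OF \<phi>]] F[OF Cc_parts(4)[OF \<phi>]]
  have *: "integral\<^sup>L M (\<lambda>x. complex_of_real (f1 x - f2 x) + \<i> * complex_of_real (f3 x - f4 x))
    = complex_of_real (integral\<^sup>L M f1 - integral\<^sup>L M f2) + \<i> * complex_of_real (integral\<^sup>L M f3 - integral\<^sup>L M f4)"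
    if "integrable M f1" "integrable M f2" "integrable M f3" "integrable M f4" for f1 f2 f3 f4
  proof -
    have "integrable M (\<lambda>x. complex_of_real (f1 x - f2 x))" "integrable M (\<lambda>x. complex_of_real (f3 x - f4 x))"
      using that by (intro integrable_of_real Bochner_Integration.integrable_diff; simp)+
    then show ?thesis
      using that by (simp add: Bochner_Integration.integral_add del: of_real_diff)
  qed
  show ?thesis unfolding complexify_def by (rule *[OF I])
qed

lemma Ccp_of_real_Cc: "f \<in> Ccp X \<Longrightarrow> (\<lambda>x. complex_of_real (f x)) \<in> Cc X"
  unfolding Ccp_def Cc_def continuous_map_nhdsin by (auto intro!: tendsto_of_real)

section \<open>Topology and algebra of the quotient\<close>

locale quot_groupoid = stab_groupoid TG TX r s e m i
  for TG :: "'g topology" and TX :: "'x topology"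
    and r s :: "'g \<Rightarrow> 'x" and e :: "'x \<Rightarrow> 'g" and m :: "'g \<Rightarrow> 'g \<Rightarrow> 'g" and i :: "'g \<Rightarrow> 'g" +
  fixes TGb :: "'g set topology"
  assumes quot: "quotient_map TG TGb (arrow_class (topspace TG) r s)"
begin

abbreviation "q \<equiv> arrow_class Gs r s"
abbreviation "rb \<equiv> qr r"
abbreviation "sb \<equiv> qr s"
abbreviation "eb \<equiv> qe Gs r s e"
abbreviation "mb \<equiv> qm Gs r s m"
abbreviation "ib \<equiv> qi Gs r s i"

lemma topspace_TGb: "topspace TGb = q ` Gs"
  using quotient_imp_surjective_map[OF quot] by simp

lemma q_cont: "continuous_map TG TGb q"
  by (rule quotient_imp_continuous_map[OF quot])

lemma q_in [simp]: "g \<in> Gs \<Longrightarrow> q g \<in> topspace TGb"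
  unfolding topspace_TGb by blast

lemma q_eq_iff: "g \<in> Gs \<Longrightarrow> h \<in> Gs \<Longrightarrow> q g = q h \<longleftrightarrow> r g = r h \<and> s g = s h"
  unfolding arrow_class_def by auto

definition rep :: "'g set \<Rightarrow> 'g" where "rep c = (SOME g. g \<in> c)"

lemma rep_q: "g \<in> Gs \<Longrightarrow> rep (q g) \<in> Gs \<and> r (rep (q g)) = r g \<and> s (rep (q g)) = s g"
proof -
  assume g: "g \<in> Gs"
  then have "g \<in> q g" unfolding arrow_class_def by simp
  then have "rep (q g) \<in> q g" unfolding rep_def by (rule someI)
  then show ?thesis unfolding arrow_class_def by simp
qed

lemma rb_q [simp]: "g \<in> Gs \<Longrightarrow> rb (q g) = r g" and sb_q [simp]: "g \<in> Gs \<Longrightarrow> sb (q g) = s g"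
  using rep_q[of g] unfolding qr_def rep_def by auto

lemma eb_eq: "eb x = q (e x)"
  unfolding qe_def ..

lemma mb_q [simp]: "g \<in> Gs \<Longrightarrow> h \<in> Gs \<Longrightarrow> s g = r h \<Longrightarrow> mb (q g) (q h) = q (m g h)"
  using rep_q[of g] rep_q[of h] unfolding qm_def rep_def[symmetric] by (simp add: q_eq_iff)

lemma ib_q [simp]: "g \<in> Gs \<Longrightarrow> ib (q g) = q (i g)"
  using rep_q[of g] unfolding qi_def rep_def[symmetric] by (simp add: q_eq_iff)

lemma groupoid_TGb: "groupoid (topspace TGb) Xs rb sb eb mb ib"
  unfolding groupoid_def topspace_TGb eb_eq by (auto simp: m_assoc)

lemma q_open: "open_map TG TGb q"
  unfolding open_map_def
proof (intro allI impI)
  fix U assume U: "openin TG U"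
  have UG: "U \<subseteq> Gs" using openin_subset[OF U] .
  have "openin TG {g \<in> Gs. q g \<in> q ` U}"
  proof (subst openin_subopen, intro ballI)
    fix g assume "g \<in> {g \<in> Gs. q g \<in> q ` U}"
    then obtain k where g: "g \<in> Gs" and kU: "k \<in> U" "q g = q k" by blast
    then have k: "k \<in> U" "r k = r g" "s k = s g" using UG q_eq_iff[of g k] by auto
    have kG: "k \<in> Gs" using k UG by auto
    \<comment> \<open>h = k^-1 g lies in the stability group at \<open>s g\<close>, and g h^-1 = k
      is in U. For g' near g, openness of r provides a stability element h' over \<open>s g'\<close>
      close to h; then g' h'^-1 is in U and in the class of g'.\<close>
    let ?h = "m (i k) g"
    have h: "?h \<in> Gs" "r ?h = s g" "s ?h = s g" using k g kG by auto
    have "m g (i ?h) = k"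
    proof -
      have "m k ?h = g" using k g kG by simp
      then show ?thesis using m_cancel_i[of k ?h] k g kG h by simp
    qed
    then have gh: "s (id g) = r (i ?h)" "m (id g) (i ?h) \<in> U" using k h by simp_all
    obtain A B where AB: "openin TG A" "openin TG B" "g \<in> A" "?h \<in> B"
      "\<And>a b. a \<in> A \<Longrightarrow> b \<in> B \<Longrightarrow> s (id a) = r (i b) \<Longrightarrow> m (id a) (i b) \<in> U"
      by (rule mult_nhds[OF continuous_map_id cont_i U g h(1) gh]) blast
    let ?S = "{g \<in> Gs. r g = s g}"
    have "openin (subtopology TG ?S) (?S \<inter> B)" using openin_subtopology_Int2[OF AB(2)] .
    then have o: "openin TX (r ` (?S \<inter> B))" using stab_open unfolding open_map_def by blast
    have "?h \<in> ?S \<inter> B" using h AB by simp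
    then have "r ?h \<in> r ` (?S \<inter> B)" by (rule imageI)
    then have sg: "s g \<in> r ` (?S \<inter> B)" using h by simp
    have "openin TG (A \<inter> {g \<in> Gs. s g \<in> r ` (?S \<inter> B)})"
      using AB(1) openin_continuous_map_preimage[OF cont_s o] by blast
    moreover have "A \<inter> {g \<in> Gs. s g \<in> r ` (?S \<inter> B)} \<subseteq> {g \<in> Gs. q g \<in> q ` U}"
    proof
      fix g' assume "g' \<in> A \<inter> {g \<in> Gs. s g \<in> r ` (?S \<inter> B)}"
      then obtain h' where g': "g' \<in> A" "g' \<in> Gs" and h': "h' \<in> B" "h' \<in> Gs" "r h' = s h'" "s g' = r h'" by blast
      then have U': "m g' (i h') \<in> U" using AB(5)[of g' h'] by simp
      moreover have "q g' = q (m g' (i h'))" using g' h' by (subst q_eq_iff) auto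
      ultimately show "g' \<in> {g \<in> Gs. q g \<in> q ` U}" using g' by blast
    qed
    ultimately show "\<exists>T. openin TG T \<and> g \<in> T \<and> T \<subseteq> {g \<in> Gs. q g \<in> q ` U}"
      using AB(3) g sg by (intro exI[of _ "A \<inter> {g \<in> Gs. s g \<in> r ` (?S \<inter> B)}"]) simp
  qed
  moreover have "q ` U \<subseteq> topspace TGb" using UG topspace_TGb by blast
  ultimately show "openin TGb (q ` U)" using quot unfolding quotient_map_def by blast
qed

lemma cont_rb: "continuous_map TGb TX rb" and cont_sb: "continuous_map TGb TX sb"
proof -
  have "continuous_map TG TX (rb \<circ> q)" by (rule continuous_map_eq[OF cont_r]) simp
  then show "continuous_map TGb TX rb" by (rule continuous_compose_quotient_map[OF quot])
  have "continuous_map TG TX (sb \<circ> q)" by (rule continuous_map_eq[OF cont_s]) simp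
  then show "continuous_map TGb TX sb" by (rule continuous_compose_quotient_map[OF quot])
qed

text \<open>A product of quotient maps need not be a quotient map. Openness of q makes images of
  product neighbourhoods open, and representatives of composable classes are always
  composable.\<close>

lemma cont_mb:
  "continuous_map (subtopology (prod_topology TGb TGb) (composable (topspace TGb) rb sb)) TGb (\<lambda>(a, b). mb a b)"
  (is "continuous_map (subtopology ?P ?C) TGb ?f")
proof -
  have sub: "?C \<subseteq> topspace ?P" unfolding composable_def by auto
  have ts: "topspace (subtopology ?P ?C) = ?C" using sub by auto
  have "openin (subtopology ?P ?C) {p \<in> ?C. ?f p \<in> W}" if W: "openin TGb W" for W
  proof (subst openin_subopen, intro ballI)
    fix p assume p: "p \<in> {p \<in> ?C. ?f p \<in> W}"
    then obtain g h where gh: "p = (q g, q h)" "g \<in> Gs" "h \<in> Gs" "s g = r h"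
      unfolding composable_def topspace_TGb by auto
    have "openin TG {k \<in> Gs. q k \<in> W}" by (rule openin_continuous_map_preimage[OF q_cont W])
    then obtain A B where AB: "openin TG A" "openin TG B" "g \<in> A" "h \<in> B"
      "\<And>a b. a \<in> A \<Longrightarrow> b \<in> B \<Longrightarrow> s (id a) = r (id b) \<Longrightarrow> m (id a) (id b) \<in> {k \<in> Gs. q k \<in> W}"
      by (rule mult_nhds[OF continuous_map_id continuous_map_id _ gh(2,3)]) (use p gh in auto)
    have "openin ?P (q ` A \<times> q ` B)"
      using AB q_open unfolding open_map_def by (simp add: openin_prod_Times_iff)
    then have "openin (subtopology ?P ?C) ((q ` A \<times> q ` B) \<inter> ?C)" unfolding openin_subtopology by blast
    moreover have "p \<in> (q ` A \<times> q ` B) \<inter> ?C" using p gh AB by auto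
    moreover have "(q ` A \<times> q ` B) \<inter> ?C \<subseteq> {p \<in> ?C. ?f p \<in> W}"
    proof
      fix p' assume p': "p' \<in> (q ` A \<times> q ` B) \<inter> ?C"
      then obtain a b where ab: "p' = (q a, q b)" "a \<in> A" "b \<in> B" by auto
      have abG: "a \<in> Gs" "b \<in> Gs" using ab AB openin_subset by blast+
      have sr: "s a = r b" using p' ab abG unfolding composable_def by simp
      then have "q (m a b) \<in> W" using ab AB(5)[of a b] by simp
      then show "p' \<in> {p \<in> ?C. ?f p \<in> W}" using p' ab abG sr by simp
    qed
    ultimately show "\<exists>T. openin (subtopology ?P ?C) T \<and> p \<in> T \<and> T \<subseteq> {p \<in> ?C. ?f p \<in> W}" by blast
  qed
  moreover have "?f \<in> ?C \<rightarrow> topspace TGb"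
    unfolding composable_def topspace_TGb by auto
  ultimately show ?thesis unfolding continuous_map_def ts by blast
qed

lemma Hausdorff_TGb: "Hausdorff_space TGb"
  unfolding Hausdorff_space_def
proof (intro allI impI)
  fix c d assume cd: "c \<in> topspace TGb \<and> d \<in> topspace TGb \<and> c \<noteq> d"
  have sep: "\<exists>U V. openin TGb U \<and> openin TGb V \<and> c \<in> U \<and> d \<in> V \<and> disjnt U V"
    if f: "continuous_map TGb TX f" and ne: "f c \<noteq> f d" for f
  proof -
    have "f c \<in> Xs" "f d \<in> Xs" using continuous_map_image_subset_topspace[OF f] cd by auto
    then obtain U V where UV: "openin TX U" "openin TX V" "f c \<in> U" "f d \<in> V" "disjnt U V"
      using X.haus ne unfolding Hausdorff_space_def by blast
    show ?thesis
      using openin_continuous_map_preimage[OF f UV(1)] openin_continuous_map_preimage[OF f UV(2)] UV cd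
      by (intro exI[of _ "{x \<in> topspace TGb. f x \<in> U}"] exI[of _ "{x \<in> topspace TGb. f x \<in> V}"])
        (auto simp: disjnt_def)
  qed
  obtain g h where gh: "g \<in> Gs" "c = q g" "h \<in> Gs" "d = q h" using cd unfolding topspace_TGb by blast
  then have "rb c \<noteq> rb d \<or> sb c \<noteq> sb d" using cd q_eq_iff[of g h] by auto
  then show "\<exists>U V. openin TGb U \<and> openin TGb V \<and> c \<in> U \<and> d \<in> V \<and> disjnt U V"
    using sep[OF cont_rb] sep[OF cont_sb] by blast
qed

lemma locally_compact_groupoid_TGb: "locally_compact_groupoid TGb TX rb sb eb mb ib"
proof -
  have "continuous_map TG TGb (ib \<circ> q)"
    by (rule continuous_map_eq[OF continuous_map_compose[OF cont_i q_cont]]) simp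
  then have "continuous_map TGb TGb ib" by (rule continuous_compose_quotient_map[OF quot])
  moreover have "continuous_map TX TGb eb"
    using continuous_map_compose[OF cont_e q_cont] by (simp add: o_def eb_eq[abs_def])
  moreover have "locally_compact_space TGb"
    by (rule locally_compact_space_continuous_open_map_image[OF q_cont q_open topspace_TGb[symmetric] G.loc_comp])
  ultimately show ?thesis
    unfolding locally_compact_groupoid_def topological_groupoid_def
    using groupoid_TGb cont_rb cont_sb cont_mb Hausdorff_TGb X.loc_comp X.haus by blast
qed

lemma open_map_rb:
  assumes "open_map TG TX r"
  shows "open_map TGb TX rb"
  unfolding open_map_def
proof (intro allI impI)
  fix U assume U: "openin TGb U"
  have "openin TG {g \<in> Gs. q g \<in> U}" by (rule openin_continuous_map_preimage[OF q_cont U])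
  moreover have "rb ` U = r ` {g \<in> Gs. q g \<in> U}"
  proof -
    have "U = q ` {g \<in> Gs. q g \<in> U}" using openin_subset[OF U] unfolding topspace_TGb by auto
    then have "rb ` U = (\<lambda>g. rb (q g)) ` {g \<in> Gs. q g \<in> U}" by (metis image_image)
    also have "\<dots> = r ` {g \<in> Gs. q g \<in> U}" by (rule image_cong) auto
    finally show ?thesis .
  qed
  ultimately show "openin TX (rb ` U)" using assms unfolding open_map_def by simp
qed

end

section \<open>Transport of a Haar system from the quotient\<close>

locale quot_haar = quot_groupoid TG TX r s e m i TGb + cont_haar_family TG TX r s e m i J
  for TG :: "'g topology" and TX :: "'x topology"
    and r s :: "'g \<Rightarrow> 'x" and e :: "'x \<Rightarrow> 'g" and m :: "'g \<Rightarrow> 'g \<Rightarrow> 'g" and i :: "'g \<Rightarrow> 'g"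
    and TGb :: "'g set topology" and J +
  fixes \<mu> :: "'x \<Rightarrow> 'g set measure"
  assumes haar: "haar_system TGb TX (qr r) (qr s) (qm (topspace TG) r s m) \<mu>"
begin

lemma mu_radon: "x \<in> Xs \<Longrightarrow> radon_measure TGb (\<mu> x)"
  using haar unfolding haar_system_def by blast

lemma mu_support: "x \<in> Xs \<Longrightarrow> measure_support TGb (\<mu> x) = {c \<in> topspace TGb. rb c = x}"
  using haar unfolding haar_system_def by blast

lemma mu_inv:
  assumes f: "f \<in> Ccp TGb" and a: "\<alpha> \<in> Gs"
  shows "integral\<^sup>L (\<mu> (s \<alpha>)) (\<lambda>c. if c \<in> topspace TGb \<and> rb c = s \<alpha> then f (mb (q \<alpha>) c) else 0)
    = integral\<^sup>L (\<mu> (r \<alpha>)) f"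
proof -
  let ?f = "\<lambda>x. complex_of_real (f x)"
  have "integral\<^sup>L (\<mu> (sb (q \<alpha>))) (\<lambda>c. if c \<in> topspace TGb \<and> rb c = sb (q \<alpha>) then ?f (mb (q \<alpha>) c) else 0)
    = integral\<^sup>L (\<mu> (rb (q \<alpha>))) ?f"
    using haar[unfolded haar_system_def, THEN conjunct2, THEN conjunct2, THEN conjunct1,
        THEN bspec[OF _ Ccp_of_real_Cc[OF f]], THEN bspec[OF _ q_in[OF a]]] .
  moreover have "(\<lambda>c. if c \<in> topspace TGb \<and> rb c = s \<alpha> then ?f (mb (q \<alpha>) c) else 0)
    = (\<lambda>c. complex_of_real (if c \<in> topspace TGb \<and> rb c = s \<alpha> then f (mb (q \<alpha>) c) else 0))"
    by (rule ext) simp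
  ultimately show ?thesis using a by simp
qed

lemma mu_cont:
  assumes f: "f \<in> Ccp TGb"
  shows "continuous_map TX euclideanreal (\<lambda>x. integral\<^sup>L (\<mu> x) f)"
proof -
  have "continuous_map TX euclidean (\<lambda>x. integral\<^sup>L (\<mu> x) (\<lambda>c. complex_of_real (f c)))"
    using haar Ccp_of_real_Cc[OF f] unfolding haar_system_def by blast
  then have "continuous_map TX euclidean (\<lambda>x. complex_of_real (integral\<^sup>L (\<mu> x) f))" by simp
  then show ?thesis unfolding continuous_map_nhdsin by (auto simp: tendsto_of_real_iff)
qed

definition Phib :: "('g \<Rightarrow> real) \<Rightarrow> 'g set \<Rightarrow> real" where
  "Phib \<phi> c = Phi \<phi> (rep c)"

lemma Phib_q: "\<phi> \<in> Ccp TG \<Longrightarrow> g \<in> Gs \<Longrightarrow> Phib \<phi> (q g) = Phi \<phi> g"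
  unfolding Phib_def using rep_q[of g] Phi_class[of \<phi> g "rep (q g)"] by blast

lemma Phib_Ccp:
  assumes p: "\<phi> \<in> Ccp TG"
  shows "Phib \<phi> \<in> Ccp TGb"
proof -
  obtain K where K: "compactin TG K" "\<And>x. x \<in> Gs \<Longrightarrow> x \<notin> K \<Longrightarrow> \<phi> x = 0"
    using Ccp_supp[OF p] by metis
  have KG: "K \<subseteq> Gs" using K(1) compactin_subset_topspace by blast
  show ?thesis
  proof (rule CcpI)
    have "continuous_map TG euclideanreal (Phib \<phi> \<circ> q)"
      by (rule continuous_map_eq[OF Phi_cont[OF p]]) (simp add: Phib_q[OF p])
    then show "continuous_map TGb euclideanreal (Phib \<phi>)"
      by (rule continuous_compose_quotient_map[OF quot])
    show "0 \<le> Phib \<phi> c" if "c \<in> topspace TGb" for c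
      using that Phi_nonneg[OF p] unfolding topspace_TGb by (auto simp: Phib_q[OF p])
    show "compactin TGb (q ` K)" by (rule image_compactin[OF K(1) q_cont])
    show "Phib \<phi> c = 0" if c: "c \<in> topspace TGb" "c \<notin> q ` K" for c
    proof -
      obtain g where g: "g \<in> Gs" "c = q g" using c unfolding topspace_TGb by blast
      have "Phi \<phi> g = 0"
      proof (rule Phi_zero[OF g(1)])
        fix k assume k: "k \<in> Gs" "r k = r g" "s k = s g"
        then have "q k = c" using g q_eq_iff by simp
        then show "\<phi> k = 0" using c(2) K(2)[OF k(1)] by blast
      qed
      then show ?thesis using g Phib_q[OF p] by simp
    qed
  qed
qed

definition Lam :: "'x \<Rightarrow> ('g \<Rightarrow> real) \<Rightarrow> real" where
  "Lam x \<phi> = integral\<^sup>L (\<mu> x) (Phib \<phi>)"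

lemma Phib_int: "x \<in> Xs \<Longrightarrow> \<phi> \<in> Ccp TG \<Longrightarrow> integrable (\<mu> x) (Phib \<phi>)"
  using radon_integrable_Ccp[OF Hausdorff_TGb mu_radon Phib_Ccp] .

lemma space_mu: "x \<in> Xs \<Longrightarrow> space (\<mu> x) = q ` Gs"
  using mu_radon[of x] topspace_TGb unfolding radon_measure_def by simp

lemma Lam_pf: "x \<in> Xs \<Longrightarrow> pos_functional TG (Lam x)"
proof unfold_locales
  assume x: "x \<in> Xs"
  fix f g :: "'g \<Rightarrow> real" and c :: real assume f: "f \<in> Ccp TG"
  show "Lam x (\<lambda>h. c * f h) = c * Lam x f" if "0 \<le> c"
  proof -
    have "Lam x (\<lambda>h. c * f h) = integral\<^sup>L (\<mu> x) (\<lambda>d. c * Phib f d)"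
      unfolding Lam_def using Phib_q[OF f] Phib_q[OF Ccp_scale[OF f that]] Phi_scale[OF f that] space_mu[OF x]
      by (intro Bochner_Integration.integral_cong) auto
    then show ?thesis unfolding Lam_def by simp
  qed
  assume g: "g \<in> Ccp TG"
  have "Lam x (\<lambda>h. f h + g h) = integral\<^sup>L (\<mu> x) (\<lambda>d. Phib f d + Phib g d)"
    unfolding Lam_def using Phib_q[OF f] Phib_q[OF g] Phib_q[OF Ccp_add[OF f g]] Phi_add[OF f g] space_mu[OF x]
    by (intro Bochner_Integration.integral_cong) auto
  then show "Lam x (\<lambda>h. f h + g h) = Lam x f + Lam x g"
    unfolding Lam_def using Phib_int[OF x f] Phib_int[OF x g] by simp
  assume fg: "\<And>h. h \<in> Gs \<Longrightarrow> f h \<le> g h"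
  show "Lam x f \<le> Lam x g"
    unfolding Lam_def
    using Phib_q[OF f] Phib_q[OF g] Phi_mono[OF f g _ fg] space_mu[OF x]
    by (intro integral_mono Phib_int[OF x] f g) auto
qed

definition nu :: "'x \<Rightarrow> 'g measure" where
  "nu x = pos_functional.riesz TG (Lam x)"

lemma nu_radon: "x \<in> Xs \<Longrightarrow> radon_measure TG (nu x)"
  unfolding nu_def by (rule pos_functional.radon_riesz[OF Lam_pf])

lemma nu_integral: "x \<in> Xs \<Longrightarrow> \<phi> \<in> Ccp TG \<Longrightarrow> integral\<^sup>L (nu x) \<phi> = Lam x \<phi>"
  unfolding nu_def by (rule pos_functional.integral_riesz[OF Lam_pf])

lemma nu_support:
  assumes x: "x \<in> Xs"
  shows "measure_support TG (nu x) = {g \<in> Gs. r g = x}"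
proof -
  interpret L: pos_functional TG "Lam x" by (rule Lam_pf[OF x])
  have em: "emeasure (nu x) U = L.open_val U" if "openin TG U" for U
    unfolding nu_def by (rule L.emeasure_riesz_open[OF that])
  have ae: "AE c in \<mu> x. c \<in> topspace TGb \<and> rb c = x"
    using radon_AE_support[OF mu_radon[OF x]] unfolding mu_support[OF x] by simp
  have "r g = x" if g: "g \<in> measure_support TG (nu x)" for g
  proof (rule ccontr)
    assume ne: "r g \<noteq> x"
    have gG: "g \<in> Gs" using g unfolding measure_support_def by blast
    let ?U = "{h \<in> Gs. r h \<in> Xs - {x}}"
    have "openin TX (Xs - {x})" using x X.haus by (simp add: closedin_Hausdorff_sing_eq openin_diff)
    then have U: "openin TG ?U" by (rule openin_continuous_map_preimage[OF cont_r])
    \<comment> \<open>A competitor f vanishes over x, so \<open>Phib f\<close> vanishes on the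
      classes with range x, which carry all of \<open>\<mu> x\<close>.\<close>
    have "L.open_val ?U \<le> 0"
      unfolding L.open_val_def
    proof (rule SUP_least)
      fix f assume "f \<in> {f. L.below ?U f}"
      then have f: "f \<in> Ccp TG" and "\<exists>C. C \<subseteq> ?U \<and> (\<forall>h\<in>Gs - C. f h = 0)" unfolding L.below_def by blast+
      then have z: "f h = 0" if "h \<in> Gs" "r h = x" for h using that by blast
      have "Phib f c = 0" if c: "c \<in> topspace TGb \<and> rb c = x" for c
      proof -
        obtain k where k: "k \<in> Gs" "c = q k" "r k = x" using c unfolding topspace_TGb by auto
        have "Phi f k = 0" by (rule Phi_zero[OF k(1)]) (use z k in auto)
        then show ?thesis using Phib_q[OF f k(1)] k by simp
      qed
      then have "AE c in \<mu> x. Phib f c = 0" using ae by auto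
      then have "Lam x f = 0" unfolding Lam_def by (rule integral_eq_zero_AE)
      then show "ennreal (Lam x f) \<le> 0" by simp
    qed
    then have "emeasure (nu x) ?U = 0" using em[OF U] by simp
    moreover have "g \<in> ?U" using gG ne by simp
    ultimately show False using g U unfolding measure_support_def by force
  qed
  moreover have "g \<in> measure_support TG (nu x)" if g: "g \<in> Gs" "r g = x" for g
    unfolding measure_support_def
  proof (intro CollectI conjI allI impI g)
    fix U assume U: "openin TG U \<and> g \<in> U"
    then have "{g} \<subseteq> U" "openin TG U" by auto
    obtain f C where f: "f \<in> Ccp TG" "compactin TG C" "C \<subseteq> U" "{g} \<subseteq> C"
      "\<And>x. x \<in> Gs \<Longrightarrow> 0 \<le> f x \<and> f x \<le> 1" "\<And>x. x \<in> {g} \<Longrightarrow> f x = 1" "\<And>x. x \<in> Gs \<Longrightarrow> x \<notin> C \<Longrightarrow> f x = 0"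
      by (rule G.Urysohn_Ccp[OF _ \<open>openin TG U\<close> \<open>{g} \<subseteq> U\<close>]) (use g in auto)
    have b: "L.below U f" unfolding L.below_def using f by auto
    have pos: "0 < Phib f (q g)" using Phi_pos[OF f(1) g(1)] f(6) Phib_q[OF f(1) g(1)] by simp
    have "Lam x f \<noteq> 0"
    proof
      assume "Lam x f = 0"
      have nn: "AE c in \<mu> x. 0 \<le> Phib f c"
        using CcpD(2)[OF Phib_Ccp[OF f(1)]] topspace_TGb space_mu[OF x] by (intro AE_I2) auto
      have "AE c in \<mu> x. Phib f c = 0"
        using integral_nonneg_eq_0_iff_AE[OF Phib_int[OF x f(1)] nn] \<open>Lam x f = 0\<close> unfolding Lam_def by simp
      \<comment> \<open>If \<open>Phib f\<close> vanished almost everywhere, this open set would be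
        null although it contains \<open>q g\<close>, a point of the support.\<close>
      let ?O = "{c \<in> topspace TGb. 0 < Phib f c}"
      have O': "openin TGb ?O" by (rule open_pos_set[OF CcpD(1)[OF Phib_Ccp[OF f(1)]]])
      have "AE c in \<mu> x. c \<notin> ?O" using \<open>AE c in \<mu> x. Phib f c = 0\<close> by auto
      then have "emeasure (\<mu> x) ?O = 0"
        using AE_iff_measurable[OF radon_openin_sets[OF mu_radon[OF x] O'], of "\<lambda>c. c \<notin> ?O"]
          topspace_TGb space_mu[OF x] by auto
      moreover have "q g \<in> measure_support TGb (\<mu> x)" unfolding mu_support[OF x] using g by simp
      moreover have "q g \<in> ?O" using pos g by simp
      ultimately show False using O' unfolding measure_support_def by force
    qed
    then have "0 < Lam x f" using L.nonneg[OF f(1)] by simp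
    then have "0 < ennreal (Lam x f)" by simp
    also have "\<dots> \<le> emeasure (nu x) U" using L.open_val_upper[OF b] em U by simp
    finally show "0 < emeasure (nu x) U" .
  qed
  ultimately show ?thesis unfolding measure_support_def by blast
qed

text \<open>The cut-off F is replaced by a \<psi> in the cone, whose integral is computed on the
  quotient. On the fibre carrying the measure \<open>Phib \<psi>\<close> is the translate of
  \<open>Phib \<phi>\<close>, so invariance of \<mu> applies.\<close>

lemma nu_inv:
  assumes p: "\<phi> \<in> Ccp TG" and a: "\<alpha> \<in> Gs"
  defines "F \<equiv> \<lambda>g. if g \<in> Gs \<and> r g = s \<alpha> then \<phi> (m \<alpha> g) else 0"
  shows "integrable (nu (s \<alpha>)) F" "integral\<^sup>L (nu (s \<alpha>)) F = Lam (r \<alpha>) \<phi>"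
proof -
  have x: "s \<alpha> \<in> Xs" "r \<alpha> \<in> Xs" using a by auto
  obtain \<psi> where psi: "\<psi> \<in> Ccp TG" "\<And>h. h \<in> Gs \<Longrightarrow> r h = s \<alpha> \<Longrightarrow> \<psi> h = \<phi> (m \<alpha> h)"
    by (rule translate_approx[OF p a]) blast
  have sup: "measure_support TG (nu (s \<alpha>)) \<subseteq> {g \<in> Gs. r g = s \<alpha>}" using nu_support[OF x(1)] by simp
  note R = radon_integral_restrict[OF G.haus nu_radon[OF x(1)] closedin_r_fibre[OF x(1)] sup psi(1), of F]
  show "integrable (nu (s \<alpha>)) F" by (rule R(1)) (auto simp: F_def psi(2))
  have "integral\<^sup>L (nu (s \<alpha>)) F = integral\<^sup>L (nu (s \<alpha>)) \<psi>" by (rule R(2)) (auto simp: F_def psi(2))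
  also have "\<dots> = integral\<^sup>L (\<mu> (s \<alpha>)) (Phib \<psi>)" using nu_integral[OF x(1) psi(1)] unfolding Lam_def .
  also have "\<dots> = integral\<^sup>L (\<mu> (s \<alpha>)) (\<lambda>c. if c \<in> topspace TGb \<and> rb c = s \<alpha> then Phib \<phi> (mb (q \<alpha>) c) else 0)"
  proof (rule radon_integral_restrict(2)[OF Hausdorff_TGb mu_radon[OF x(1)] _ _ Phib_Ccp[OF psi(1)], symmetric])
    let ?A = "{c \<in> topspace TGb. rb c = s \<alpha>}"
    show "closedin TGb ?A" using measure_support_closedin[of TGb "\<mu> (s \<alpha>)"] mu_support[OF x(1)] by simp
    show "measure_support TGb (\<mu> (s \<alpha>)) \<subseteq> ?A" using mu_support[OF x(1)] by simp
    fix c assume c: "c \<in> ?A"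
    then obtain g where g: "g \<in> Gs" "c = q g" "r g = s \<alpha>" unfolding topspace_TGb by auto
    have "Phib \<phi> (mb (q \<alpha>) c) = Phi \<phi> (m \<alpha> g)" using g a Phib_q[OF p] by simp
    also have "\<dots> = Phi \<psi> g" using Phi_translate[OF p psi(1) a g(1)] g psi(2) by simp
    finally show "(if c \<in> topspace TGb \<and> rb c = s \<alpha> then Phib \<phi> (mb (q \<alpha>) c) else 0) = Phib \<psi> c"
      using c g Phib_q[OF psi(1)] by simp
  qed auto
  also have "\<dots> = Lam (r \<alpha>) \<phi>" unfolding Lam_def by (rule mu_inv[OF Phib_Ccp[OF p] a])
  finally show "integral\<^sup>L (nu (s \<alpha>)) F = Lam (r \<alpha>) \<phi>" .
qed

lemma nu_integral_complex:
  assumes x: "x \<in> Xs" and p: "\<phi> \<in> Cc TG"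
  shows "integral\<^sup>L (nu x) \<phi> = complexify (Lam x) \<phi>"
proof -
  have "integral\<^sup>L (nu x) (\<lambda>g. complexify (\<lambda>f. f g) \<phi>) = complexify (\<lambda>f. integral\<^sup>L (nu x) f) \<phi>"
    by (rule integral_complexify[OF p radon_integrable_Ccp[OF G.haus nu_radon[OF x]]])
  also have "\<dots> = complexify (Lam x) \<phi>" by (rule complexify_cong[OF p nu_integral[OF x]])
  finally show ?thesis by (simp add: complexify_eval)
qed

lemma nu_inv_complex:
  assumes p: "\<phi> \<in> Cc TG" and a: "\<alpha> \<in> Gs"
  shows "integral\<^sup>L (nu (s \<alpha>)) (\<lambda>g. if g \<in> Gs \<and> r g = s \<alpha> then \<phi> (m \<alpha> g) else 0) = integral\<^sup>L (nu (r \<alpha>)) \<phi>"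
proof -
  define F where "F f g = (if g \<in> Gs \<and> r g = s \<alpha> then f (m \<alpha> g) else (0::real))" for f g
  have FI: "integrable (nu (s \<alpha>)) (F f)" "integral\<^sup>L (nu (s \<alpha>)) (F f) = Lam (r \<alpha>) f" if "f \<in> Ccp TG" for f
    using nu_inv[OF that a] unfolding F_def by auto
  \<comment> \<open>Outside the fibre all four parts are cut to 0, so the cut-off commutes with
    \<open>complexify\<close>.\<close>
  have "(if g \<in> Gs \<and> r g = s \<alpha> then \<phi> (m \<alpha> g) else 0) = complexify (\<lambda>f. F f g) \<phi>" for g
    using complexify_eval[of "m \<alpha> g" \<phi>] unfolding F_def by (simp add: complexify_def)
  then have "integral\<^sup>L (nu (s \<alpha>)) (\<lambda>g. if g \<in> Gs \<and> r g = s \<alpha> then \<phi> (m \<alpha> g) else 0)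
    = integral\<^sup>L (nu (s \<alpha>)) (\<lambda>g. complexify (\<lambda>f. F f g) \<phi>)" by presburger
  also have "\<dots> = complexify (\<lambda>f. integral\<^sup>L (nu (s \<alpha>)) (F f)) \<phi>"
    by (rule integral_complexify[OF p FI(1)])
  also have "\<dots> = complexify (Lam (r \<alpha>)) \<phi>" by (rule complexify_cong[OF p FI(2)])
  finally show ?thesis using nu_integral_complex[OF r_in[OF a] p] by simp
qed

lemma nu_cont:
  assumes p: "\<phi> \<in> Cc TG"
  shows "continuous_map TX euclidean (\<lambda>x. integral\<^sup>L (nu x) \<phi>)"
proof -
  have L: "continuous_map TX euclideanreal (\<lambda>x. Lam x f)" if "f \<in> Ccp TG" for f
    unfolding Lam_def by (rule mu_cont[OF Phib_Ccp[OF that]])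
  have "continuous_map TX euclidean (\<lambda>x. complexify (Lam x) \<phi>)"
    using L[OF Cc_parts(1)[OF p]] L[OF Cc_parts(2)[OF p]] L[OF Cc_parts(3)[OF p]] L[OF Cc_parts(4)[OF p]]
    unfolding continuous_map_nhdsin complexify_def
    by (intro ballI tendsto_add tendsto_mult tendsto_const tendsto_of_real tendsto_diff) auto
  then show ?thesis by (rule continuous_map_eq) (simp add: nu_integral_complex[OF _ p])
qed

theorem haar_system_nu: "haar_system TG TX r s m nu"
  unfolding haar_system_def using nu_radon nu_support nu_inv_complex nu_cont by blast

end

theorem theorem2p6:
  fixes TG :: "'g topology" and TX :: "'x topology"
    and r s :: "'g \<Rightarrow> 'x" and e :: "'x \<Rightarrow> 'g"
    and m :: "'g \<Rightarrow> 'g \<Rightarrow> 'g" and i :: "'g \<Rightarrow> 'g"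
    and TGb :: "'g set topology"
  assumes G: "locally_compact_groupoid TG TX r s e m i"
    and para: "paracompact_space TX"
    and stab_open: "open_map (subtopology TG {g \<in> topspace TG. r g = s g}) TX r"
    and quot: "quotient_map TG TGb (arrow_class (topspace TG) r s)"
  shows "(locally_compact_groupoid TGb TX (qr r) (qr s) (qe (topspace TG) r s e)
            (qm (topspace TG) r s m) (qi (topspace TG) r s i)
          \<and> open_map TG TGb (arrow_class (topspace TG) r s))
       \<and> (open_map TG TX r \<longrightarrow> open_map TGb TX (qr r))
       \<and> ((\<exists>\<mu>. haar_system TGb TX (qr r) (qr s) (qm (topspace TG) r s m) \<mu>)
            \<longrightarrow> (\<exists>\<nu>. haar_system TG TX r s m \<nu>))"
proof -
  have st: "stab_groupoid TG TX r s e m i"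
    by (intro stab_groupoid.intro lc_groupoid.intro stab_groupoid_axioms.intro G stab_open)
  have qg: "quot_groupoid TG TX r s e m i TGb"
    by (intro quot_groupoid.intro quot_groupoid_axioms.intro st quot)
  obtain J0 where "haar_family TG TX r s e m i J0"
    using stab_groupoid.haar_family_exists[OF st] by blast
  then obtain J where J: "cont_haar_family TG TX r s e m i J"
    using haar_family.cont_haar_family_exists para by blast
  have "haar_system TG TX r s m (quot_haar.nu TG s m J \<mu>)"
    if "haar_system TGb TX (qr r) (qr s) (qm (topspace TG) r s m) \<mu>" for \<mu>
    by (rule quot_haar.haar_system_nu[OF quot_haar.intro[OF qg J quot_haar_axioms.intro[OF that]]])
  then show ?thesis
    using quot_groupoid.locally_compact_groupoid_TGb[OF qg] quot_groupoid.q_open[OF qg]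
      quot_groupoid.open_map_rb[OF qg] by blast
qed

end
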